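(* There is an algorithm, running in time polynomial in $m$ and $n$, which, given a polytope $P$ represented by a slack matrix $S\in\mathbb{R}^{m\times n}$ of $P$, correctly determines whether $P$ is affinely equivalent to a Cartesian product $P_1\times P_2$ of two polytopes and, in case it is, outputs two matrices $S_1,S_2$ such that $S_i$ is a slack matrix of $P_i$ for $i\in\{1,2\}$ (for some such $P_1,P_2$). Here all slack matrices considered ($S$, $S_1$, $S_2$) have rank at least $2$; equivalently, $P$, $P_1$, $P_2$ all have dimension at least $1$.
   Context: If $P_1\subseteq\mathbb{R}^{d_1}$ and $P_2\subseteq\mathbb{R}^{d_2}$ are polytopes, their Cartesian product is $P_1\times P_2:=\{(x_1,x_2)\in\mathbb{R}^{d_1}\times\mathbb{R}^{d_2}\mid x_1\in P_1,\ x_2\in P_2\}$. Let $P\subseteq\mathbb{R}^d$ be a polytope with $P=\mathrm{conv}(\{v_1,\dots,v_n\})$ and let $Ax\leq b$, with $A\in\mathbb{R}^{m\times d}$, $b\in\mathbb{R}^m$, be a system of inequalities describing $P$. The slack matrix of $P$ associated to these descriptions is $S\in\mathbb{R}^{m\times n}_+$ with $S_{i,j}:=b_i-A_iv_j$. The system $Ax\leq b$ describes $P$ inside its affine hull, i.e. $P=\{x\in\mathrm{aff}(P)\mid Ax\leq b\}$: equations valid for $P$ may be used in the description but contribute no rows. The inequalities need not be facet-defining and the $v_j$ need not be vertices. *)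

theory Defs
  imports "HOL-Analysis.Analysis" "HOL-Analysis.Finite_Function_Topology" "Jordan_Normal_Form.DL_Rank"
begin

section \<open>Polytopes and slack matrices\<close>

text \<open>
  The dimension of the ambient space has to be quantified inside formulas, so \<open>\<real>\<^sup>d\<close> cannot be a
  type here.  It is rendered as the set of those finitely supported sequences whose support lies in
  \<open>{..<d}\<close>.  The type \<^typ>\<open>nat \<Rightarrow>\<^sub>0 real\<close> is a real vector space, so \<^term>\<open>(hull)\<close>, \<^const>\<open>polytope\<close>,
  \<^const>\<open>affine\<close> and \<^const>\<open>convex\<close> are those of the library.
\<close>

definition coord_space :: "nat \<Rightarrow> (nat \<Rightarrow>\<^sub>0 real) set" where
  "coord_space d = {x. Poly_Mapping.keys x \<subseteq> {..<d}}"

definition row_eval :: "real mat \<Rightarrow> nat \<Rightarrow> (nat \<Rightarrow>\<^sub>0 real) \<Rightarrow> real" where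
  "row_eval A i x = (\<Sum>k<dim_col A. A $$ (i, k) * Poly_Mapping.lookup x k)"

text \<open>
  The points \<open>v j\<close> may repeat and need not be vertices, the inequalities may be redundant, and they
  have to describe \<open>P\<close> only within its affine hull.
\<close>

definition is_slack_matrix :: "nat \<Rightarrow> (nat \<Rightarrow>\<^sub>0 real) set \<Rightarrow> real mat \<Rightarrow> bool" where
  "is_slack_matrix d P S \<longleftrightarrow>
     (\<exists>(A :: real mat) (b :: real Matrix.vec) (v :: nat \<Rightarrow> (nat \<Rightarrow>\<^sub>0 real)).
        A \<in> carrier_mat (dim_row S) d \<and> b \<in> carrier_vec (dim_row S) \<and>
        (\<forall>j<dim_col S. v j \<in> coord_space d) \<and>
        P = convex hull (v ` {..<dim_col S}) \<and>
        P = {x \<in> affine hull P. \<forall>i<dim_row S. row_eval A i x \<le> vec_index b i} \<and>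
        (\<forall>i<dim_row S. \<forall>j<dim_col S. S $$ (i, j) = vec_index b i - row_eval A i (v j)))"

text \<open>The constant \<^const>\<open>vec_space.rank\<close> takes the length of the columns as a parameter.\<close>

definition mat_rank :: "real mat \<Rightarrow> nat" where
  "mat_rank S = vec_space.rank (dim_row S) S"

text \<open>
  For a nonempty set, the dimension of its affine hull, as the dimension of the space of directions.
  (The constant \<^const>\<open>aff_dim\<close> is restricted to Euclidean spaces.)
\<close>

definition affine_dim :: "'a::real_vector set \<Rightarrow> nat" where
  "affine_dim P = dim {x - y | x y. x \<in> P \<and> y \<in> P}"

definition affinely_equivalent :: "'a::real_vector set \<Rightarrow> 'b::real_vector set \<Rightarrow> bool" where
  "affinely_equivalent P Q \<longleftrightarrow>
     (\<exists>f c. linear f \<and> inj_on (\<lambda>x. f x + c) (affine hull P) \<and> (\<lambda>x. f x + c) ` P = Q)"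

definition is_factorization ::
  "(nat \<Rightarrow>\<^sub>0 real) set \<Rightarrow> nat \<Rightarrow> (nat \<Rightarrow>\<^sub>0 real) set \<Rightarrow> nat \<Rightarrow> (nat \<Rightarrow>\<^sub>0 real) set \<Rightarrow> bool" where
  "is_factorization P d1 P1 d2 P2 \<longleftrightarrow>
     polytope P1 \<and> P1 \<subseteq> coord_space d1 \<and> 1 \<le> affine_dim P1 \<and>
     polytope P2 \<and> P2 \<subseteq> coord_space d2 \<and> 1 \<le> affine_dim P2 \<and>
     affinely_equivalent P (P1 \<times> P2)"


section \<open>Real random access machines\<close>

text \<open>
  The model of computation is the uniform real RAM (Blum-Shub-Smale model with indirect addressing).
  A real register holds an exact real number; the field operations and comparisons on real registers
  take one time unit, and there is no rounding to integers.  Index registers hold natural numbers and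
  support only addition and truncated subtraction, so that within \<open>t\<close> steps the bit length of an index
  grows by at most \<open>O(t)\<close>.  The only constants available to a program are natural numbers.  Registers
  are named directly by the program, whereas the two memories are addressed through index registers.
  Results are appended to a write-only output tape.
\<close>

record ram_state =
  nreg :: "nat \<Rightarrow> nat"
  rreg :: "nat \<Rightarrow> real"
  nmem :: "nat \<Rightarrow> nat"
  rmem :: "nat \<Rightarrow> real"
  tape :: "real list"

datatype instr =
    NConst nat nat
  | NAdd nat nat nat
  | NSub nat nat nat
  | NLoad nat nat
  | NStore nat nat
  | RConst nat nat
  | RAdd nat nat nat
  | RSub nat nat nat
  | RMul nat nat nat
  | RDiv nat nat nat
  | RLoad nat nat
  | RStore nat nat
  | Emit nat

text \<open>Division by zero yields zero, as everywhere in HOL.\<close>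

fun step :: "instr \<Rightarrow> ram_state \<Rightarrow> ram_state" where
  "step (NConst a c) s = s\<lparr>nreg := (nreg s)(a := c)\<rparr>"
| "step (NAdd a b c) s = s\<lparr>nreg := (nreg s)(a := nreg s b + nreg s c)\<rparr>"
| "step (NSub a b c) s = s\<lparr>nreg := (nreg s)(a := nreg s b - nreg s c)\<rparr>"
| "step (NLoad a b) s = s\<lparr>nreg := (nreg s)(a := nmem s (nreg s b))\<rparr>"
| "step (NStore a b) s = s\<lparr>nmem := (nmem s)(nreg s a := nreg s b)\<rparr>"
| "step (RConst a c) s = s\<lparr>rreg := (rreg s)(a := real c)\<rparr>"
| "step (RAdd a b c) s = s\<lparr>rreg := (rreg s)(a := rreg s b + rreg s c)\<rparr>"
| "step (RSub a b c) s = s\<lparr>rreg := (rreg s)(a := rreg s b - rreg s c)\<rparr>"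
| "step (RMul a b c) s = s\<lparr>rreg := (rreg s)(a := rreg s b * rreg s c)\<rparr>"
| "step (RDiv a b c) s = s\<lparr>rreg := (rreg s)(a := rreg s b / rreg s c)\<rparr>"
| "step (RLoad a b) s = s\<lparr>rreg := (rreg s)(a := rmem s (nreg s b))\<rparr>"
| "step (RStore a b) s = s\<lparr>rmem := (rmem s)(nreg s a := rreg s b)\<rparr>"
| "step (Emit a) s = s\<lparr>tape := tape s @ [rreg s a]\<rparr>"

datatype test =
    NLess nat nat
  | NEq nat nat
  | RLess nat nat
  | REq nat nat

fun holds :: "test \<Rightarrow> ram_state \<Rightarrow> bool" where
  "holds (NLess a b) s \<longleftrightarrow> nreg s a < nreg s b"
| "holds (NEq a b) s \<longleftrightarrow> nreg s a = nreg s b"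
| "holds (RLess a b) s \<longleftrightarrow> rreg s a < rreg s b"
| "holds (REq a b) s \<longleftrightarrow> rreg s a = rreg s b"

datatype prog =
    Do instr
  | Seq prog prog
  | Cond test prog prog
  | While test prog

text \<open>
  \<open>exec p s t s'\<close>: started in state \<open>s\<close>, the program \<open>p\<close> halts in state \<open>s'\<close> after executing exactly
  \<open>t\<close> instructions and tests.  The relation is deterministic, and a diverging run has no \<open>t\<close> and \<open>s'\<close>.
\<close>

inductive exec :: "prog \<Rightarrow> ram_state \<Rightarrow> nat \<Rightarrow> ram_state \<Rightarrow> bool" where
  Do: "exec (Do i) s 1 (step i s)"
| Seq: "exec p s t s' \<Longrightarrow> exec q s' u s'' \<Longrightarrow> exec (Seq p q) s (t + u) s''"
| CondTrue: "holds c s \<Longrightarrow> exec p s t s' \<Longrightarrow> exec (Cond c p q) s (t + 1) s'"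
| CondFalse: "\<not> holds c s \<Longrightarrow> exec q s t s' \<Longrightarrow> exec (Cond c p q) s (t + 1) s'"
| WhileFalse: "\<not> holds c s \<Longrightarrow> exec (While c p) s 1 s"
| WhileTrue: "holds c s \<Longrightarrow> exec p s t s' \<Longrightarrow> exec (While c p) s' u s'' \<Longrightarrow>
    exec (While c p) s (t + u + 1) s''"

text \<open>
  Matrices are passed in row-major order: the input in real memory from address \<open>0\<close>, with its
  dimensions in index registers \<open>0\<close> and \<open>1\<close>; two output matrices one after the other on the tape, with
  their dimensions in index registers \<open>1\<close> to \<open>4\<close>.  Index register \<open>0\<close> finally holds the answer to the
  decision problem.
\<close>

definition mat_entries :: "real mat \<Rightarrow> real list" where
  "mat_entries S = concat (mat_to_list S)"

definition input_state :: "real mat \<Rightarrow> ram_state" where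
  "input_state S =
     \<lparr>nreg = (\<lambda>_. 0)(0 := dim_row S, 1 := dim_col S),
      rreg = (\<lambda>_. 0),
      nmem = (\<lambda>_. 0),
      rmem = (\<lambda>a. if a < dim_row S * dim_col S then mat_entries S ! a else 0),
      tape = []\<rparr>"

definition answer :: "ram_state \<Rightarrow> nat" where
  "answer s = nreg s 0"

definition outputs_matrices :: "ram_state \<Rightarrow> real mat \<Rightarrow> real mat \<Rightarrow> bool" where
  "outputs_matrices s S1 S2 \<longleftrightarrow>
     nreg s 1 = dim_row S1 \<and> nreg s 2 = dim_col S1 \<and>
     nreg s 3 = dim_row S2 \<and> nreg s 4 = dim_col S2 \<and>
     tape s = mat_entries S1 @ mat_entries S2"

end

theory Submission
  imports Defs
begin

text \<open>
  Let \<open>r\<^sub>i\<close> be the slack of the \<open>i\<close>-th inequality.  A row that is not identically zero and whose set of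
  zeros is maximal defines a facet, and these rows describe \<open>P\<close>.  If \<open>P\<close> is a product
  \<open>P\<^sub>1 \<times> P\<^sub>2\<close>, every facet row depends on one of the two components only: otherwise
  \<open>r\<^sub>i\<close> would be a sum of a nonnegative function of each component, and the zeros of one summand would form
  a larger proper face, on which some other row vanishes.
  Conversely, let the facet rows be partitioned into two blocks such that the space spanned by the
  differences of the columns is invariant under the coordinate projections onto the blocks; then the
  slack map identifies \<open>P\<close> with the product of its images under the two blocks of rows, and
  the blocks are slack matrices of the factors.

  Such partitions are read off the orthogonal projection matrix \<open>H\<close> onto that space: they are the
  partitions with \<open>H i k = 0\<close> for all \<open>i\<close>, \<open>k\<close> in different blocks.  With
  \<open>x / 0 = 0\<close> the matrix is computed without pivoting by adding
  \<open>u u\<^sup>T / (u\<^sup>T u)\<close> with \<open>u = w - H w\<close> for every spanning vector \<open>w\<close>.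
  Hence \<open>P\<close> is a product iff the graph on the facet rows with edges \<open>H i k \<noteq> 0\<close> is disconnected, and a
  connected component and its complement yield the factors.
\<close>

section \<open>Compiling arithmetic loop programs\<close>

text \<open>The difference space is invariant under the coordinate projection \<open>D\<close> of a
  block exactly if \<open>D\<close> commutes with the orthogonal projection onto that space, both
  being self-adjoint; this is the vanishing of all entries between the block and its complement. One
  matrix thus displays every admissible partition at once, the finest one consisting of connected
  components, and no search over partitions takes place. The restriction to facet rows is essential:
  a redundant inequality may add up slacks of both factors and would glue the two blocks together.
  Columns need no selection, since listed points may repeat; both output matrices keep all
  \<open>n\<close> columns. Independence of two blocks of rows is first a linear statement about the
  affine hull. It descends to \<open>P\<close> because a point of the affine hull with nonnegative
  facet slacks lies in \<open>P\<close>. On the machine side everything is expressed by loops whose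
  bounds are variables of value at most \<open>m + n\<close>, so that polynomial time can be read
  off the shape of the program.\<close>

definition wp :: "prog \<Rightarrow> nat \<Rightarrow> (ram_state \<Rightarrow> bool) \<Rightarrow> ram_state \<Rightarrow> bool" where
  "wp p T Q s \<longleftrightarrow> (\<exists>t s'. exec p s t s' \<and> t \<le> T \<and> Q s')"

lemma wp_Do: "Q (step i s) \<Longrightarrow> wp (Do i) 1 Q s"
  unfolding wp_def using exec.Do by blast

text \<open>The postcondition of the first program is the precondition of the second, so repeated
  resolution executes a program symbolically while the budgets accumulate as a sum.\<close>

lemma wp_Seq: "wp p T (wp q U Q) s \<Longrightarrow> wp (Seq p q) (T + U) Q s"
  unfolding wp_def by (meson add_mono exec.Seq)

lemma wp_Cond:
  "(holds c s \<Longrightarrow> wp p T Q s) \<Longrightarrow> (\<not> holds c s \<Longrightarrow> wp q T Q s) \<Longrightarrow> wp (Cond c p q) (T + 1) Q s"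
  unfolding wp_def by (meson add_le_mono1 exec.CondTrue exec.CondFalse)

lemma wp_mono: "wp p T Q s \<Longrightarrow> T \<le> T' \<Longrightarrow> (\<And>s'. Q s' \<Longrightarrow> Q' s') \<Longrightarrow> wp p T' Q' s"
  unfolding wp_def by (meson le_trans)

text \<open>The number \<open>N\<close> of rounds is fixed in advance and the invariant is indexed
  by the rounds done. Each round pays for the body and one successful test; the final
  \<open>+ 1\<close> pays for the failing test.\<close>

lemma wp_While:
  assumes "I 0 s"
    and step: "\<And>k s. k < N \<Longrightarrow> I k s \<Longrightarrow> holds c s \<and> wp p T (I (Suc k)) s"
    and stop: "\<And>s. I N s \<Longrightarrow> \<not> holds c s"
  shows "wp (While c p) (N * (T + 1) + 1) (I N) s"
proof -
  \<comment> \<open>The induction is on the number \<open>d\<close> of rounds still to come, so that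
    the loop is unfolded at its front as in \<open>exec.WhileTrue\<close>.\<close>
  have "wp (While c p) (d * (T + 1) + 1) (I N) s" if "I (N - d) s" "d \<le> N" for d s
    using that
  proof (induction d arbitrary: s)
    case 0
    then show ?case unfolding wp_def using exec.WhileFalse[OF stop] by fastforce
  next
    case (Suc d)
    then have "holds c s" and "wp p T (I (Suc (N - Suc d))) s" using step[of "N - Suc d" s] by auto
    then obtain t s' where t: "exec p s t s'" "t \<le> T" and "I (Suc (N - Suc d)) s'"
      unfolding wp_def by blast
    then have "I (N - d) s'" using Suc.prems by (simp add: Suc_diff_Suc)
    then obtain u s'' where u: "exec (While c p) s' u s''" "u \<le> d * (T + 1) + 1" "I N s''"
      using Suc.IH[of s'] Suc.prems unfolding wp_def by auto
    have "exec (While c p) s (t + u + 1) s''" using exec.WhileTrue[OF \<open>holds c s\<close> t(1) u(1)] .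
    moreover have "t + u + 1 \<le> Suc d * (T + 1) + 1" using t u by simp
    ultimately show ?case unfolding wp_def using u by blast
  qed
  from this[of N s] show ?thesis using assms(1) by simp
qed

text \<open>The machine has no copy instruction. The target is cleared before the source is added to
  it, whence the side condition \<open>a \<noteq> b\<close> in \<open>wp_mov\<close>.\<close>

definition mov :: "nat \<Rightarrow> nat \<Rightarrow> prog" where
  "mov a b = Seq (Do (NConst a 0)) (Do (NAdd a a b))"

lemma wp_mov: "a \<noteq> b \<Longrightarrow> Q (s\<lparr>nreg := (nreg s)(a := nreg s b)\<rparr>) \<Longrightarrow> wp (mov a b) 2 Q s"
  unfolding mov_def using wp_Seq[OF wp_Do[OF wp_Do]] by (simp add: numeral_2_eq_2)

section \<open>A language of bounded loops over exact reals\<close>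

datatype iexp = IVar nat | INum nat | IPlus iexp iexp | IProd nat nat

datatype rexp =
    RNum nat
  | RGet iexp
  | RPlus rexp rexp
  | RMinus rexp rexp
  | RTimes rexp rexp
  | RQuot rexp rexp
  | RSum nat nat rexp

text \<open>The number of rounds of a loop is fixed on entry, so every command terminates and its
  meaning \<open>cval\<close> is a total function.\<close>

datatype cmd =
    Put iexp rexp
  | Out rexp
  | Tick nat
  | Test rexp cmd
  | For nat nat cmd
  | Then cmd cmd

text \<open>Real memory, counters and tape. Variables are not part of the store: only loops and sums
  bind them, so an environment passed downwards suffices.\<close>

type_synonym store = "(nat \<Rightarrow> real) \<times> (nat \<Rightarrow> nat) \<times> real list"

primrec ival :: "(nat \<Rightarrow> nat) \<Rightarrow> iexp \<Rightarrow> nat" where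
  "ival v (IVar x) = v x"
| "ival v (INum c) = c"
| "ival v (IPlus a b) = ival v a + ival v b"
| "ival v (IProd x y) = v x * v y"

primrec rval :: "(nat \<Rightarrow> nat) \<Rightarrow> (nat \<Rightarrow> real) \<Rightarrow> rexp \<Rightarrow> real" where
  "rval v \<mu> (RNum c) = real c"
| "rval v \<mu> (RGet a) = \<mu> (ival v a)"
| "rval v \<mu> (RPlus e f) = rval v \<mu> e + rval v \<mu> f"
| "rval v \<mu> (RMinus e f) = rval v \<mu> e - rval v \<mu> f"
| "rval v \<mu> (RTimes e f) = rval v \<mu> e * rval v \<mu> f"
| "rval v \<mu> (RQuot e f) = rval v \<mu> e / rval v \<mu> f"
| "rval v \<mu> (RSum x y e) = (\<Sum>k<v y. rval (v(x := k)) \<mu> e)"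

primrec cval :: "(nat \<Rightarrow> nat) \<Rightarrow> cmd \<Rightarrow> store \<Rightarrow> store" where
  "cval v (Put a e) = (\<lambda>(\<mu>, \<kappa>, \<tau>). (\<mu>(ival v a := rval v \<mu> e), \<kappa>, \<tau>))"
| "cval v (Out e) = (\<lambda>(\<mu>, \<kappa>, \<tau>). (\<mu>, \<kappa>, \<tau> @ [rval v \<mu> e]))"
| "cval v (Tick a) = (\<lambda>(\<mu>, \<kappa>, \<tau>). (\<mu>, \<kappa>(a := Suc (\<kappa> a)), \<tau>))"
| "cval v (Test e c) = (\<lambda>\<sigma>. if rval v (fst \<sigma>) e = 0 then \<sigma> else cval v c \<sigma>)"
| "cval v (For x y c) = fold (\<lambda>k. cval (v(x := k)) c) [0..<v y]"
| "cval v (Then c d) = (\<lambda>\<sigma>. cval v d (cval v c \<sigma>))"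

text \<open>Variables live in the index registers below \<open>10\<close>, intermediate results in the others; the
  counters incremented by \<^const>\<open>Tick\<close> live in the index memory.\<close>

primrec iwf :: "iexp \<Rightarrow> bool" where
  "iwf (IVar x) \<longleftrightarrow> x < 10"
| "iwf (INum c) \<longleftrightarrow> True"
| "iwf (IPlus a b) \<longleftrightarrow> iwf a \<and> iwf b"
| "iwf (IProd x y) \<longleftrightarrow> x < 10 \<and> y < 10"

primrec rwf :: "rexp \<Rightarrow> bool" where
  "rwf (RNum c) \<longleftrightarrow> True"
| "rwf (RGet a) \<longleftrightarrow> iwf a"
| "rwf (RPlus e f) \<longleftrightarrow> rwf e \<and> rwf f"
| "rwf (RMinus e f) \<longleftrightarrow> rwf e \<and> rwf f"
| "rwf (RTimes e f) \<longleftrightarrow> rwf e \<and> rwf f"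
| "rwf (RQuot e f) \<longleftrightarrow> rwf e \<and> rwf f"
| "rwf (RSum x y e) \<longleftrightarrow> x < 10 \<and> y < 10 \<and> rwf e"

primrec cwf :: "cmd \<Rightarrow> bool" where
  "cwf (Put a e) \<longleftrightarrow> iwf a \<and> rwf e"
| "cwf (Out e) \<longleftrightarrow> rwf e"
| "cwf (Tick a) \<longleftrightarrow> True"
| "cwf (Test e c) \<longleftrightarrow> rwf e \<and> cwf c"
| "cwf (For x y c) \<longleftrightarrow> x < 10 \<and> y < 10 \<and> cwf c"
| "cwf (Then c d) \<longleftrightarrow> cwf c \<and> cwf d"

section \<open>Translation to machine code with explicit time bounds\<close>

text \<open>A stack discipline: the result goes to register \<open>t\<close>, further operands to
  the registers after it, and everything below \<open>t\<close> survives. Index registers cannot be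
  multiplied, so products are computed by repeated addition.\<close>

primrec icomp :: "nat \<Rightarrow> iexp \<Rightarrow> prog" where
  "icomp t (IVar x) = mov t x"
| "icomp t (INum c) = Do (NConst t c)"
| "icomp t (IPlus a b) = Seq (icomp t a) (Seq (icomp (Suc t) b) (Do (NAdd t t (Suc t))))"
| "icomp t (IProd x y) =
     Seq (Do (NConst t 0)) (Seq (Do (NConst (t + 1) 0)) (Seq (Do (NConst (t + 2) 1))
       (While (NLess (t + 1) x) (Seq (Do (NAdd t t y)) (Do (NAdd (t + 1) (t + 1) (t + 2)))))))"

text \<open>\<open>B\<close> bounds all variables. A product therefore takes at most
  \<open>B\<close> rounds, each consisting of two additions and a test.\<close>

primrec itime :: "nat \<Rightarrow> iexp \<Rightarrow> nat" where
  "itime B (IVar x) = 2"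
| "itime B (INum c) = 1"
| "itime B (IPlus a b) = itime B a + (itime B b + 1)"
| "itime B (IProd x y) = 1 + (1 + (1 + (B * 3 + 1)))"

text \<open>The loop counter is kept in a temporary register and copied to the variable, and the old value
  of the variable is restored, so that a loop leaves the variables unchanged.\<close>

definition loop :: "nat \<Rightarrow> nat \<Rightarrow> nat \<Rightarrow> prog \<Rightarrow> prog" where
  "loop t x y p =
     Seq (mov t x) (Seq (mov (t + 1) y) (Seq (Do (NConst (t + 2) 0)) (Seq
       (While (NLess (t + 2) (t + 1)) (Seq (mov x (t + 2)) (Seq p (Seq (Do (NConst (t + 3) 1))
         (Do (NAdd (t + 2) (t + 2) (t + 3)))))))
       (mov x t))))"

text \<open>The sum is left unevaluated and nested like the \<open>Seq\<close> in
  \<open>loop\<close>; the budgets produced by \<open>wp_Seq\<close> then match it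
  syntactically.\<close>

definition looptime :: "nat \<Rightarrow> nat \<Rightarrow> nat" where
  "looptime B T = 2 + (2 + (1 + ((B * ((2 + (T + (1 + 1))) + 1) + 1) + 2)))"

text \<open>\<open>t\<close> and \<open>r\<close> are the first free index and real registers. The
  body of a sum starts at \<open>t + 3\<close>, since \<open>loop\<close> keeps the old value, the
  bound and the counter in the three registers before; its own use of \<open>t + 3\<close> comes
  after the body.\<close>

primrec rcomp :: "nat \<Rightarrow> nat \<Rightarrow> rexp \<Rightarrow> prog" where
  "rcomp t r (RNum c) = Do (RConst r c)"
| "rcomp t r (RGet a) = Seq (icomp t a) (Do (RLoad r t))"
| "rcomp t r (RPlus e f) = Seq (rcomp t r e) (Seq (rcomp t (Suc r) f) (Do (RAdd r r (Suc r))))"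
| "rcomp t r (RMinus e f) = Seq (rcomp t r e) (Seq (rcomp t (Suc r) f) (Do (RSub r r (Suc r))))"
| "rcomp t r (RTimes e f) = Seq (rcomp t r e) (Seq (rcomp t (Suc r) f) (Do (RMul r r (Suc r))))"
| "rcomp t r (RQuot e f) = Seq (rcomp t r e) (Seq (rcomp t (Suc r) f) (Do (RDiv r r (Suc r))))"
| "rcomp t r (RSum x y e) = Seq (Do (RConst r 0))
     (loop t x y (Seq (rcomp (t + 3) (Suc r) e) (Do (RAdd r r (Suc r)))))"

primrec rtime :: "nat \<Rightarrow> rexp \<Rightarrow> nat" where
  "rtime B (RNum c) = 1"
| "rtime B (RGet a) = itime B a + 1"
| "rtime B (RPlus e f) = rtime B e + (rtime B f + 1)"
| "rtime B (RMinus e f) = rtime B e + (rtime B f + 1)"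
| "rtime B (RTimes e f) = rtime B e + (rtime B f + 1)"
| "rtime B (RQuot e f) = rtime B e + (rtime B f + 1)"
| "rtime B (RSum x y e) = 1 + looptime B (rtime B e + 1)"

primrec ccomp :: "nat \<Rightarrow> cmd \<Rightarrow> prog" where
  "ccomp t (Put a e) = Seq (icomp t a) (Seq (rcomp (Suc t) 0 e) (Do (RStore t 0)))"
| "ccomp t (Out e) = Seq (rcomp t 0 e) (Do (Emit 0))"
| "ccomp t (Tick a) = Seq (Do (NConst t a)) (Seq (Do (NLoad (t + 1) t)) (Seq (Do (NConst (t + 2) 1))
     (Seq (Do (NAdd (t + 1) (t + 1) (t + 2))) (Do (NStore t (t + 1))))))"
| "ccomp t (Test e c) = Seq (rcomp t 0 e) (Seq (Do (RConst 1 0))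
     (Cond (REq 0 1) (Do (NConst t 0)) (ccomp t c)))"
| "ccomp t (For x y c) = loop t x y (ccomp (t + 3) c)"
| "ccomp t (Then c d) = Seq (ccomp t c) (ccomp t d)"

primrec ctime :: "nat \<Rightarrow> cmd \<Rightarrow> nat" where
  "ctime B (Put a e) = itime B a + (rtime B e + 1)"
| "ctime B (Out e) = rtime B e + 1"
| "ctime B (Tick a) = 1 + (1 + (1 + (1 + 1)))"
| "ctime B (Test e c) = rtime B e + (1 + ((ctime B c + 1) + 1))"
| "ctime B (For x y c) = looptime B (ctime B c)"
| "ctime B (Then c d) = ctime B c + ctime B d"

definition same_memory :: "ram_state \<Rightarrow> ram_state \<Rightarrow> bool" where
  "same_memory s s' \<longleftrightarrow> rmem s' = rmem s \<and> nmem s' = nmem s \<and> tape s' = tape s"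

lemma icomp_correct:
  assumes "iwf e" "10 \<le> t" "\<forall>x<10. nreg s x = v x" "\<forall>x<10. v x \<le> B"
  shows "wp (icomp t e) (itime B e)
    (\<lambda>s'. nreg s' t = ival v e \<and> (\<forall>x<t. nreg s' x = nreg s x) \<and> rreg s' = rreg s \<and> same_memory s s') s"
  using assms
proof (induction e arbitrary: t s)
  case (IVar x)
  then show ?case by (auto intro!: wp_mov simp: same_memory_def)
next
  case (INum c)
  then show ?case by (auto intro!: wp_Do[unfolded One_nat_def] simp: same_memory_def)
next
  case (IPlus a b)
  show ?case unfolding icomp.simps itime.simps
    apply (rule wp_Seq, rule wp_mono[OF IPlus.IH(1) order.refl])
    using IPlus.prems apply simp_all[4]
    apply (rule wp_Seq, rule wp_mono[OF IPlus.IH(2) order.refl])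
    using IPlus.prems apply simp_all[4]
    apply (rule wp_Do)
    apply (auto simp: less_Suc_eq same_memory_def)
    done
next
  case (IProd x y)
  define I where "I k s' \<longleftrightarrow> nreg s' t = k * v y \<and> nreg s' (t + 1) = k \<and>
    nreg s' (t + 2) = 1 \<and> (\<forall>x<t. nreg s' x = nreg s x) \<and> rreg s' = rreg s \<and> same_memory s s'"
    for k :: nat and s'
  show ?case unfolding icomp.simps itime.simps
    apply (rule wp_Seq, rule wp_Do, rule wp_Seq, rule wp_Do, rule wp_Seq, rule wp_Do)
    apply (rule wp_mono[OF wp_While[where N = "v x" and I = I and T = "1 + 1"]])
    subgoal unfolding I_def same_memory_def by auto
    subgoal for k s'
      apply (rule conjI)
      subgoal unfolding I_def using IProd.prems by auto
      apply (rule wp_Seq, rule wp_Do, rule wp_Do)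
      unfolding I_def same_memory_def using IProd.prems by (auto simp: algebra_simps)
    subgoal unfolding I_def using IProd.prems by auto
    subgoal using IProd.prems by auto
    subgoal unfolding I_def using IProd.prems by auto
    done
qed

text \<open>The invariant speaks only about what lies outside the index registers, as
  \<open>frame\<close> says; the index registers are handled here once and for all. The body sees
  the environment with \<open>x\<close> set to \<open>k\<close> and must preserve the three
  registers of the loop as well.\<close>

lemma loop_correct:
  assumes xy: "x < 10" "y < 10" "10 \<le> t" "nreg s y \<le> B"
    and I0: "I 0 s"
    and body: "\<And>k s'. k < nreg s y \<Longrightarrow> I k s' \<Longrightarrow> \<forall>z<t. nreg s' z = ((nreg s)(x := k)) z \<Longrightarrow>
        wp p T (\<lambda>s''. I (Suc k) s'' \<and> (\<forall>z<t+3. nreg s'' z = nreg s' z)) s'"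
    and frame: "\<And>k N s'. I k s' \<Longrightarrow> I k (s'\<lparr>nreg := N\<rparr>)"
  shows "wp (loop t x y p) (looptime B T)
    (\<lambda>s'. I (nreg s y) s' \<and> (\<forall>z<t. nreg s' z = nreg s z)) s"
proof -
  \<comment> \<open>The bookkeeping part: saved variable, bound and counter. The bound is copied
    before \<open>x\<close> is overwritten, so \<open>x\<close> and \<open>y\<close> may
    coincide.\<close>
  define J where "J k s' \<longleftrightarrow> I k s' \<and> (\<forall>z<t. z \<noteq> x \<longrightarrow> nreg s' z = nreg s z) \<and>
    nreg s' t = nreg s x \<and> nreg s' (t + 1) = nreg s y \<and> nreg s' (t + 2) = k" for k s'
  show ?thesis unfolding loop_def looptime_def
    apply (rule wp_Seq, rule wp_mov)
    using xy apply simp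
    apply (rule wp_Seq, rule wp_mov)
    using xy apply simp
    apply (rule wp_Seq, rule wp_Do)
    apply (rule wp_Seq)
    apply (rule wp_mono[OF wp_While[where N = "nreg s y" and I = J and T = "2 + (T + (1 + 1))"]])
    subgoal unfolding J_def using xy I0 frame by auto
    subgoal for k s'
      apply (rule conjI)
      subgoal unfolding J_def by auto
      apply (rule wp_Seq, rule wp_mov)
      using xy apply simp
      apply (rule wp_Seq, rule wp_mono[OF body[of k] order.refl])
      using xy apply simp
      subgoal unfolding J_def using frame by auto
      subgoal unfolding J_def using xy by auto
      apply (rule wp_Seq, rule wp_Do, rule wp_Do)
      unfolding J_def using xy frame by auto
    subgoal unfolding J_def by auto
    subgoal using xy by (intro add_mono mult_le_mono1 order.refl)
    subgoal for s'
      apply (rule wp_mov)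
      using xy apply simp
      unfolding J_def using frame by auto
    done
qed

lemma rcomp_correct:
  assumes "rwf e" "10 \<le> t" "\<forall>x<10. nreg s x = v x" "\<forall>x<10. v x \<le> B" "rmem s = \<mu>"
  shows "wp (rcomp t r e) (rtime B e)
    (\<lambda>s'. rreg s' r = rval v \<mu> e \<and> (\<forall>x<t. nreg s' x = nreg s x) \<and>
       (\<forall>x<r. rreg s' x = rreg s x) \<and> same_memory s s') s"
  using assms
proof (induction e arbitrary: t r s v)
  case (RNum c)
  show ?case unfolding rcomp.simps rtime.simps
    by (rule wp_Do) (auto simp: same_memory_def)
next
  case (RGet a)
  show ?case unfolding rcomp.simps rtime.simps
    apply (rule wp_Seq, rule wp_mono[OF icomp_correct order.refl])
    using RGet.prems apply simp_all[4]
    apply (rule wp_Do)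
    using RGet.prems apply (auto simp: same_memory_def)
    done
next
  case (RPlus e f)
  show ?case unfolding rcomp.simps rtime.simps
    apply (rule wp_Seq, rule wp_mono[OF RPlus.IH(1) order.refl])
    using RPlus.prems apply simp_all[5]
    apply (rule wp_Seq, rule wp_mono[OF RPlus.IH(2) order.refl])
    using RPlus.prems apply (simp_all add: same_memory_def)[5]
    apply (rule wp_Do)
    apply (auto simp: less_Suc_eq same_memory_def)
    done
next
  case (RMinus e f)
  show ?case unfolding rcomp.simps rtime.simps
    apply (rule wp_Seq, rule wp_mono[OF RMinus.IH(1) order.refl])
    using RMinus.prems apply simp_all[5]
    apply (rule wp_Seq, rule wp_mono[OF RMinus.IH(2) order.refl])
    using RMinus.prems apply (simp_all add: same_memory_def)[5]
    apply (rule wp_Do)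
    apply (auto simp: less_Suc_eq same_memory_def)
    done
next
  case (RTimes e f)
  show ?case unfolding rcomp.simps rtime.simps
    apply (rule wp_Seq, rule wp_mono[OF RTimes.IH(1) order.refl])
    using RTimes.prems apply simp_all[5]
    apply (rule wp_Seq, rule wp_mono[OF RTimes.IH(2) order.refl])
    using RTimes.prems apply (simp_all add: same_memory_def)[5]
    apply (rule wp_Do)
    apply (auto simp: less_Suc_eq same_memory_def)
    done
next
  case (RQuot e f)
  show ?case unfolding rcomp.simps rtime.simps
    apply (rule wp_Seq, rule wp_mono[OF RQuot.IH(1) order.refl])
    using RQuot.prems apply simp_all[5]
    apply (rule wp_Seq, rule wp_mono[OF RQuot.IH(2) order.refl])
    using RQuot.prems apply (simp_all add: same_memory_def)[5]
    apply (rule wp_Do)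
    apply (auto simp: less_Suc_eq same_memory_def)
    done
next
  case (RSum x y e)
  define I where "I k s' \<longleftrightarrow> rreg s' r = (\<Sum>i<k. rval (v(x := i)) \<mu> e) \<and>
    (\<forall>x<r. rreg s' x = rreg s x) \<and> same_memory s s'" for k s'
  have v: "nreg s y = v y" "v y \<le> B" using RSum.prems by auto
  show ?case unfolding rcomp.simps rtime.simps
    apply (rule wp_Seq, rule wp_Do)
    apply (rule wp_mono[OF loop_correct[where I = I] order.refl])
    using RSum.prems apply simp_all[4]
    subgoal unfolding I_def same_memory_def by auto
    subgoal for k s'
      apply (rule wp_Seq)
      apply (rule wp_mono[OF RSum.IH[where v = "v(x := k)"] order.refl])
      using RSum.prems apply simp_all[2]
      subgoal using RSum.prems by auto
      subgoal using RSum.prems v by auto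
      subgoal using RSum.prems unfolding I_def same_memory_def by auto
      apply (rule wp_Do)
      unfolding I_def same_memory_def by (auto simp: fun_upd_def)
    subgoal unfolding I_def same_memory_def by simp
    subgoal unfolding I_def using v by simp
    done
qed

lemma ccomp_correct:
  assumes "cwf c" "10 \<le> t" "\<forall>x<10. nreg s x = v x" "\<forall>x<10. v x \<le> B"
    "(rmem s, nmem s, tape s) = \<sigma>"
  shows "wp (ccomp t c) (ctime B c)
    (\<lambda>s'. (rmem s', nmem s', tape s') = cval v c \<sigma> \<and> (\<forall>x<t. nreg s' x = nreg s x)) s"
  using assms
proof (induction c arbitrary: t s v \<sigma>)
  case (Put a e)
  show ?case unfolding ccomp.simps ctime.simps
    apply (rule wp_Seq, rule wp_mono[OF icomp_correct order.refl])
    using Put.prems apply simp_all[4]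
    apply (rule wp_Seq, rule wp_mono[OF rcomp_correct[where \<mu> = "rmem s"] order.refl])
    using Put.prems apply (simp_all add: same_memory_def)[5]
    apply (rule wp_Do)
    using Put.prems(5) by (auto simp: less_Suc_eq same_memory_def)
next
  case (Out e)
  show ?case unfolding ccomp.simps ctime.simps
    apply (rule wp_Seq, rule wp_mono[OF rcomp_correct[where \<mu> = "rmem s"] order.refl])
    using Out.prems apply simp_all[5]
    apply (rule wp_Do)
    using Out.prems(5) by (auto simp: same_memory_def)
next
  case (Tick a)
  show ?case unfolding ccomp.simps ctime.simps
    apply (rule wp_Seq, rule wp_Do)+
    apply (rule wp_Do)
    using Tick.prems(5) by auto
next
  case (Test e c)
  show ?case unfolding ccomp.simps ctime.simps
    apply (rule wp_Seq, rule wp_mono[OF rcomp_correct[where \<mu> = "rmem s"] order.refl])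
    using Test.prems apply simp_all[5]
    apply (rule wp_Seq, rule wp_Do, rule wp_Cond)
    subgoal
      apply (rule wp_mono[OF wp_Do[where Q = "\<lambda>s'. (rmem s', nmem s', tape s') = cval v (Test e c) \<sigma> \<and> (\<forall>x<t. nreg s' x = nreg s x)"]])
      using Test.prems(5) by (auto simp: same_memory_def)
    subgoal
      apply (rule wp_mono[OF Test.IH[where \<sigma> = \<sigma>]])
      using Test.prems by (auto simp: same_memory_def)
    done
next
  case (For x y c)
  define I where "I k s' \<longleftrightarrow> (rmem s', nmem s', tape s') = fold (\<lambda>k. cval (v(x := k)) c) [0..<k] \<sigma>"
    for k and s' :: ram_state
  have v: "nreg s y = v y" "v y \<le> B" using For.prems by auto
  show ?case unfolding ccomp.simps ctime.simps
    apply (rule wp_mono[OF loop_correct[where I = I] order.refl])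
    using For.prems apply simp_all[4]
    subgoal unfolding I_def using For.prems by simp
    subgoal for k s'
      apply (rule wp_mono[OF For.IH[where v = "v(x := k)" and \<sigma> = "fold (\<lambda>k. cval (v(x := k)) c) [0..<k] \<sigma>"] order.refl])
      using For.prems apply simp_all[2]
      subgoal using For.prems by auto
      subgoal using For.prems v by auto
      subgoal unfolding I_def by auto
      subgoal unfolding I_def by (auto simp: fun_upd_def)
      done
    subgoal unfolding I_def by simp
    subgoal unfolding I_def using v by simp
    done
next
  case (Then c d)
  show ?case unfolding ccomp.simps ctime.simps
    apply (rule wp_Seq, rule wp_mono[OF Then.IH(1)[where \<sigma> = \<sigma>] order.refl])
    using Then.prems apply simp_all[5]
    apply (rule wp_mono[OF Then.IH(2)[where \<sigma> = "cval v c \<sigma>"] order.refl])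
    using Then.prems by auto
qed

section \<open>Polynomial time bounds\<close>

text \<open>For \<open>B \<ge> 1\<close> powers increase with the exponent, so two bounds can be
  brought to a common one; this yields closure under sums.\<close>

definition poly_bounded :: "(nat \<Rightarrow> nat) \<Rightarrow> bool" where
  "poly_bounded f \<longleftrightarrow> (\<exists>c k. \<forall>B\<ge>1. f B \<le> c * B ^ k)"

lemma poly_bounded_const: "poly_bounded (\<lambda>B. c)"
  unfolding poly_bounded_def by (rule exI[of _ c], rule exI[of _ 0]) simp

lemma poly_bounded_id: "poly_bounded (\<lambda>B. B)"
  unfolding poly_bounded_def by (rule exI[of _ 1], rule exI[of _ 1]) simp

lemma poly_bounded_add:
  assumes "poly_bounded f" "poly_bounded g"
  shows "poly_bounded (\<lambda>B. f B + g B)"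
proof -
  obtain c k d l where f: "\<forall>B\<ge>1. f B \<le> c * B ^ k" and g: "\<forall>B\<ge>1. g B \<le> d * B ^ l"
    using assms unfolding poly_bounded_def by auto
  have "f B + g B \<le> (c + d) * B ^ (k + l)" if "B \<ge> 1" for B
  proof -
    have "B ^ k \<le> B ^ (k + l)" "B ^ l \<le> B ^ (k + l)" using that by (simp_all add: power_increasing)
    then have "c * B ^ k \<le> c * B ^ (k + l)" "d * B ^ l \<le> d * B ^ (k + l)" by simp_all
    then show ?thesis using f[rule_format, OF that] g[rule_format, OF that]
      unfolding distrib_right by linarith
  qed
  then show ?thesis unfolding poly_bounded_def by blast
qed

lemma poly_bounded_mult:
  assumes "poly_bounded f" "poly_bounded g"
  shows "poly_bounded (\<lambda>B. f B * g B)"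
proof -
  obtain c k d l where f: "\<forall>B\<ge>1. f B \<le> c * B ^ k" and g: "\<forall>B\<ge>1. g B \<le> d * B ^ l"
    using assms unfolding poly_bounded_def by auto
  have "f B * g B \<le> (c * d) * B ^ (k + l)" if "B \<ge> 1" for B
    using mult_le_mono[OF f[rule_format, OF that] g[rule_format, OF that]]
    by (simp add: power_add mult_ac)
  then show ?thesis unfolding poly_bounded_def by blast
qed

lemmas poly_bounded_intros = poly_bounded_const poly_bounded_id poly_bounded_add poly_bounded_mult

lemma poly_bounded_itime: "poly_bounded (\<lambda>B. itime B e)"
  by (induction e; simp only: itime.simps; intro poly_bounded_intros; assumption)

text \<open>A loop multiplies the time of its body by \<open>B\<close>; the degree of the bound for
  a fixed program thus comes from the nesting of its loops.\<close>

lemma poly_bounded_looptime: "poly_bounded T \<Longrightarrow> poly_bounded (\<lambda>B. looptime B (T B))"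
  unfolding looptime_def by (intro poly_bounded_intros)

lemma poly_bounded_rtime: "poly_bounded (\<lambda>B. rtime B e)"
  by (induction e; simp only: rtime.simps;
      intro poly_bounded_intros poly_bounded_looptime poly_bounded_itime; assumption)

lemma poly_bounded_ctime: "poly_bounded (\<lambda>B. ctime B c)"
  by (induction c; simp only: ctime.simps;
      intro poly_bounded_intros poly_bounded_looptime poly_bounded_itime poly_bounded_rtime; assumption)

section \<open>Facets of a polytope given by slacks\<close>

text \<open>A substitute for a norm in an arbitrary real vector space: boundedness of a polytope
  will be measured along a single direction \<open>d\<close> by such a functional.\<close>

lemma linear_functional_nonzero:
  fixes d :: "'a::real_vector"
  assumes "d \<noteq> 0"
  obtains g :: "'a \<Rightarrow> real" where "linear g" "g d = 1"
proof -
  have "independent {d}" using assms by simp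
  then obtain g :: "'a \<Rightarrow> real" where "linear g" "\<forall>x\<in>{d}. g x = 1"
    using linear_independent_extend[of "{d}" "\<lambda>_. 1 :: real"] by blast
  then show thesis using that by blast
qed

text \<open>Coefficients belong to positions \<open>j\<close> and not to points, because the
  \<open>v j\<close> may repeat; sums over the columns of a slack matrix need this form.\<close>

lemma convex_hull_image_rep:
  assumes "x \<in> convex hull (v ` {..<n::nat})"
  shows "\<exists>u. (\<forall>j<n. 0 \<le> u j) \<and> (\<Sum>j<n. u j) = 1 \<and> x = (\<Sum>j<n. u j *\<^sub>R (v j :: 'a::real_vector))"
proof -
  let ?C = "{x. \<exists>u. (\<forall>j<n. 0 \<le> u j) \<and> (\<Sum>j<n. u j) = 1 \<and> x = (\<Sum>j<n. u j *\<^sub>R v j)}"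
  have "v ` {..<n} \<subseteq> ?C"
  proof (rule image_subsetI, rule CollectI)
    fix i assume "i \<in> {..<n}"
    then show "\<exists>u. (\<forall>j<n. 0 \<le> u j) \<and> (\<Sum>j<n. u j) = 1 \<and> v i = (\<Sum>j<n. u j *\<^sub>R v j)"
      by (intro exI[of _ "\<lambda>j. if j = i then 1 else 0"])
        (auto simp: if_distrib[of "\<lambda>c. c *\<^sub>R _"] sum.delta cong: if_cong)
  qed
  moreover have "convex ?C"
  proof (rule convexI)
    fix x y and s t :: real
    assume "x \<in> ?C" "y \<in> ?C" and st: "0 \<le> s" "0 \<le> t" "s + t = 1"
    then obtain a b where ab: "\<forall>j<n. 0 \<le> a j" "(\<Sum>j<n. a j) = 1" "x = (\<Sum>j<n. a j *\<^sub>R v j)"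
      "\<forall>j<n. 0 \<le> b j" "(\<Sum>j<n. b j) = 1" "y = (\<Sum>j<n. b j *\<^sub>R v j)" by blast
    show "s *\<^sub>R x + t *\<^sub>R y \<in> ?C"
      by (rule CollectI, rule exI[of _ "\<lambda>j. s * a j + t * b j"])
        (use ab st in \<open>simp add: sum.distrib sum_distrib_left[symmetric] scaleR_add_left scaleR_sum_right\<close>)
  qed
  ultimately have "convex hull (v ` {..<n}) \<subseteq> ?C" by (rule hull_minimal)
  then show ?thesis using assms by blast
qed

lemma affine_hull_image_rep:
  assumes "x \<in> affine hull (v ` {..<n::nat})"
  shows "\<exists>u. (\<Sum>j<n. u j) = 1 \<and> x = (\<Sum>j<n. u j *\<^sub>R (v j :: 'a::real_vector))"
proof -
  let ?C = "{x. \<exists>u. (\<Sum>j<n. u j) = 1 \<and> x = (\<Sum>j<n. u j *\<^sub>R v j)}"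
  have "v ` {..<n} \<subseteq> ?C"
  proof (rule image_subsetI, rule CollectI)
    fix i assume "i \<in> {..<n}"
    then show "\<exists>u. (\<Sum>j<n. u j) = 1 \<and> v i = (\<Sum>j<n. u j *\<^sub>R v j)"
      by (intro exI[of _ "\<lambda>j. if j = i then 1 else 0"])
        (auto simp: if_distrib[of "\<lambda>c. c *\<^sub>R _"] sum.delta cong: if_cong)
  qed
  moreover have "affine ?C"
    unfolding affine_def
  proof (intro ballI allI impI)
    fix x y and s t :: real
    assume "x \<in> ?C" "y \<in> ?C" and st: "s + t = 1"
    then obtain a b where ab: "(\<Sum>j<n. a j) = 1" "x = (\<Sum>j<n. a j *\<^sub>R v j)"
      "(\<Sum>j<n. b j) = 1" "y = (\<Sum>j<n. b j *\<^sub>R v j)" by blast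
    show "s *\<^sub>R x + t *\<^sub>R y \<in> ?C"
      by (rule CollectI, rule exI[of _ "\<lambda>j. s * a j + t * b j"])
        (use ab st in \<open>simp add: sum.distrib sum_distrib_left[symmetric] scaleR_add_left scaleR_sum_right\<close>)
  qed
  ultimately have "affine hull (v ` {..<n}) \<subseteq> ?C" by (rule hull_minimal)
  then show ?thesis using assms by blast
qed

section \<open>Slacks, zero patterns and facet rows\<close>

text \<open>The geometric content of a slack matrix without matrices or coordinates. The rank
  condition will enter as \<open>nontrivial\<close>, which says that \<open>P\<close> is not a
  single point.\<close>

locale slack_description =
  fixes P :: "'a::real_vector set" and m n :: nat and v :: "nat \<Rightarrow> 'a"
    and a :: "nat \<Rightarrow> 'a \<Rightarrow> real" and b :: "nat \<Rightarrow> real"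
  assumes lin: "linear (a i)"
    and P_hull: "P = convex hull (v ` {..<n})"
    and P_ineq: "P = {x \<in> affine hull P. \<forall>i<m. a i x \<le> b i}"
    and nontrivial: "\<exists>j<n. \<exists>k<n. v j \<noteq> v k"
begin

definition r :: "nat \<Rightarrow> 'a \<Rightarrow> real" where "r i x = b i - a i x"

definition Z :: "nat \<Rightarrow> nat set" where "Z i = {j. j < n \<and> r i (v j) = 0}"

definition nz :: "nat \<Rightarrow> bool" where "nz i \<longleftrightarrow> (\<exists>j<n. r i (v j) \<noteq> 0)"

text \<open>Only proper inclusions of zero patterns disqualify a row, so several rows that define
  the same facet all stay in \<open>E\<close>.\<close>

definition E :: "nat set" where
  "E = {i. i < m \<and> nz i \<and> \<not> (\<exists>k<m. nz k \<and> Z i \<subset> Z k)}"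

text \<open>The exchange property of a product, phrased without mentioning factors. It is
  parametrised by \<open>X\<close> because linear algebra yields it on the affine hull and geometry
  uses it on \<open>P\<close>.\<close>

definition splits :: "'a set \<Rightarrow> nat set \<Rightarrow> nat set \<Rightarrow> bool" where
  "splits X E1 E2 \<longleftrightarrow> (\<forall>x\<in>X. \<forall>y\<in>X. \<exists>z\<in>X. (\<forall>i\<in>E1. r i z = r i x) \<and> (\<forall>i\<in>E2. r i z = r i y))"

lemma n_pos: "0 < n" using nontrivial by force

lemma aff: "affine hull P = affine hull (v ` {..<n})"
  unfolding P_hull by simp

lemma P_subset_aff: "P \<subseteq> affine hull P" by (rule hull_subset)

lemma convex_P: "convex P" unfolding P_hull by (rule convex_convex_hull)

lemma v_in_P: "j < n \<Longrightarrow> v j \<in> P"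
  unfolding P_hull by (rule hull_inc) auto

lemma in_P_iff: "x \<in> P \<longleftrightarrow> x \<in> affine hull P \<and> (\<forall>i<m. 0 \<le> r i x)"
  using P_ineq unfolding r_def by auto

lemma r_nonneg: "x \<in> P \<Longrightarrow> i < m \<Longrightarrow> 0 \<le> r i x"
  using in_P_iff by blast

lemma r_combination: "r i (s *\<^sub>R x + t *\<^sub>R y) = s * r i x + t * r i y" if "s + t = 1"
proof -
  have "b i = s * b i + t * b i" using that by (metis distrib_right mult_1)
  then show ?thesis
    using lin[of i] unfolding r_def by (simp add: linear_add linear_scale algebra_simps)
qed

lemma r_line: "r i (x + s *\<^sub>R (y - z)) = r i x + s * (r i y - r i z)"
  using lin[of i] unfolding r_def by (simp add: linear_add linear_scale linear_diff algebra_simps)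

lemma r_sum: "r i (\<Sum>j<n. u j *\<^sub>R v j) = (\<Sum>j<n. u j * r i (v j))" if "(\<Sum>j<n. u j) = 1"
proof -
  have "a i (\<Sum>j<n. u j *\<^sub>R v j) = (\<Sum>j<n. u j * a i (v j))"
    using lin[of i] by (simp add: linear_sum linear_scale)
  moreover have "b i = (\<Sum>j<n. u j * b i)" using that by (simp flip: sum_distrib_right)
  ultimately show ?thesis unfolding r_def by (simp add: right_diff_distrib sum_subtractf)
qed

lemma aff_line: "x \<in> affine hull P \<Longrightarrow> y \<in> affine hull P \<Longrightarrow> z \<in> affine hull P \<Longrightarrow>
    x + s *\<^sub>R (y - z) \<in> affine hull P"
  by (rule mem_affine_3_minus) auto

lemma P_combination: "x \<in> P \<Longrightarrow> y \<in> P \<Longrightarrow> 0 \<le> s \<Longrightarrow> 0 \<le> t \<Longrightarrow> s + t = 1 \<Longrightarrow> s *\<^sub>R x + t *\<^sub>R y \<in> P"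
  using convex_P unfolding convex_def by blast

lemma zero_support:
  assumes "i < m" "\<forall>j<n. 0 \<le> u j" "(\<Sum>j<n. u j) = 1" "r i (\<Sum>j<n. u j *\<^sub>R v j) = 0" "j < n"
  shows "u j * r i (v j) = 0"
proof (rule sum_nonneg_0[of "{..<n}" "\<lambda>j. u j * r i (v j)"])
  show "(\<Sum>j<n. u j * r i (v j)) = 0" using assms r_sum by metis
qed (use assms r_nonneg v_in_P in auto)

text \<open>A point of \<open>P\<close> where a nonnegative slack vanishes is a combination of
  listed points where it vanishes, so an inclusion of zero patterns among the columns extends to all
  of \<open>P\<close>.\<close>

lemma zero_on_P:
  assumes "i < m" "Z i \<subseteq> Z k" "x \<in> P" "r i x = 0"
  shows "r k x = 0"
proof -
  obtain u where u: "\<forall>j<n. 0 \<le> u j" "(\<Sum>j<n. u j) = 1" "x = (\<Sum>j<n. u j *\<^sub>R v j)"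
    using convex_hull_image_rep assms(3) unfolding P_hull by metis
  have "\<forall>j\<in>{..<n}. u j * r i (v j) = 0" using zero_support[OF assms(1) u(1,2)] assms(4) u(3) by simp
  then have "\<forall>j\<in>{..<n}. u j * r k (v j) = 0" using assms(2) unfolding Z_def by auto
  then show ?thesis unfolding u(3) r_sum[OF u(2)] by (rule sum.neutral)
qed

lemma nz_if: "x \<in> affine hull P \<Longrightarrow> r i x \<noteq> 0 \<Longrightarrow> nz i"
proof -
  assume "x \<in> affine hull P" "r i x \<noteq> 0"
  moreover then obtain u where "(\<Sum>j<n. u j) = 1" "x = (\<Sum>j<n. u j *\<^sub>R v j)"
    using affine_hull_image_rep unfolding aff by metis
  ultimately have "(\<Sum>j<n. u j * r i (v j)) \<noteq> 0" using r_sum by metis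
  then show "nz i" unfolding nz_def by (metis (mono_tags, lifting) lessThan_iff mult_zero_right sum.neutral)
qed

text \<open>A functional with value \<open>1\<close> on \<open>d\<close> grows without limit along
  the ray, but on \<open>P\<close> it never exceeds the sum of its absolute values at the listed
  points.\<close>

lemma unbounded_ray:
  assumes "d \<noteq> 0"
  shows "\<exists>s\<ge>0. x + s *\<^sub>R d \<notin> P"
proof (rule ccontr)
  assume *: "\<not> ?thesis"
  obtain g :: "'a \<Rightarrow> real" where g: "linear g" "g d = 1" using linear_functional_nonzero[OF assms] .
  define M where "M = (\<Sum>j<n. \<bar>g (v j)\<bar>)"
  define s where "s = M + \<bar>g x\<bar> + 1"
  have "0 \<le> M" unfolding M_def by (simp add: sum_nonneg)
  then have "x + s *\<^sub>R d \<in> P" using * unfolding s_def by auto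
  then obtain u where u: "\<forall>j<n. 0 \<le> u j" "(\<Sum>j<n. u j) = 1" "x + s *\<^sub>R d = (\<Sum>j<n. u j *\<^sub>R v j)"
    using convex_hull_image_rep unfolding P_hull by metis
  have "g x + s = g (x + s *\<^sub>R d)" using g by (simp add: linear_add linear_scale)
  also have "\<dots> = (\<Sum>j<n. u j * g (v j))" using g u by (simp add: linear_sum linear_scale)
  also have "\<dots> \<le> (\<Sum>j<n. \<bar>g (v j)\<bar>)"
  proof (rule sum_mono)
    fix j assume j: "j \<in> {..<n}"
    have "u j \<le> 1" using u member_le_sum[of j "{..<n}" u] j by auto
    then have "u j * \<bar>g (v j)\<bar> \<le> \<bar>g (v j)\<bar>" using mult_right_mono[of "u j" 1 "\<bar>g (v j)\<bar>"] by simp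
    moreover have "u j * g (v j) \<le> u j * \<bar>g (v j)\<bar>" using u j by (intro mult_left_mono) auto
    ultimately show "u j * g (v j) \<le> \<bar>g (v j)\<bar>" by linarith
  qed
  finally show False unfolding s_def M_def by linarith
qed

text \<open>All listed points get positive weight, so every slack that is not identically zero is
  positive here: the centroid serves as a relative interior point.\<close>

definition centroid :: 'a where "centroid = (\<Sum>j<n. (1 / real n) *\<^sub>R v j)"

lemma centroid_in_P: "centroid \<in> P"
  unfolding centroid_def by (rule convex_sum) (use n_pos convex_P v_in_P in auto)

lemma centroid_pos: "i < m \<Longrightarrow> nz i \<Longrightarrow> 0 < r i centroid"
proof -
  assume i: "i < m" "nz i"
  then obtain j where j: "j < n" "r i (v j) \<noteq> 0" unfolding nz_def by blast
  have pos: "0 < r i (v j)" using j r_nonneg[OF v_in_P[OF j(1)] i(1)] by simp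
  have "r i centroid = (\<Sum>j<n. 1 / real n * r i (v j))"
    unfolding centroid_def by (rule r_sum) (use n_pos in simp)
  also have "\<dots> > 0"
    by (rule sum_pos2[of _ j]) (use j i n_pos r_nonneg v_in_P pos in auto)
  finally show ?thesis .
qed

text \<open>On the segment from the centroid to \<open>x\<close> the inequalities violated at
  \<open>x\<close> become tight one after the other; up to the first of these moments the segment
  stays in \<open>P\<close>.\<close>

lemma exit_point:
  assumes x: "x \<in> affine hull P" "x \<notin> P"
  obtains k t where "k < m" "r k x < 0" "0 \<le> t" "t < 1"
    "centroid + t *\<^sub>R (x - centroid) \<in> P" "r k (centroid + t *\<^sub>R (x - centroid)) = 0"
proof -
  define N where "N = {k. k < m \<and> r k x < 0}"
  \<comment> \<open>The parameter at which slack \<open>k\<close> reaches zero on the segment, by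
    linear interpolation between its values at the two ends.\<close>
  define h where "h k = r k centroid / (r k centroid - r k x)" for k
  have N: "finite N" "N \<noteq> {}" unfolding N_def using x in_P_iff by fastforce+
  have pos: "0 < r k centroid" if "k \<in> N" for k
    using that centroid_pos nz_if[OF x(1)] unfolding N_def by force
  obtain k where k: "k \<in> N" "\<forall>l\<in>N. h k \<le> h l"
    using N by (metis arg_min_if_finite(1) arg_min_least)
  have neg: "r k x < 0" "k < m" using k unfolding N_def by auto
  have t: "0 \<le> h k" "h k < 1" using pos[OF k(1)] neg unfolding h_def by (auto simp: field_simps)
  let ?y = "centroid + h k *\<^sub>R (x - centroid)"
  have ry: "r i ?y = (1 - h k) * r i centroid + h k * r i x" for i
    unfolding r_line by (simp add: algebra_simps)
  have "0 \<le> r i ?y" if "i < m" for i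
  proof (cases "i \<in> N")
    case True
    then have "h k \<le> h i" using k by blast
    then have "h k * (r i centroid - r i x) \<le> r i centroid"
      using pos[OF True] True unfolding h_def[of i] N_def by (simp add: field_simps)
    then show ?thesis unfolding ry by (simp add: algebra_simps)
  next
    case False
    then show ?thesis unfolding ry N_def using that t r_nonneg[OF centroid_in_P that] by simp
  qed
  then have "?y \<in> P"
    using in_P_iff aff_line x(1) centroid_in_P P_subset_aff by blast
  moreover have "r k ?y = 0"
    unfolding ry using pos[OF k(1)] neg unfolding h_def by (simp add: field_simps)
  ultimately show thesis using that neg t by blast
qed

lemma E_extends:
  assumes "k < m" "nz k"
  shows "\<exists>i\<in>E. Z k \<subseteq> Z i"
proof -
  let ?A = "{i. i < m \<and> nz i \<and> Z k \<subseteq> Z i}"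
  have "finite (Z ` ?A)" "Z k \<in> Z ` ?A" using assms by auto
  from finite_has_maximal2[OF this] obtain M
    where M: "M \<in> Z ` ?A" "\<forall>T\<in>Z ` ?A. M \<subseteq> T \<longrightarrow> M = T" by blast
  then obtain i where i: "i < m" "nz i" "Z k \<subseteq> Z i" "M = Z i" by auto
  have "i \<in> E" unfolding E_def using i M by blast
  then show ?thesis using i by blast
qed

text \<open>Where the segment from the centroid leaves \<open>P\<close>, the tight row may be
  extended to a row of \<open>E\<close> with a larger zero pattern. That row is positive at the
  centroid and zero at the exit point, hence negative at \<open>x\<close>.\<close>

lemma E_describes:
  assumes "x \<in> affine hull P" "\<forall>i\<in>E. 0 \<le> r i x"
  shows "x \<in> P"
proof (rule ccontr)
  assume "x \<notin> P"
  with assms(1) obtain k t where k: "k < m" "r k x < 0" "0 \<le> t" "t < 1"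
    "centroid + t *\<^sub>R (x - centroid) \<in> P" "r k (centroid + t *\<^sub>R (x - centroid)) = 0"
    by (rule exit_point)
  obtain i where i: "i \<in> E" "Z k \<subseteq> Z i" using E_extends[OF k(1)] nz_if[OF assms(1)] k(2) by force
  have im: "i < m" "nz i" using i unfolding E_def by auto
  have "r i (centroid + t *\<^sub>R (x - centroid)) = 0" using zero_on_P[OF k(1) i(2) k(5,6)] .
  then have "(1 - t) * r i centroid + t * r i x = 0" unfolding r_line by (simp add: algebra_simps)
  moreover have "0 < (1 - t) * r i centroid" using centroid_pos[OF im] k by simp
  moreover have "0 \<le> t * r i x" using assms(2) i k by simp
  ultimately show False by linarith
qed

text \<open>Otherwise moving along \<open>x - y\<close> would change no slack of \<open>E\<close>,
  and a whole ray from the centroid would lie in the bounded set \<open>P\<close>.\<close>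

lemma E_injective:
  assumes "x \<in> affine hull P" "y \<in> affine hull P" "\<forall>i\<in>E. r i x = r i y"
  shows "x = y"
proof (rule ccontr)
  assume "x \<noteq> y"
  then obtain s where "centroid + s *\<^sub>R (x - y) \<notin> P" using unbounded_ray[of "x - y"] by auto
  moreover have "centroid + s *\<^sub>R (x - y) \<in> P"
  proof (rule E_describes)
    show "centroid + s *\<^sub>R (x - y) \<in> affine hull P"
      using aff_line assms centroid_in_P P_subset_aff by blast
    show "\<forall>i\<in>E. 0 \<le> r i (centroid + s *\<^sub>R (x - y))"
      using assms r_nonneg[OF centroid_in_P] unfolding r_line E_def by auto
  qed
  ultimately show False by blast
qed

text \<open>Boundedness enters here: leaving \<open>P\<close> along some direction makes a row
  tight, so there is a nonzero row with a nonempty zero pattern. An empty pattern is properly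
  contained in it and cannot be maximal.\<close>

lemma E_zero:
  assumes "i \<in> E"
  shows "\<exists>j<n. r i (v j) = 0"
proof -
  obtain j k where jk: "j < n" "k < n" "v j - v k \<noteq> 0" using nontrivial by auto
  obtain s where "centroid + s *\<^sub>R (v j - v k) \<notin> P" using unbounded_ray[OF jk(3)] by blast
  moreover have x: "centroid + s *\<^sub>R (v j - v k) \<in> affine hull P"
    using aff_line centroid_in_P P_subset_aff jk v_in_P by blast
  ultimately obtain l y where l: "l < m" "r l (centroid + s *\<^sub>R (v j - v k)) < 0" "y \<in> P" "r l y = 0"
    using exit_point by metis
  have "nz l" using nz_if[OF x] l by force
  moreover have "Z l \<noteq> {}"
  proof
    assume "Z l = {}"
    obtain u where u: "\<forall>j<n. 0 \<le> u j" "(\<Sum>j<n. u j) = 1" "y = (\<Sum>j<n. u j *\<^sub>R v j)"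
      using convex_hull_image_rep l(3) unfolding P_hull by metis
    have "\<forall>j\<in>{..<n}. u j * r l (v j) = 0" using zero_support[OF l(1) u(1,2)] l(4) u(3) by simp
    then have "\<forall>j\<in>{..<n}. u j = 0" using \<open>Z l = {}\<close> unfolding Z_def by auto
    then show False using u(2) by simp
  qed
  ultimately have "Z i \<noteq> {}" using assms l(1) unfolding E_def by blast
  then show ?thesis unfolding Z_def by blast
qed

lemma E_nonempty: "E \<noteq> {}"
proof
  assume "E = {}"
  then have "v j = v k" if "j < n" "k < n" for j k
    using E_injective v_in_P P_subset_aff that by (metis empty_iff subsetD)
  then show False using nontrivial by blast
qed

section \<open>Faces and product structure\<close>

text \<open>If every row vanishing on \<open>G\<close> also vanished at \<open>w\<close>, then from
  a relative interior point of \<open>G\<close> one could move a little further away from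
  \<open>w\<close> inside \<open>P\<close>. That point would lie strictly between \<open>w\<close>
  and another point of \<open>P\<close>, forcing \<open>w\<close> into the face.\<close>

lemma face_in_row:
  assumes G: "G face_of P" "G \<noteq> {}" and w: "w \<in> P" "w \<notin> G"
  shows "\<exists>i<m. (\<forall>y\<in>G. r i y = 0) \<and> r i w \<noteq> 0"
proof (rule ccontr)
  assume no: "\<not> ?thesis"
  define tight where "tight x = {i. i < m \<and> r i x = 0}" for x
  \<comment> \<open>A point with the fewest tight rows plays the role of a relative interior point
    of \<open>G\<close>.\<close>
  obtain x where x: "x \<in> G" "\<And>y. y \<in> G \<Longrightarrow> card (tight x) \<le> card (tight y)"
    using ex_has_least_nat[of "\<lambda>x. x \<in> G" _ "\<lambda>x. card (tight x)"] G(2) by blast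
  have GP: "G \<subseteq> P" and cG: "convex G" using G(1) face_of_imp_subset face_of_imp_convex by blast+
  have tight_all: "r i y = 0" if "i < m" "r i x = 0" "y \<in> G" for i y
  proof -
    \<comment> \<open>A slack vanishes at the midpoint only if it vanishes at both ends. By
      minimality the midpoint has as many tight rows as \<open>x\<close>, so those of
      \<open>x\<close> are tight at \<open>y\<close> too.\<close>
    let ?z = "(1/2) *\<^sub>R x + (1/2) *\<^sub>R y"
    have z: "?z \<in> G" using cG x that unfolding convex_def 
      by (metis divide_nonneg_nonneg field_sum_of_halves zero_le_numeral zero_le_one)
    have "r k ?z = 0 \<longleftrightarrow> r k x = 0 \<and> r k y = 0" if "k < m" for k
    proof -
      have "r k ?z = (r k x + r k y) / 2" by (subst r_combination) auto
      moreover have "0 \<le> r k x" "0 \<le> r k y" using r_nonneg that GP x \<open>y \<in> G\<close> by auto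
      ultimately show ?thesis by auto
    qed
    then have sub: "tight ?z = tight x \<inter> tight y" unfolding tight_def by blast
    have "tight x \<inter> tight y = tight x"
      by (rule card_seteq) (use x(2)[OF z] sub in \<open>auto simp: tight_def\<close>)
    then show ?thesis using that unfolding tight_def by blast
  qed
  then have tw: "r i w = 0" if "i < m" "r i x = 0" for i using no that by blast
  \<comment> \<open>Step lengths that keep each slack nonnegative:
    \<open>e * (r i w + 1) \<le> r i x\<close> suffices. The \<open>+ 1\<close> avoids a zero
    denominator, and the extra element \<open>1\<close> makes the minimum exist even if no slack is
    positive at \<open>x\<close>.\<close>
  define A where "A = insert 1 ((\<lambda>i. r i x / (r i w + 1)) ` {i. i < m \<and> r i x \<noteq> 0})"
  define e where "e = Min A"
  have A: "finite A" "A \<noteq> {}" unfolding A_def by auto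
  have Apos: "0 < c" if "c \<in> A" for c
  proof -
    have "0 < r i x / (r i w + 1)" if "i < m" "r i x \<noteq> 0" for i
      using that r_nonneg[of w i] r_nonneg[of x i] w x GP by (auto simp: less_le)
    then show ?thesis using that unfolding A_def by auto
  qed
  have e: "0 < e" unfolding e_def using A Apos by simp
  let ?u = "x + e *\<^sub>R (x - w)"
  have "0 \<le> r i ?u" if i: "i < m" for i
  proof (cases "r i x = 0")
    case True
    then show ?thesis using tw[OF i] by (simp add: r_line)
  next
    case False
    have nn: "0 \<le> r i x" "0 \<le> r i w" using r_nonneg i w x GP by auto
    have "e \<le> r i x / (r i w + 1)" unfolding e_def using A i False by (intro Min_le) (auto simp: A_def)
    then have "e * (r i w + 1) \<le> r i x" using nn by (simp add: field_simps)
    moreover have "0 \<le> e * r i x" using e nn by simp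
    ultimately show ?thesis using e unfolding r_line by (simp add: algebra_simps)
  qed
  then have u: "?u \<in> P" using in_P_iff aff_line x w GP P_subset_aff by blast
  have "x \<noteq> w" using x w by blast
  \<comment> \<open>The point \<open>x\<close> divides the segment from \<open>?u\<close> to
    \<open>w\<close> in the ratio \<open>e\<close> to \<open>1\<close>.\<close>
  have "x \<in> open_segment ?u w"
    unfolding in_segment
  proof (intro conjI exI[of _ "e / (1 + e)"])
    show "?u \<noteq> w"
    proof
      assume "?u = w"
      then have "(1 + e) *\<^sub>R (x - w) = 0" by (simp add: algebra_simps)
      then show False using e \<open>x \<noteq> w\<close> by simp
    qed
    have "(1 - e / (1 + e)) = 1 / (1 + e)" using e by (simp add: field_simps)
    then have "(1 - e / (1 + e)) *\<^sub>R ?u + (e / (1 + e)) *\<^sub>R w = (1 / (1 + e)) *\<^sub>R (?u + e *\<^sub>R w)"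
      by (simp add: scaleR_add_right)
    also have "?u + e *\<^sub>R w = (1 + e) *\<^sub>R x" by (simp add: algebra_simps)
    finally show "x = (1 - e / (1 + e)) *\<^sub>R ?u + (e / (1 + e)) *\<^sub>R w" using e by simp
  qed (use e in auto)
  then have "w \<in> G" using face_ofD[OF G(1) _ u w(1) x(1)] by blast
  then show False using w by blast
qed

text \<open>The product structure is used only through the operation \<open>mix\<close>, which
  recombines the components of two points of \<open>P\<close>. A facet row must ignore one of its
  two arguments, and this sorts the rows into blocks.\<close>

lemma product_splits:
  fixes f :: "'a \<Rightarrow> 'b::real_vector \<times> 'c::real_vector"
  assumes f: "linear f" and inj: "inj_on (\<lambda>x. f x + c) (affine hull P)"
    and img: "(\<lambda>x. f x + c) ` P = Q1 \<times> Q2"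
    and Q1: "\<exists>x\<in>Q1. \<exists>y\<in>Q1. x \<noteq> y" and Q2: "\<exists>x\<in>Q2. \<exists>y\<in>Q2. x \<noteq> y"
  shows "\<exists>E1 E2. E1 \<union> E2 = E \<and> E1 \<inter> E2 = {} \<and> E1 \<noteq> {} \<and> E2 \<noteq> {} \<and> splits P E1 E2"
proof -
  define g where "g x = f x + c" for x
  have g_comb: "g (s *\<^sub>R x + t *\<^sub>R y) = s *\<^sub>R g x + t *\<^sub>R g y" if "s + t = 1" for s t x y
  proof -
    have "c = s *\<^sub>R c + t *\<^sub>R c" using that by (simp flip: scaleR_add_left)
    then show ?thesis unfolding g_def using f by (simp add: linear_add linear_scale algebra_simps)
  qed
  have g_inj: "x = y" if "x \<in> P" "y \<in> P" "g x = g y" for x y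
    using inj that P_subset_aff unfolding g_def inj_on_def by auto
  have g_img: "g ` P = Q1 \<times> Q2" using img unfolding g_def .
  define mix where "mix x y = (SOME z. z \<in> P \<and> g z = (fst (g x), snd (g y)))" for x y
  have mix: "mix x y \<in> P" "g (mix x y) = (fst (g x), snd (g y))" if "x \<in> P" "y \<in> P" for x y
  proof -
    have "g x \<in> Q1 \<times> Q2" "g y \<in> Q1 \<times> Q2" using that g_img by blast+
    then have "(fst (g x), snd (g y)) \<in> g ` P" unfolding g_img by (auto simp: mem_Times_iff)
    then have "\<exists>z. z \<in> P \<and> g z = (fst (g x), snd (g y))" by force
    from someI_ex[OF this] show "mix x y \<in> P" "g (mix x y) = (fst (g x), snd (g y))"
      unfolding mix_def by auto
  qed
  have mixI: "mix x y = z" if "x \<in> P" "y \<in> P" "z \<in> P" "fst (g z) = fst (g x)" "snd (g z) = snd (g y)" for x y z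
    by (rule g_inj) (use that mix in \<open>auto simp: prod_eq_iff\<close>)
  have mix_fst: "fst (g (mix x y)) = fst (g x)" and mix_snd: "snd (g (mix x y)) = snd (g y)"
    if "x \<in> P" "y \<in> P" for x y using mix[OF that] by auto
  \<comment> \<open>Exchanging components does not change the sum of two points, so the two pairs
    have the same midpoint.\<close>
  have parallelogram: "r i (mix x y) + r i (mix y x) = r i x + r i y" if "x \<in> P" "y \<in> P" for i x y
  proof -
    have "(1/2) *\<^sub>R mix x y + (1/2) *\<^sub>R mix y x = (1/2) *\<^sub>R x + (1/2) *\<^sub>R y"
      by (rule g_inj)
        (use that mix P_combination in \<open>auto simp: g_comb prod_eq_iff add.commute\<close>)
    then have "r i ((1/2) *\<^sub>R mix x y + (1/2) *\<^sub>R mix y x) = r i ((1/2) *\<^sub>R x + (1/2) *\<^sub>R y)" by simp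
    then show ?thesis by (simp add: r_combination)
  qed
  \<comment> \<open>Affinity in the first argument, from which convexity and the face property of
    \<open>G\<close> below follow.\<close>
  have mix_comb: "mix (s *\<^sub>R x + t *\<^sub>R y) z = s *\<^sub>R mix x z + t *\<^sub>R mix y z"
    if "x \<in> P" "y \<in> P" "z \<in> P" "0 \<le> s" "0 \<le> t" "s + t = 1" for s t x y z
  proof (rule mixI)
    have "s *\<^sub>R snd (g z) + t *\<^sub>R snd (g z) = snd (g z)" using that by (simp flip: scaleR_add_left)
    then show "snd (g (s *\<^sub>R mix x z + t *\<^sub>R mix y z)) = snd (g z)"
      using that by (simp add: g_comb mix_snd)
  qed (use that mix P_combination in \<open>auto simp: g_comb mix_fst\<close>)
  have dichotomy: "(\<forall>x\<in>P. \<forall>y\<in>P. r i (mix x y) = r i x) \<or> (\<forall>x\<in>P. \<forall>y\<in>P. r i (mix x y) = r i y)"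
    if i: "i \<in> E" for i
  proof -
    have im: "i < m" and max: "\<And>k. k < m \<Longrightarrow> nz k \<Longrightarrow> \<not> Z i \<subset> Z k" using i unfolding E_def by auto
    obtain j where j: "j < n" "r i (v j) = 0" using E_zero[OF i] by blast
    define o' where "o' = v j"
    have o': "o' \<in> P" "r i o' = 0" using v_in_P j unfolding o'_def by auto
    \<comment> \<open>Relative to a point \<open>o'\<close> on the facet, the slack is the sum of
      two nonnegative functions, one of each component.\<close>
    have dec: "r i x = r i (mix x o') + r i (mix o' x)" if "x \<in> P" for x
      using parallelogram[OF that o'(1), of i] o' by simp
    \<comment> \<open>The zeros of the first summand. They form a face containing all zeros of row
      \<open>i\<close>; either it is all of \<open>P\<close>, or maximality of row \<open>i\<close>
      eliminates the second summand.\<close>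
    define G where "G = {x \<in> P. r i (mix x o') = 0}"
    have fst_only: "r i (mix x y) = r i x" if "\<forall>x\<in>P. r i (mix o' x) = 0" "x \<in> P" "y \<in> P" for x y
    proof -
      have "mix (mix x y) o' = mix x o'"
        by (rule mixI) (use that mix o' in \<open>auto simp: mix_fst mix_snd\<close>)
      then show ?thesis using dec[of x] dec[of "mix x y"] that mix by simp
    qed
    have snd_only: "r i (mix x y) = r i y" if "\<forall>x\<in>P. r i (mix x o') = 0" "x \<in> P" "y \<in> P" for x y
    proof -
      have "mix o' (mix x y) = mix o' y"
        by (rule mixI) (use that mix o' in \<open>auto simp: mix_fst mix_snd\<close>)
      then show ?thesis using dec[of y] dec[of "mix x y"] that mix by simp
    qed
    show ?thesis
    proof (cases "G = P")
      case True
      then have "\<forall>x\<in>P. r i (mix x o') = 0" unfolding G_def by blast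
      then show ?thesis using snd_only by blast
    next
      case False
      then obtain w where w: "w \<in> P" "w \<notin> G" unfolding G_def by blast
      have "mix o' o' = o'" by (rule mixI) (use o' in auto)
      then have "o' \<in> G" unfolding G_def using o' by simp
      have "G face_of P"
        unfolding face_of_def
      proof (intro conjI ballI impI)
        show "G \<subseteq> P" unfolding G_def by blast
        show "convex G"
          unfolding convex_def G_def
          using mix_comb o' P_combination by (auto simp: r_combination)
      next
        fix p q x assume pq: "p \<in> P" "q \<in> P" "x \<in> G" "x \<in> open_segment p q"
        then obtain s where s: "0 < s" "s < 1" "x = (1 - s) *\<^sub>R p + s *\<^sub>R q" unfolding in_segment by blast
        have "r i (mix x o') = (1 - s) * r i (mix p o') + s * r i (mix q o')"
          using s pq o' by (simp add: mix_comb r_combination)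
        moreover have "r i (mix x o') = 0" using pq unfolding G_def by blast
        moreover have "0 \<le> (1 - s) * r i (mix p o')" "0 \<le> s * r i (mix q o')"
          using s r_nonneg mix pq o' im by auto
        ultimately have "(1 - s) * r i (mix p o') = 0" "s * r i (mix q o') = 0" by linarith+
        then show "p \<in> G" "q \<in> G" unfolding G_def using s pq by auto
      qed
      then obtain k where k: "k < m" "\<forall>y\<in>G. r k y = 0" "r k w \<noteq> 0"
        using face_in_row[of G w] w \<open>o' \<in> G\<close> by blast
      have "nz k" using nz_if k w P_subset_aff by blast
      \<comment> \<open>At a zero of row \<open>i\<close> both nonnegative summands vanish, so the
        point lies in \<open>G\<close>, where row \<open>k\<close> is zero.\<close>
      have "Z i \<subseteq> Z k"
      proof
        fix l assume "l \<in> Z i"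
        then have l: "l < n" "r i (v l) = 0" unfolding Z_def by auto
        have "0 \<le> r i (mix (v l) o')" "0 \<le> r i (mix o' (v l))" using r_nonneg mix o' v_in_P[OF l(1)] im by auto
        then have "v l \<in> G" unfolding G_def using dec[OF v_in_P[OF l(1)]] l v_in_P by auto
        then show "l \<in> Z k" unfolding Z_def using k l by blast
      qed
      then have "Z k \<subseteq> Z i" using max[OF k(1) \<open>nz k\<close>] by blast
      have "r i (mix o' y) = 0" if y: "y \<in> P" for y
      proof -
        \<comment> \<open>\<open>mix o' y\<close> has the first component of \<open>o'\<close>,
          hence lies in \<open>G\<close>; there row \<open>k\<close> vanishes, and so does row
          \<open>i\<close>, since the two zero patterns agree.\<close>
        have "mix (mix o' y) o' = o'" by (rule mixI) (use y o' mix in \<open>auto simp: mix_fst\<close>)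
        then have "mix o' y \<in> G" unfolding G_def using o' y mix by simp
        then show ?thesis using zero_on_P[OF k(1) \<open>Z k \<subseteq> Z i\<close>] k(2) mix y o' by blast
      qed
      then show ?thesis using fst_only by blast
    qed
  qed
  define E1 where "E1 = {i \<in> E. \<forall>x\<in>P. \<forall>y\<in>P. r i (mix x y) = r i x}"
  define E2 where "E2 = E - E1"
  have E1: "\<forall>i\<in>E1. \<forall>x\<in>P. \<forall>y\<in>P. r i (mix x y) = r i x" unfolding E1_def by blast
  have E2: "\<forall>i\<in>E2. \<forall>x\<in>P. \<forall>y\<in>P. r i (mix x y) = r i y"
    using dichotomy unfolding E1_def E2_def by blast
  have "splits P E1 E2"
    unfolding splits_def
  proof (intro ballI)
    fix x y assume "x \<in> P" "y \<in> P"
    then show "\<exists>z\<in>P. (\<forall>i\<in>E1. r i z = r i x) \<and> (\<forall>i\<in>E2. r i z = r i y)"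
      using mix(1) E1 E2 by (intro bexI[of _ "mix x y"]) auto
  qed
  moreover have "E1 \<noteq> {}"
  proof
    assume "E1 = {}"
    \<comment> \<open>If all rows ignored the first component, two points differing only there would
      have equal slacks in \<open>E\<close>.\<close>
    obtain q q' q2 where q: "q \<in> Q1" "q' \<in> Q1" "q \<noteq> q'" "q2 \<in> Q2" using Q1 Q2 by blast
    then have "(q, q2) \<in> g ` P" "(q', q2) \<in> g ` P" unfolding g_img by auto
    then obtain x y where xy: "x \<in> P" "y \<in> P" "g x = (q, q2)" "g y = (q', q2)" by (metis imageE)
    have "mix x y = x" by (rule mixI) (use xy in auto)
    then have "\<forall>i\<in>E. r i x = r i y" using E2 \<open>E1 = {}\<close> xy unfolding E2_def by (metis Diff_empty)
    then have "x = y" using E_injective xy P_subset_aff by blast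
    then show False using xy q by simp
  qed
  moreover have "E2 \<noteq> {}"
  proof
    assume "E2 = {}"
    obtain q q' q1 where q: "q \<in> Q2" "q' \<in> Q2" "q \<noteq> q'" "q1 \<in> Q1" using Q1 Q2 by blast
    then have "(q1, q) \<in> g ` P" "(q1, q') \<in> g ` P" unfolding g_img by auto
    then obtain x y where xy: "x \<in> P" "y \<in> P" "g x = (q1, q)" "g y = (q1, q')" by (metis imageE)
    have "mix x y = y" by (rule mixI) (use xy in auto)
    then have "\<forall>i\<in>E. r i x = r i y" using E1 \<open>E2 = {}\<close> xy unfolding E2_def by (metis Diff_eq_empty_iff subsetD)
    then have "x = y" using E_injective xy P_subset_aff by blast
    then show False using xy q by simp
  qed
  moreover have "E1 \<subseteq> E" unfolding E1_def by blast
  then have "E1 \<union> E2 = E" "E1 \<inter> E2 = {}" unfolding E2_def by auto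
  ultimately show ?thesis by blast
qed

end

section \<open>Orthogonal projections\<close>

text \<open>Vectors are total functions, so equality is required on the coordinates below
  \<open>m\<close> only.\<close>

definition in_span :: "nat \<Rightarrow> nat \<Rightarrow> (nat \<Rightarrow> nat \<Rightarrow> real) \<Rightarrow> (nat \<Rightarrow> real) \<Rightarrow> bool" where
  "in_span m n w c \<longleftrightarrow> (\<exists>a. \<forall>i<m. c i = (\<Sum>l<n. a l * w l i))"

lemma in_span_cong: "in_span m n w c \<Longrightarrow> (\<And>i. i < m \<Longrightarrow> c i = c' i) \<Longrightarrow> in_span m n w c'"
  unfolding in_span_def by auto

lemma in_span_add: "in_span m n w c \<Longrightarrow> in_span m n w d \<Longrightarrow> in_span m n w (\<lambda>i. c i + d i)"
proof -
  assume "in_span m n w c" "in_span m n w d"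
  then obtain a b where "\<forall>i<m. c i = (\<Sum>l<n. a l * w l i)" "\<forall>i<m. d i = (\<Sum>l<n. b l * w l i)"
    unfolding in_span_def by blast
  then show ?thesis unfolding in_span_def
    by (intro exI[of _ "\<lambda>l. a l + b l"]) (simp add: distrib_right sum.distrib)
qed

lemma in_span_scale: "in_span m n w c \<Longrightarrow> in_span m n w (\<lambda>i. s * c i)"
proof -
  assume "in_span m n w c"
  then obtain a where "\<forall>i<m. c i = (\<Sum>l<n. a l * w l i)" unfolding in_span_def by blast
  then show ?thesis unfolding in_span_def
    by (intro exI[of _ "\<lambda>l. s * a l"]) (simp add: sum_distrib_left mult.assoc)
qed

lemma in_span_sum:
  assumes "\<And>k. k < (q::nat) \<Longrightarrow> in_span m n w (c k)"
  shows "in_span m n w (\<lambda>i. \<Sum>k<q. c k i)"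
  using assms
proof (induction q)
  case 0
  then show ?case unfolding in_span_def by (intro exI[of _ "\<lambda>_. 0"]) simp
next
  case (Suc q)
  then show ?case using in_span_add[of m n w "\<lambda>i. \<Sum>k<q. c k i" "c q"] by simp
qed

lemma in_span_base: "l < n \<Longrightarrow> in_span m n w (w l)"
  unfolding in_span_def
proof (intro exI[of _ "\<lambda>k. if k = l then 1 else 0"] allI impI)
  fix i assume "l < n"
  have "(\<Sum>k<n. (if k = l then 1 else 0) * w k i) = (\<Sum>k<n. if k = l then w k i else 0)"
    by (rule sum.cong) auto
  then show "w l i = (\<Sum>k<n. (if k = l then 1 else 0) * w k i)" using \<open>l < n\<close> by simp
qed

lemma in_span_Suc: "in_span m n w c \<Longrightarrow> in_span m (Suc n) w c"
proof -
  assume "in_span m n w c"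
  then obtain a where "\<forall>i<m. c i = (\<Sum>l<n. a l * w l i)" unfolding in_span_def by blast
  then show ?thesis unfolding in_span_def
    by (intro exI[of _ "\<lambda>l. if l < n then a l else 0"]) simp
qed

text \<open>These conditions determine \<open>H\<close> as the orthogonal projection onto the span of the \<open>w l\<close>.\<close>

definition projection :: "nat \<Rightarrow> nat \<Rightarrow> (nat \<Rightarrow> nat \<Rightarrow> real) \<Rightarrow> (nat \<Rightarrow> nat \<Rightarrow> real) \<Rightarrow> bool" where
  "projection m n w H \<longleftrightarrow> (\<forall>i<m. \<forall>k<m. H i k = H k i) \<and>
     (\<forall>l<n. \<forall>i<m. (\<Sum>k<m. H i k * w l k) = w l i) \<and> (\<forall>k<m. in_span m n w (\<lambda>i. H i k))"

lemma projection_fixes: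
  assumes "projection m n w H" "in_span m n w c" "i < m"
  shows "(\<Sum>k<m. H i k * c k) = c i"
proof -
  obtain a where a: "\<forall>i<m. c i = (\<Sum>l<n. a l * w l i)" using assms(2) unfolding in_span_def by blast
  have "(\<Sum>k<m. H i k * c k) = (\<Sum>k<m. \<Sum>l<n. a l * (H i k * w l k))"
    using a by (simp add: sum_distrib_left mult.left_commute)
  also have "\<dots> = (\<Sum>l<n. a l * (\<Sum>k<m. H i k * w l k))"
    by (subst sum.swap) (simp add: sum_distrib_left)
  also have "\<dots> = (\<Sum>l<n. a l * w l i)"
  proof (intro sum.cong refl)
    fix l assume "l \<in> {..<n}"
    then have "(\<Sum>k<m. H i k * w l k) = w l i" using assms(1,3) unfolding projection_def by blast
    then show "a l * (\<Sum>k<m. H i k * w l k) = a l * w l i" by simp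
  qed
  also have "\<dots> = c i" using assms a by simp
  finally show ?thesis .
qed

lemma projection_0: "projection m 0 w (\<lambda>i k. 0)"
  unfolding projection_def in_span_def by simp

definition residual :: "nat \<Rightarrow> (nat \<Rightarrow> nat \<Rightarrow> real) \<Rightarrow> (nat \<Rightarrow> real) \<Rightarrow> nat \<Rightarrow> real" where
  "residual m H x i = x i - (\<Sum>k<m. H i k * x k)"

text \<open>A Gram-Schmidt step carried out on the projection matrix instead of on a basis; the new
  vector is not normalised, which avoids square roots.\<close>

lemma projection_Suc:
  assumes "projection m j w H"
  defines "u \<equiv> residual m H (w j)"
  shows "projection m (Suc j) w (\<lambda>i k. H i k + u i * u k / (\<Sum>l<m. u l * u l))"
proof -
  define q where "q = (\<Sum>l<m. u l * u l)"
  have sym: "\<And>i k. i < m \<Longrightarrow> k < m \<Longrightarrow> H i k = H k i"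
    and span: "\<And>k. k < m \<Longrightarrow> in_span m j w (\<lambda>i. H i k)"
    using assms(1) unfolding projection_def by blast+
  \<comment> \<open>\<open>H\<close> is symmetric and fixes \<open>c\<close>, so the component of
    \<open>w j\<close> along the old span has the same inner product with \<open>c\<close> as
    \<open>w j\<close> itself.\<close>
  have u_perp: "(\<Sum>k<m. u k * c k) = 0" if c: "in_span m j w c" for c
  proof -
    have "(\<Sum>k<m. (\<Sum>i<m. H k i * w j i) * c k) = (\<Sum>k<m. \<Sum>i<m. w j i * (H i k * c k))"
      unfolding sum_distrib_right by (intro sum.cong refl) (simp add: sym mult_ac)
    also have "\<dots> = (\<Sum>i<m. w j i * (\<Sum>k<m. H i k * c k))"
      by (subst sum.swap) (simp add: sum_distrib_left)
    also have "\<dots> = (\<Sum>i<m. w j i * c i)" using projection_fixes[OF assms(1) c] by simp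
    finally show ?thesis unfolding u_def residual_def by (simp add: left_diff_distrib sum_subtractf)
  qed
  have "in_span m j w (\<lambda>i. \<Sum>k<m. w j k * H i k)" using span by (intro in_span_sum in_span_scale)
  then have Pw: "in_span m j w (\<lambda>i. \<Sum>k<m. H i k * w j k)" by (simp add: mult.commute)
  \<comment> \<open>\<open>w j\<close> differs from \<open>u\<close> by a vector of the old span, to
    which \<open>u\<close> is orthogonal.\<close>
  have "(\<Sum>k<m. u k * w j k) = (\<Sum>k<m. u k * (u k + (\<Sum>l<m. H k l * w j l)))"
    unfolding u_def residual_def by simp
  also have "\<dots> = q" using u_perp[OF Pw] unfolding q_def by (simp add: distrib_left sum.distrib)
  finally have uw: "(\<Sum>k<m. u k * w j k) = q" .
  have u_span: "in_span m (Suc j) w u"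
    using in_span_add[OF in_span_base[of j "Suc j"] in_span_scale[OF in_span_Suc[OF Pw], of "-1"]]
    unfolding u_def residual_def by simp
  \<comment> \<open>This covers a dependent \<open>w j\<close> as well: if the squared norm
    \<open>q\<close> is zero, every coordinate of \<open>u\<close> is zero and so is the
    quotient.\<close>
  have uq: "u i * q / q = u i" if "i < m" for i
  proof (cases "q = 0")
    case True
    have "u i * u i = 0"
      by (rule sum_nonneg_0[of "{..<m}" "\<lambda>l. u l * u l"]) (use True that q_def in auto)
    then show ?thesis by simp
  qed simp
  show ?thesis
    unfolding projection_def q_def[symmetric]
  proof (intro conjI allI impI)
    fix i k assume "i < m" "k < m"
    then show "H i k + u i * u k / q = H k i + u k * u i / q" using sym by (simp add: mult.commute)
  next
    fix l i assume l: "l < Suc j" and i: "i < m"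
    have "(\<Sum>k<m. (H i k + u i * u k / q) * w l k) = (\<Sum>k<m. H i k * w l k) + u i * (\<Sum>k<m. u k * w l k) / q"
      by (simp add: distrib_right sum.distrib sum_distrib_left sum_divide_distrib mult.assoc)
    also have "\<dots> = w l i"
    proof (cases "l = j")
      case True
      have "(\<Sum>k<m. H i k * w j k) = w j i - u i" unfolding u_def residual_def by simp
      then show ?thesis using uw uq[OF i] True by simp
    next
      case False
      then have "l < j" using l by simp
      then show ?thesis using u_perp[OF in_span_base] projection_fixes[OF assms(1) in_span_base i] by simp
    qed
    finally show "(\<Sum>k<m. (H i k + u i * u k / q) * w l k) = w l i" .
  next
    fix k assume "k < m"
    then show "in_span m (Suc j) w (\<lambda>i. H i k + u i * u k / q)"
      using in_span_add[OF in_span_Suc[OF span] in_span_scale[OF u_span, of "u k / q"]]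
      by (simp add: mult.commute)
  qed
qed

text \<open>A block diagonal \<open>H\<close> commutes with truncation to \<open>A\<close>. The
  truncation of \<open>c\<close> is therefore fixed by \<open>H\<close>, and it is a combination of
  columns of \<open>H\<close>, which lie in the span.\<close>

lemma projection_block:
  assumes "projection m n w H" and "\<And>i k. i < m \<Longrightarrow> k < m \<Longrightarrow> i \<in> A \<Longrightarrow> k \<notin> A \<Longrightarrow> H i k = 0"
    and c: "in_span m n w c"
  shows "in_span m n w (\<lambda>i. if i \<in> A then c i else 0)"
proof -
  have "in_span m n w (\<lambda>i. \<Sum>k<m. (if k \<in> A then c k else 0) * H i k)"
    using assms(1) unfolding projection_def by (intro in_span_sum in_span_scale) blast
  moreover have "(\<Sum>k<m. (if k \<in> A then c k else 0) * H i k) = (if i \<in> A then c i else 0)" if i: "i < m" for i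
  proof (cases "i \<in> A")
    case True
    have "(\<Sum>k<m. (if k \<in> A then c k else 0) * H i k) = (\<Sum>k<m. H i k * c k)"
      by (rule sum.cong) (use assms(2)[OF i _ True] in auto)
    then show ?thesis using projection_fixes[OF assms(1) c i] True by simp
  next
    case False
    have "(if k \<in> A then c k else 0) * H i k = 0" if "k < m" for k
      using assms(2)[OF that i] assms(1) False that i unfolding projection_def by auto
    then have "(\<Sum>k<m. (if k \<in> A then c k else 0) * H i k) = 0" by (intro sum.neutral) auto
    then show ?thesis using False by simp
  qed
  ultimately show ?thesis by (rule in_span_cong)
qed

text \<open>Truncating column \<open>k\<close> of \<open>H\<close> to \<open>A\<close> gives a
  vector \<open>x\<close> of the span, hence fixed by \<open>H\<close>. By symmetry its squared norm
  is coordinate \<open>k\<close> of \<open>H x\<close>, that is \<open>x k\<close>, which is zero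
  because \<open>k\<close> lies outside \<open>A\<close>.\<close>

lemma projection_block_converse:
  assumes pr: "projection m n w H" and A: "\<And>l. l < n \<Longrightarrow> in_span m n w (\<lambda>i. if i \<in> A then w l i else 0)"
    and ik: "i < m" "k < m" "i \<in> A" "k \<notin> A"
  shows "H i k = 0"
proof -
  obtain a where a: "\<forall>i<m. H i k = (\<Sum>l<n. a l * w l i)"
    using pr ik unfolding projection_def in_span_def by blast
  define x where "x i = (if i \<in> A then H i k else 0)" for i
  have "in_span m n w (\<lambda>i. \<Sum>l<n. a l * (if i \<in> A then w l i else 0))"
    using A by (intro in_span_sum in_span_scale)
  then have x: "in_span m n w x"
    by (rule in_span_cong) (use a x_def in auto)
  have "(\<Sum>l<m. x l * x l) = (\<Sum>l<m. H k l * x l)"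
    by (rule sum.cong) (use pr ik in \<open>auto simp: x_def projection_def\<close>)
  also have "\<dots> = x k" using projection_fixes[OF pr x ik(2)] .
  also have "\<dots> = 0" using ik x_def by simp
  finally have s: "(\<Sum>l<m. x l * x l) = 0" .
  have "x i * x i = 0"
    by (rule sum_nonneg_0[of "{..<m}" "\<lambda>l. x l * x l"]) (use s ik in auto)
  then show ?thesis using ik x_def by simp
qed

section \<open>Partitions of the facet rows and the projection matrix\<close>

context slack_description
begin

text \<open>Rows outside \<open>E\<close> are set to zero instead of being removed, so the row
  indices remain those of the input. The column \<open>v 0\<close> is an arbitrary base point for
  the direction space.\<close>

definition w :: "nat \<Rightarrow> nat \<Rightarrow> real" where
  "w l i = (if i \<in> E then r i (v l) - r i (v 0) else 0)"

lemma aff_in_span: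
  assumes "x \<in> affine hull P"
  shows "in_span m n w (\<lambda>i. if i \<in> E then r i x - r i (v 0) else 0)"
proof -
  obtain u where u: "(\<Sum>j<n. u j) = 1" "x = (\<Sum>j<n. u j *\<^sub>R v j)"
    using affine_hull_image_rep assms unfolding aff by metis
  have "r i x - r i (v 0) = (\<Sum>l<n. u l * (r i (v l) - r i (v 0)))" for i
    unfolding u(2) r_sum[OF u(1)] using u(1) by (simp add: right_diff_distrib sum_subtractf flip: sum_distrib_right)
  then show ?thesis unfolding in_span_def w_def by (intro exI[of _ u]) simp
qed

text \<open>The point is reached from \<open>v 0\<close> by adding the directions
  \<open>v l - v 0\<close> one at a time, which never leaves the affine hull.\<close>

lemma in_span_aff:
  assumes "in_span m n w c"
  shows "\<exists>x\<in>affine hull P. \<forall>i\<in>E. r i x = r i (v 0) + c i"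
proof -
  obtain u where u: "\<forall>i<m. c i = (\<Sum>l<n. u l * w l i)" using assms unfolding in_span_def by blast
  have "\<exists>x\<in>affine hull P. \<forall>i. r i x = r i (v 0) + (\<Sum>l<k. u l * (r i (v l) - r i (v 0)))" if "k \<le> n" for k
    using that
  proof (induction k)
    case 0
    show ?case using v_in_P[OF n_pos] P_subset_aff by auto
  next
    case (Suc k)
    then obtain x where x: "x \<in> affine hull P" "\<forall>i. r i x = r i (v 0) + (\<Sum>l<k. u l * (r i (v l) - r i (v 0)))"
      by auto
    have "x + u k *\<^sub>R (v k - v 0) \<in> affine hull P"
      using aff_line x(1) v_in_P n_pos Suc.prems P_subset_aff by (meson Suc_le_lessD subsetD)
    then show ?case using x(2) by (intro bexI[of _ "x + u k *\<^sub>R (v k - v 0)"]) (auto simp: r_line)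
  qed
  from this[of n] obtain x where "x \<in> affine hull P"
    "\<forall>i. r i x = r i (v 0) + (\<Sum>l<n. u l * (r i (v l) - r i (v 0)))" by auto
  then show ?thesis using u by (intro bexI[of _ x]) (auto simp: w_def E_def)
qed

lemma projection_support:
  assumes "projection m n w H" "i < m" "k < m" "i \<notin> E"
  shows "H i k = 0" "H k i = 0"
proof -
  obtain a where "\<forall>i<m. H i k = (\<Sum>l<n. a l * w l i)"
    using assms unfolding projection_def in_span_def by blast
  then show "H i k = 0" using assms unfolding w_def by simp
  then show "H k i = 0" using assms unfolding projection_def by simp
qed

lemma splits_if_block:
  assumes pr: "projection m n w H" and "A \<subseteq> E"
    and "\<And>i k. i < m \<Longrightarrow> k < m \<Longrightarrow> i \<in> A \<Longrightarrow> k \<notin> A \<Longrightarrow> H i k = 0"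
  shows "splits (affine hull P) A (E - A)"
  unfolding splits_def
proof (intro ballI)
  fix x y assume xy: "x \<in> affine hull P" "y \<in> affine hull P"
  let ?c = "\<lambda>x i. if i \<in> E then r i x - r i (v 0) else 0"
  \<comment> \<open>The slack vector of \<open>y\<close> corrected on \<open>A\<close> by the
    truncated difference of \<open>x\<close> and \<open>y\<close>: it agrees with \<open>x\<close>
    on \<open>A\<close> and with \<open>y\<close> on the rest of \<open>E\<close>.\<close>
  let ?d = "\<lambda>i. ?c y i + ((if i \<in> A then ?c x i else 0) + -1 * (if i \<in> A then ?c y i else 0))"
  have "in_span m n w ?d"
    by (intro in_span_add in_span_scale projection_block[OF pr assms(3)] aff_in_span xy) auto
  from in_span_aff[OF this] obtain z where z: "z \<in> affine hull P" "\<forall>i\<in>E. r i z = r i (v 0) + ?d i" ..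
  have "\<forall>i\<in>A. r i z = r i x" "\<forall>i\<in>E - A. r i z = r i y" using z(2) \<open>A \<subseteq> E\<close> by auto
  then show "\<exists>z\<in>affine hull P. (\<forall>i\<in>A. r i z = r i x) \<and> (\<forall>i\<in>E - A. r i z = r i y)" using z by blast
qed

text \<open>Exchanging the slacks of \<open>v l\<close> with those of \<open>v 0\<close> on
  \<open>E2\<close> realises the truncation of \<open>w l\<close> to \<open>E1\<close> by a point of
  \<open>P\<close>, so the span is invariant under truncation.\<close>

lemma block_if_splits:
  assumes pr: "projection m n w H" and E12: "E1 \<union> E2 = E" "E1 \<inter> E2 = {}" and sp: "splits P E1 E2"
    and ik: "i < m" "k < m" "i \<in> E1" "k \<notin> E1"
  shows "H i k = 0"
proof (rule projection_block_converse[OF pr _ ik])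
  fix l assume "l < n"
  then obtain z where z: "z \<in> P" "\<forall>i\<in>E1. r i z = r i (v l)" "\<forall>i\<in>E2. r i z = r i (v 0)"
    using sp v_in_P n_pos unfolding splits_def by metis
  have "in_span m n w (\<lambda>i. if i \<in> E then r i z - r i (v 0) else 0)"
    using aff_in_span z(1) P_subset_aff by blast
  then show "in_span m n w (\<lambda>i. if i \<in> E1 then w l i else 0)"
    by (rule in_span_cong) (use z E12 in \<open>auto simp: w_def\<close>)
qed

text \<open>Each facet slack of the mixed point is copied from a point of \<open>P\<close> and hence
  nonnegative, so \<open>E_describes\<close> puts the point into \<open>P\<close>.\<close>

lemma splits_P:
  assumes "splits (affine hull P) E1 E2" "E1 \<union> E2 = E"
  shows "splits P E1 E2"
  unfolding splits_def
proof (intro ballI)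
  fix x y assume xy: "x \<in> P" "y \<in> P"
  then obtain z where z: "z \<in> affine hull P" "\<forall>i\<in>E1. r i z = r i x" "\<forall>i\<in>E2. r i z = r i y"
    using assms(1) P_subset_aff unfolding splits_def by (meson subsetD)
  have "z \<in> P"
  proof (rule E_describes[OF z(1)], rule ballI)
    fix i assume i: "i \<in> E"
    then have "i < m" "i \<in> E1 \<or> i \<in> E2" using assms(2) unfolding E_def by auto
    then show "0 \<le> r i z" using z r_nonneg xy by metis
  qed
  then show "\<exists>z\<in>P. (\<forall>i\<in>E1. r i z = r i x) \<and> (\<forall>i\<in>E2. r i z = r i y)" using z by blast
qed

end

section \<open>Slack matrices of the factors\<close>

lemma lookup_scaleR: "Poly_Mapping.lookup (c *\<^sub>R x) k = c *\<^sub>R Poly_Mapping.lookup x k"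
proof -
  have "finite {i. c *\<^sub>R Poly_Mapping.lookup x i \<noteq> 0}"
    by (rule finite_subset[OF _ finite_lookup[of x]]) auto
  then show ?thesis unfolding scaleR_poly_mapping_def by (simp add: Abs_poly_mapping_inverse)
qed

definition coords :: "nat \<Rightarrow> (nat \<Rightarrow> real) \<Rightarrow> (nat \<Rightarrow>\<^sub>0 real)" where
  "coords N f = Abs_poly_mapping (\<lambda>k. if k < N then f k else 0)"

lemma lookup_coords: "Poly_Mapping.lookup (coords N f) k = (if k < N then f k else 0)"
proof -
  have "finite {k. (if k < N then f k else 0) \<noteq> 0}"
    by (rule finite_subset[of _ "{..<N}"]) auto
  then show ?thesis unfolding coords_def by (simp add: Abs_poly_mapping_inverse)
qed

lemma coords_in_coord_space: "coords N f \<in> coord_space N"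
  unfolding coord_space_def by (auto simp: in_keys_iff lookup_coords split: if_splits)

lemma coords_eq_iff: "coords N f = coords N g \<longleftrightarrow> (\<forall>k<N. f k = g k)"
  by (auto simp: poly_mapping_eq_iff fun_eq_iff lookup_coords)

lemma coords_combination:
  "coords N (\<lambda>k. s * f k + t * g k) = s *\<^sub>R coords N f + t *\<^sub>R coords N g"
  by (rule poly_mapping_eqI) (simp add: lookup_coords lookup_add lookup_scaleR)

lemma linear_row_eval: "linear (row_eval A i)"
proof (rule linearI)
  show "row_eval A i (x + y) = row_eval A i x + row_eval A i y" for x y
    unfolding row_eval_def by (simp add: lookup_add distrib_left sum.distrib)
  show "row_eval A i (c *\<^sub>R x) = c *\<^sub>R row_eval A i x" for c x
    unfolding row_eval_def by (simp add: lookup_scaleR sum_distrib_left mult.left_commute)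
qed

lemma affine_dim_pos:
  assumes "finite F" "S = convex hull F" "x \<in> S" "y \<in> S" "x \<noteq> y"
  shows "1 \<le> affine_dim S"
proof (rule ccontr)
  define D where "D = {x - y | x y. x \<in> S \<and> y \<in> S}"
  assume "\<not> 1 \<le> affine_dim S"
  then have "dim D = 0" unfolding affine_dim_def D_def by simp
  moreover obtain B where B: "B \<subseteq> D" "independent B" "D \<subseteq> span B" "card B = dim D"
    using real_vector.basis_exists by blast
  moreover have "S \<subseteq> span F" unfolding assms(2) by (rule convex_hull_subset_span)
  then have "D \<subseteq> span F" unfolding D_def by (auto intro: span_diff)
  \<comment> \<open>Needed because an infinite basis would also have cardinality \<open>0\<close>;
    the finite set \<open>F\<close> spans all differences.\<close>
  then have "finite B" using real_vector.independent_span_bound[OF assms(1) B(2)] B(1) by blast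
  ultimately have "D \<subseteq> {0}" by simp
  then show False using assms unfolding D_def by force
qed

lemma affine_dim_posD:
  assumes "1 \<le> affine_dim S"
  shows "\<exists>x\<in>S. \<exists>y\<in>S. x \<noteq> y"
proof (rule ccontr)
  assume "\<not> ?thesis"
  then have "{x - y | x y. x \<in> S \<and> y \<in> S} \<subseteq> span {}" unfolding span_empty by fastforce
  then have "dim {x - y | x y. x \<in> S \<and> y \<in> S} \<le> card ({} :: 'a set)"
    by (rule real_vector.dim_le_card) simp
  then show False using assms unfolding affine_dim_def by simp
qed

section \<open>Rank at least two in terms of entries\<close>

text \<open>If all columns were equal, a set of independent columns would have at most one
  element.\<close>

lemma mat_rank_ge_2D:
  assumes "2 \<le> mat_rank S"
  shows "\<exists>j<dim_col S. \<exists>k<dim_col S. \<exists>i<dim_row S. S $$ (i, j) \<noteq> S $$ (i, k)"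
proof (rule ccontr)
  assume no: "\<not> ?thesis"
  interpret vec_space "TYPE(real)" "dim_row S" .
  have S: "S \<in> carrier_mat (dim_row S) (dim_col S)" by simp
  have "lin_indpt {}" unfolding lin_dep_def by auto
  then obtain T where T: "maximal T (\<lambda>T. T \<subseteq> set (cols S) \<and> lin_indpt T)"
    using maximal_exists_superset[of "set (cols S)" "\<lambda>T. T \<subseteq> set (cols S) \<and> lin_indpt T" "{}"] by auto
  then have "2 \<le> card T" using rank_card_indpt[OF S T] assms unfolding mat_rank_def by simp
  moreover have "T \<subseteq> set (cols S)" using T unfolding maximal_def by blast
  moreover have "x = y" if xy: "x \<in> set (cols S)" "y \<in> set (cols S)" for x y
  proof -
    obtain j k where jk: "j < dim_col S" "x = col S j" "k < dim_col S" "y = col S k"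
      using xy unfolding cols_def by auto
    show ?thesis
      unfolding jk(2,4)
    proof (rule eq_vecI)
      fix i assume "i < dim_vec (col S k)"
      then have "i < dim_row S" by simp
      moreover then have "S $$ (i, j) = S $$ (i, k)" using no jk(1,3) by blast
      ultimately show "col S j $ i = col S k $ i" using jk(1,3) by simp
    qed simp
  qed
  ultimately have "finite T" "\<forall>x\<in>T. \<forall>y\<in>T. x = y" "2 \<le> card T"
    by (auto intro: finite_subset)
  then have "card T \<le> Suc 0" by (simp only: card_le_Suc0_iff_eq)
  with \<open>2 \<le> card T\<close> show False by simp
qed

text \<open>Rows \<open>i\<close>, \<open>k\<close> and columns \<open>p\<close>, \<open>q\<close>
  form a triangular \<open>2\<close> by \<open>2\<close> submatrix with nonzero determinant.\<close>

lemma mat_rank_ge_2I: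
  assumes "i < dim_row S" "k < dim_row S" "p < dim_col S" "q < dim_col S"
    and "S $$ (i, p) = 0" "S $$ (i, q) \<noteq> 0" "S $$ (k, p) \<noteq> 0"
  shows "2 \<le> mat_rank S"
proof -
  interpret vec_space "TYPE(real)" "dim_row S" .
  have S: "S \<in> carrier_mat (dim_row S) (dim_col S)" by simp
  let ?T = "{col S p, col S q}"
  have ne: "col S p \<noteq> col S q"
  proof
    assume "col S p = col S q"
    then have "col S p $ i = col S q $ i" by simp
    then show False using assms by simp
  qed
  have T: "?T \<subseteq> carrier_vec (dim_row S)" by auto
  have "lin_indpt ?T"
  proof (rule finite_lin_indpt2)
    fix a assume "lincomb a ?T = 0\<^sub>v (dim_row S)"
    then have *: "a (col S p) * col S p $ l + a (col S q) * col S q $ l = 0" if "l < dim_row S" for l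
      using lincomb_index[OF that T, of a] that ne by simp
    have "a (col S q) = 0" using *[OF assms(1)] assms by simp
    moreover have "a (col S p) = 0" using *[OF assms(2)] assms calculation by simp
    ultimately show "\<forall>v\<in>?T. a v = 0" by simp
  qed (use T in auto)
  then have "card ?T \<le> rank S" using assms by (intro rank_ge_card_indpt[OF S]) (auto simp: cols_def)
  then show ?thesis unfolding mat_rank_def using ne by simp
qed

section \<open>Factors as images under slack maps\<close>

context slack_description
begin

text \<open>A factor is realised by its own slacks, so that its inequalities become nonnegativity of
  the coordinates and its slack matrix is a selection of rows.\<close>

definition image_map :: "nat list \<Rightarrow> 'a \<Rightarrow> (nat \<Rightarrow>\<^sub>0 real)" where
  "image_map es x = coords (length es) (\<lambda>k. r (es ! k) x)"

definition linear_part :: "nat list \<Rightarrow> 'a \<Rightarrow> (nat \<Rightarrow>\<^sub>0 real)" where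
  "linear_part es x = coords (length es) (\<lambda>k. - a (es ! k) x)"

definition constant_part :: "nat list \<Rightarrow> (nat \<Rightarrow>\<^sub>0 real)" where
  "constant_part es = coords (length es) (\<lambda>k. b (es ! k))"

definition row_selection :: "nat list \<Rightarrow> real mat" where
  "row_selection es = Matrix.mat (length es) n (\<lambda>(p, q). r (es ! p) (v q))"

lemma image_map_split: "image_map es x = linear_part es x + constant_part es"
  unfolding image_map_def linear_part_def constant_part_def
  by (rule poly_mapping_eqI) (simp add: lookup_coords lookup_add r_def)

lemma linear_linear_part: "linear (linear_part es)"
proof (rule linearI)
  show "linear_part es (x + y) = linear_part es x + linear_part es y" for x y
    unfolding linear_part_def
    by (rule poly_mapping_eqI) (simp add: lookup_coords lookup_add linear_add[OF lin])
  show "linear_part es (c *\<^sub>R x) = c *\<^sub>R linear_part es x" for c x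
    unfolding linear_part_def
    by (rule poly_mapping_eqI) (simp add: lookup_coords lookup_scaleR linear_scale[OF lin])
qed

lemma image_map_eq_iff: "image_map es x = image_map es y \<longleftrightarrow> (\<forall>i\<in>set es. r i x = r i y)"
  unfolding image_map_def coords_eq_iff by (auto simp: all_set_conv_all_nth)

lemma image_map_combination:
  "s + t = 1 \<Longrightarrow> image_map es (s *\<^sub>R x + t *\<^sub>R y) = s *\<^sub>R image_map es x + t *\<^sub>R image_map es y"
  unfolding image_map_def by (simp add: r_combination coords_combination)

lemma image_map_P: "image_map es ` P = convex hull ((\<lambda>j. image_map es (v j)) ` {..<n})"
proof -
  have *: "image_map es ` X = (\<lambda>x. constant_part es + x) ` linear_part es ` X" for X
    by (auto simp: image_map_split image_image add.commute)
  have "image_map es ` P = convex hull (image_map es ` v ` {..<n})"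
    unfolding P_hull * by (simp add: convex_hull_linear_image linear_linear_part convex_hull_translation)
  then show ?thesis by (simp add: image_image)
qed

lemma aff_image: "affine hull (image_map es ` P) \<subseteq> image_map es ` (affine hull P)"
proof (rule hull_minimal)
  show "image_map es ` P \<subseteq> image_map es ` (affine hull P)" using P_subset_aff by blast
  show "affine (image_map es ` (affine hull P))"
    unfolding affine_def[of "image_map es ` _"]
  proof (intro ballI allI impI)
    fix p q and s t :: real
    assume "p \<in> image_map es ` (affine hull P)" "q \<in> image_map es ` (affine hull P)" and st: "s + t = 1"
    then obtain x y where xy: "x \<in> affine hull P" "y \<in> affine hull P" "p = image_map es x" "q = image_map es y"
      by blast
    have "s *\<^sub>R x + t *\<^sub>R y \<in> affine hull P"
      using xy st by (intro mem_affine) auto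
    then show "s *\<^sub>R p + t *\<^sub>R q \<in> image_map es ` (affine hull P)"
      unfolding xy(3,4) image_map_combination[OF st, symmetric] by (rule imageI)
  qed
qed

text \<open>The lifting hypothesis ensures that nonnegativity of the coordinates cuts the image of \<open>P\<close> out
  of its affine hull.\<close>

lemma row_selection_slack:
  assumes es: "set es \<subseteq> E" "es \<noteq> []"
    and lift: "\<And>x. x \<in> affine hull P \<Longrightarrow> \<forall>i\<in>set es. 0 \<le> r i x \<Longrightarrow> \<exists>z\<in>P. \<forall>i\<in>set es. r i z = r i x"
  defines "Q \<equiv> image_map es ` P"
  shows "polytope Q" "Q \<subseteq> coord_space (length es)" "1 \<le> affine_dim Q"
    "is_slack_matrix (length es) Q (row_selection es)" "2 \<le> mat_rank (row_selection es)"
proof -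
  let ?N = "length es"
  have hull: "Q = convex hull ((\<lambda>j. image_map es (v j)) ` {..<n})" unfolding Q_def by (rule image_map_P)
  show "polytope Q" unfolding hull by (intro polytope_convex_hull) simp
  show "Q \<subseteq> coord_space ?N" unfolding Q_def image_map_def using coords_in_coord_space by blast
  have esm: "i < m" "nz i" if "i \<in> set es" for i using that es unfolding E_def by auto
  define i where "i = es ! 0"
  have i: "i \<in> set es" "0 < ?N" using es unfolding i_def by auto
  obtain p where p: "p < n" "r i (v p) = 0" using E_zero i es by blast
  obtain q where q: "q < n" "r i (v q) \<noteq> 0" using esm[OF i(1)] unfolding nz_def by blast
  have "image_map es (v p) \<noteq> image_map es (v q)" unfolding image_map_eq_iff using i(1) p(2) q(2) by metis
  then show "1 \<le> affine_dim Q"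
    by (intro affine_dim_pos[OF _ hull, of "image_map es (v p)" "image_map es (v q)"])
      (use p q v_in_P Q_def in auto)
  \<comment> \<open>Minus the identity: with right-hand side zero it expresses nonnegativity of the
    coordinates, and the slacks are the coordinates themselves.\<close>
  define A where "A = Matrix.mat ?N ?N (\<lambda>(i, k). if i = k then - 1 else (0::real))"
  have row: "row_eval A k y = - Poly_Mapping.lookup y k" if "k < ?N" for k y
  proof -
    have "row_eval A k y = (\<Sum>l<?N. if k = l then - Poly_Mapping.lookup y l else 0)"
      unfolding row_eval_def A_def using that by (intro sum.cong) auto
    then show ?thesis using that by simp
  qed
  have "Q = {x \<in> affine hull Q. \<forall>k<?N. row_eval A k x \<le> 0}"
  proof (intro equalityI subsetI)
    fix y assume y: "y \<in> Q"
    then obtain x where x: "x \<in> P" "y = image_map es x" unfolding Q_def by blast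
    have "row_eval A k y \<le> 0" if "k < ?N" for k
      using r_nonneg[OF x(1)] esm that unfolding row[OF that] x image_map_def by (simp add: lookup_coords)
    then show "y \<in> {x \<in> affine hull Q. \<forall>k<?N. row_eval A k x \<le> 0}" using y hull_inc by fastforce
  next
    fix y assume y: "y \<in> {x \<in> affine hull Q. \<forall>k<?N. row_eval A k x \<le> 0}"
    then obtain x where x: "x \<in> affine hull P" "y = image_map es x" using aff_image unfolding Q_def by blast
    have "0 \<le> r (es ! k) x" if "k < ?N" for k
      using y that row[OF that, of y] unfolding x(2) by (auto simp: image_map_def lookup_coords)
    then have "\<forall>i\<in>set es. 0 \<le> r i x" by (simp add: all_set_conv_all_nth)
    then obtain z where "z \<in> P" "\<forall>i\<in>set es. r i z = r i x" using lift[OF x(1)] by blast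
    then show "y \<in> Q" unfolding Q_def x(2) by (metis image_eqI image_map_eq_iff)
  qed
  then have cut: "Q = {x \<in> affine hull Q. \<forall>k<?N. row_eval A k x \<le> vec_index (0\<^sub>v ?N) k}" by simp
  have dim: "dim_row (row_selection es) = ?N" "dim_col (row_selection es) = n"
    unfolding row_selection_def by auto
  show "is_slack_matrix ?N Q (row_selection es)"
    unfolding is_slack_matrix_def dim
  proof (intro exI conjI)
    show "A \<in> carrier_mat ?N ?N" unfolding A_def by simp
    show "0\<^sub>v ?N \<in> carrier_vec ?N" by simp
    show "\<forall>j<n. image_map es (v j) \<in> coord_space ?N" unfolding image_map_def by (simp add: coords_in_coord_space)
    show "\<forall>k<?N. \<forall>j<n. row_selection es $$ (k, j) = vec_index (0\<^sub>v ?N) k - row_eval A k (image_map es (v j))"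
      using row by (simp add: row_selection_def image_map_def lookup_coords)
  qed (rule hull, rule cut)
  \<comment> \<open>For rank two, column \<open>p\<close> must not vanish on all selected rows. If
    it did, the ray from \<open>v p\<close> through \<open>v q\<close> would keep the selected
    slacks nonnegative, and lifting its points to \<open>P\<close> would make slack \<open>i\<close>
    unbounded on \<open>P\<close>.\<close>
  obtain k where k: "k < ?N" "r (es ! k) (v p) \<noteq> 0"
  proof (rule ccontr)
    assume "\<not> thesis"
    then have zero: "\<forall>i\<in>set es. r i (v p) = 0" using that by (auto simp: all_set_conv_all_nth)
    define M where "M = (\<Sum>j<n. r i (v j))"
    have bound: "r i x \<le> M" if "x \<in> P" for x
    proof -
      obtain u where u: "\<forall>j<n. 0 \<le> u j" "(\<Sum>j<n. u j) = 1" "x = (\<Sum>j<n. u j *\<^sub>R v j)"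
        using convex_hull_image_rep \<open>x \<in> P\<close> unfolding P_hull by metis
      have "u j * r i (v j) \<le> r i (v j)" if "j < n" for j
      proof -
        have "u j \<le> 1" using u member_le_sum[of j "{..<n}" u] that by auto
        then show ?thesis using mult_right_mono[of "u j" 1 "r i (v j)"] r_nonneg[OF v_in_P[OF that]] esm i by simp
      qed
      then show ?thesis unfolding u(3) r_sum[OF u(2)] M_def by (intro sum_mono) simp
    qed
    have rq: "0 < r i (v q)" using q r_nonneg[OF v_in_P[OF q(1)]] esm i by force
    have "0 \<le> M" using bound[OF v_in_P[OF p(1)]] p by simp
    \<comment> \<open>Chosen so that slack \<open>i\<close> takes the value \<open>M + 1\<close> at
      \<open>?x\<close>, beyond its bound on \<open>P\<close>.\<close>
    define s where "s = (M + 1) / r i (v q)"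
    let ?x = "v p + s *\<^sub>R (v q - v p)"
    have s: "0 \<le> s" using rq \<open>0 \<le> M\<close> unfolding s_def by simp
    have rx: "r l ?x = s * r l (v q)" if "l \<in> set es" for l
      using zero that unfolding r_line by simp
    have "?x \<in> affine hull P" using aff_line v_in_P p q P_subset_aff by blast
    moreover have "\<forall>l\<in>set es. 0 \<le> r l ?x" using rx s r_nonneg v_in_P q esm by simp
    ultimately obtain z where z: "z \<in> P" "\<forall>l\<in>set es. r l z = r l ?x" using lift by blast
    have "r i z = M + 1" using z(2) i rx[OF i(1)] rq unfolding s_def by simp
    then show False using bound[OF z(1)] by simp
  qed
  show "2 \<le> mat_rank (row_selection es)"
    by (rule mat_rank_ge_2I[of 0 _ k p q]) (use i k p q in \<open>auto simp: row_selection_def i_def\<close>)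
qed

text \<open>Injectivity holds because the two blocks together contain all facet rows; every pair of
  images is attained because the blocks can be prescribed independently on \<open>P\<close>.\<close>

lemma splits_equivalence:
  assumes E12: "set es1 \<union> set es2 = E" and sp: "splits (affine hull P) (set es1) (set es2)"
  shows "affinely_equivalent P ((image_map es1 ` P) \<times> (image_map es2 ` P))"
  unfolding affinely_equivalent_def
proof (intro exI conjI)
  let ?f = "\<lambda>x. (linear_part es1 x, linear_part es2 x)"
  let ?c = "(constant_part es1, constant_part es2)"
  have f: "?f x + ?c = (image_map es1 x, image_map es2 x)" for x by (simp add: image_map_split)
  show "linear ?f"
    using linear_linear_part[of es1] linear_linear_part[of es2]
    by (intro linearI) (auto simp: linear_add linear_scale)
  show "inj_on (\<lambda>x. ?f x + ?c) (affine hull P)"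
    unfolding f
  proof (rule inj_onI)
    fix x y assume xy: "x \<in> affine hull P" "y \<in> affine hull P"
      "(image_map es1 x, image_map es2 x) = (image_map es1 y, image_map es2 y)"
    then have "\<forall>i\<in>E. r i x = r i y" unfolding E12[symmetric] by (auto simp: image_map_eq_iff)
    then show "x = y" using E_injective xy by blast
  qed
  show "(\<lambda>x. ?f x + ?c) ` P = (image_map es1 ` P) \<times> (image_map es2 ` P)"
    unfolding f
  proof (intro equalityI subsetI)
    fix p assume "p \<in> (image_map es1 ` P) \<times> (image_map es2 ` P)"
    then obtain x y where xy: "x \<in> P" "y \<in> P" "p = (image_map es1 x, image_map es2 y)" by blast
    obtain z where "z \<in> P" "\<forall>i\<in>set es1. r i z = r i x" "\<forall>i\<in>set es2. r i z = r i y"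
      using splits_P[OF sp E12] xy unfolding splits_def by metis
    then show "p \<in> (\<lambda>x. (image_map es1 x, image_map es2 x)) ` P"
      unfolding xy(3) by (intro image_eqI[of _ _ z]) (auto simp: image_map_eq_iff)
  qed auto
qed

text \<open>The slacks in \<open>E2\<close> are taken from \<open>v 0\<close>, where they are
  nonnegative; this discards whatever \<open>x\<close> violates outside \<open>E1\<close>.\<close>

lemma splits_lift:
  assumes "E1 \<union> E2 = E" "splits (affine hull P) E1 E2" "x \<in> affine hull P" "\<forall>i\<in>E1. 0 \<le> r i x"
  shows "\<exists>z\<in>P. \<forall>i\<in>E1. r i z = r i x"
proof -
  have v0: "v 0 \<in> P" "v 0 \<in> affine hull P" using v_in_P n_pos P_subset_aff by auto
  from assms(2)[unfolded splits_def, rule_format, OF assms(3) v0(2)] obtain z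
    where z: "z \<in> affine hull P" "\<forall>i\<in>E1. r i z = r i x" "\<forall>i\<in>E2. r i z = r i (v 0)" by blast
  have "z \<in> P"
  proof (rule E_describes[OF z(1)], rule ballI)
    fix i assume i: "i \<in> E"
    then have "i < m" "i \<in> E1 \<or> i \<in> E2" using assms(1) unfolding E_def by auto
    then show "0 \<le> r i z" using z r_nonneg[OF v0(1)] assms(4) by metis
  qed
  then show ?thesis using z by blast
qed

lemma splits_commute: "splits X E1 E2 \<Longrightarrow> splits X E2 E1"
  unfolding splits_def by blast

end

lemma splits_factorization:
  fixes P :: "(nat \<Rightarrow>\<^sub>0 real) set"
  assumes "slack_description P m n v a b"
    and "set es1 \<union> set es2 = slack_description.E m n v a b" "es1 \<noteq> []" "es2 \<noteq> []"
    and "slack_description.splits a b (affine hull P) (set es1) (set es2)"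
  shows "\<exists>d1 P1 d2 P2. is_factorization P d1 P1 d2 P2 \<and>
    is_slack_matrix d1 P1 (slack_description.row_selection n v a b es1) \<and>
    2 \<le> mat_rank (slack_description.row_selection n v a b es1) \<and>
    is_slack_matrix d2 P2 (slack_description.row_selection n v a b es2) \<and>
    2 \<le> mat_rank (slack_description.row_selection n v a b es2)"
proof -
  interpret slack_description P m n v a b by fact
  have E21: "set es2 \<union> set es1 = E" using assms(2) by blast
  have sub: "set es1 \<subseteq> E" "set es2 \<subseteq> E" using assms(2) by auto
  note R1 = row_selection_slack[OF sub(1) assms(3) splits_lift[OF assms(2,5)]]
  note R2 = row_selection_slack[OF sub(2) assms(4) splits_lift[OF E21 splits_commute[OF assms(5)]]]
  have "is_factorization P (length es1) (image_map es1 ` P) (length es2) (image_map es2 ` P)"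
    unfolding is_factorization_def
    by (intro conjI R1(1-3) R2(1-3) splits_equivalence[OF assms(2,5)])
  then show ?thesis using R1(4,5) R2(4,5) by blast
qed

lemma factorization_splits:
  assumes "slack_description P m n v a b" "is_factorization P d1 P1 d2 P2"
  shows "\<exists>E1 E2. E1 \<union> E2 = slack_description.E m n v a b \<and> E1 \<inter> E2 = {} \<and> E1 \<noteq> {} \<and> E2 \<noteq> {} \<and>
    slack_description.splits a b P E1 E2"
proof -
  interpret slack_description P m n v a b by fact
  obtain f c where f: "linear f" "inj_on (\<lambda>x. f x + c) (affine hull P)" "(\<lambda>x. f x + c) ` P = P1 \<times> P2"
    using assms(2) unfolding is_factorization_def affinely_equivalent_def by blast
  have "1 \<le> affine_dim P1" "1 \<le> affine_dim P2" using assms(2) unfolding is_factorization_def by blast+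
  then show ?thesis by (intro product_splits[OF f] affine_dim_posD)
qed

lemma slack_matrix_description:
  assumes "is_slack_matrix d P S" "2 \<le> mat_rank S"
  obtains v a b where "slack_description P (dim_row S) (dim_col S) v a b"
    "\<And>i j. i < dim_row S \<Longrightarrow> j < dim_col S \<Longrightarrow> slack_description.r a b i (v j) = S $$ (i, j)"
proof -
  obtain A c v where *: "P = convex hull (v ` {..<dim_col S})"
      "P = {x \<in> affine hull P. \<forall>i<dim_row S. row_eval A i x \<le> vec_index c i}"
      "\<forall>i<dim_row S. \<forall>j<dim_col S. S $$ (i, j) = vec_index c i - row_eval A i (v j)"
    using assms(1) unfolding is_slack_matrix_def by blast
  obtain j k i where "j < dim_col S" "k < dim_col S" "i < dim_row S" "S $$ (i, j) \<noteq> S $$ (i, k)"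
    using mat_rank_ge_2D[OF assms(2)] by blast
  then have "\<exists>j<dim_col S. \<exists>k<dim_col S. v j \<noteq> v k" using *(3) by metis
  then have sd: "slack_description P (dim_row S) (dim_col S) v (row_eval A) (vec_index c)"
    by (rule slack_description.intro[OF linear_row_eval *(1,2)])
  show thesis
    by (rule that[OF sd]) (use *(3) in \<open>auto simp: slack_description.r_def[OF sd]\<close>)
qed

section \<open>The algorithm\<close>

lemma fold_invariant:
  assumes "I 0 s" "\<And>k s. k < N \<Longrightarrow> I k s \<Longrightarrow> I (Suc k) (g k s)"
  shows "I N (fold g [0..<N] s)"
  using assms by (induction N) auto

text \<open>In the real memory the slack matrix \<open>S\<close> is followed by the indicator \<open>K\<close> of the facet rows, the
  vector \<open>U\<close> added to the projection, the indicator \<open>R\<close> of the component and the projection matrix \<open>H\<close>.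
  The variables \<open>0\<close> and \<open>1\<close> always hold \<open>m\<close> and \<open>n\<close>.\<close>

definition layout ::
  "nat \<Rightarrow> nat \<Rightarrow> (nat \<Rightarrow> nat \<Rightarrow> real) \<Rightarrow> (nat \<Rightarrow> real) \<Rightarrow> (nat \<Rightarrow> real) \<Rightarrow> (nat \<Rightarrow> real) \<Rightarrow>
    (nat \<Rightarrow> nat \<Rightarrow> real) \<Rightarrow> (nat \<Rightarrow> real) \<Rightarrow> bool" where
  "layout m n S K U R H \<mu> \<longleftrightarrow>
     (\<forall>i<m. \<forall>j<n. \<mu> (i * n + j) = S i j) \<and>
     (\<forall>i<m. \<mu> (m * n + i) = K i) \<and>
     (\<forall>i<m. \<mu> (m * n + m + i) = U i) \<and>
     (\<forall>i<m. \<mu> (m * n + m + m + i) = R i) \<and>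
     (\<forall>i<m. \<forall>k<m. \<mu> (m * n + m + m + m + (i * m + k)) = H i k)"

lemma index_less:
  assumes "(i::nat) < m" "j < n"
  shows "i * n + j < m * n"
proof -
  have "i * n + j < Suc i * n" using assms(2) by simp
  also have "\<dots> \<le> m * n" using assms(1) by (intro mult_le_mono1) simp
  finally show ?thesis .
qed

lemma index_eq_iff:
  assumes "(k::nat) < m" "k' < m"
  shows "i * m + k = i' * m + k' \<longleftrightarrow> i = i' \<and> k = k'"
proof
  assume *: "i * m + k = i' * m + k'"
  have "(i * m + k) div m = i" "(i' * m + k') div m = i'" using assms by simp_all
  then have "i = i'" using * by metis
  then show "i = i' \<and> k = k'" using * by simp
qed simp

lemma layout_read:
  assumes "layout m n S K U R H \<mu>" "i < m"
  shows "j < n \<Longrightarrow> \<mu> (i * n + j) = S i j" "\<mu> (m * n + i) = K i" "\<mu> (m * n + m + i) = U i"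
    "\<mu> (m * n + m + m + i) = R i" "k < m \<Longrightarrow> \<mu> (m * n + m + m + m + (i * m + k)) = H i k"
  using assms unfolding layout_def by auto

lemma layout_K:
  assumes "layout m n S K U R H \<mu>" "i < m"
  shows "layout m n S (K(i := x)) U R H (\<mu>(m * n + i := x))"
proof -
  have "p * n + j \<noteq> m * n + i" if "p < m" "j < n" for p j using index_less[OF that] by simp
  then show ?thesis using assms unfolding layout_def by auto
qed

lemma layout_U:
  assumes "layout m n S K U R H \<mu>" "i < m"
  shows "layout m n S K (U(i := x)) R H (\<mu>(m * n + m + i := x))"
proof -
  have "p * n + j \<noteq> m * n + m + i" if "p < m" "j < n" for p j using index_less[OF that] by simp
  then show ?thesis using assms unfolding layout_def by auto
qed

lemma layout_R:
  assumes "layout m n S K U R H \<mu>" "i < m"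
  shows "layout m n S K U (R(i := x)) H (\<mu>(m * n + m + m + i := x))"
proof -
  have "p * n + j \<noteq> m * n + m + m + i" if "p < m" "j < n" for p j using index_less[OF that] by simp
  then show ?thesis using assms unfolding layout_def by auto
qed

lemma layout_H:
  assumes "layout m n S K U R H \<mu>" "i < m" "k < m"
  shows "layout m n S K U R (H(i := (H i)(k := x))) (\<mu>(m * n + m + m + m + (i * m + k) := x))"
proof -
  have "p * n + j \<noteq> m * n + m + m + m + (i * m + k)" if "p < m" "j < n" for p j
    using index_less[OF that] by simp
  then show ?thesis using assms unfolding layout_def by (auto simp: index_eq_iff)
qed

lemma layout_cong:
  assumes "layout m n S K U R H \<mu>"
    "\<And>i. i < m \<Longrightarrow> K i = K' i" "\<And>i. i < m \<Longrightarrow> U i = U' i" "\<And>i. i < m \<Longrightarrow> R i = R' i"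
    "\<And>i k. i < m \<Longrightarrow> k < m \<Longrightarrow> H i k = H' i k"
  shows "layout m n S K' U' R' H' \<mu>"
  using assms unfolding layout_def by simp

definition S_at :: "nat \<Rightarrow> nat \<Rightarrow> iexp" where "S_at x y = IPlus (IProd x 1) (IVar y)"
definition K_at :: "nat \<Rightarrow> iexp" where "K_at x = IPlus (IProd 0 1) (IVar x)"
definition U_at :: "nat \<Rightarrow> iexp" where "U_at x = IPlus (IPlus (IProd 0 1) (IVar 0)) (IVar x)"
definition R_at :: "nat \<Rightarrow> iexp" where
  "R_at x = IPlus (IPlus (IPlus (IProd 0 1) (IVar 0)) (IVar 0)) (IVar x)"
definition H_at :: "nat \<Rightarrow> nat \<Rightarrow> iexp" where
  "H_at x y = IPlus (IPlus (IPlus (IPlus (IProd 0 1) (IVar 0)) (IVar 0)) (IVar 0))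
     (IPlus (IProd x 0) (IVar y))"

lemma iwf_at [simp]:
  "iwf (S_at x y) \<longleftrightarrow> x < 10 \<and> y < 10" "iwf (K_at x) \<longleftrightarrow> x < 10" "iwf (U_at x) \<longleftrightarrow> x < 10"
  "iwf (R_at x) \<longleftrightarrow> x < 10" "iwf (H_at x y) \<longleftrightarrow> x < 10 \<and> y < 10"
  unfolding S_at_def K_at_def U_at_def R_at_def H_at_def by auto

lemma ival_at:
  assumes "v 0 = m" "v (Suc 0) = n"
  shows "ival v (S_at x y) = v x * n + v y" "ival v (K_at x) = m * n + v x"
    "ival v (U_at x) = m * n + m + v x" "ival v (R_at x) = m * n + m + m + v x"
    "ival v (H_at x y) = m * n + m + m + m + (v x * m + v y)"
  unfolding S_at_def K_at_def U_at_def R_at_def H_at_def using assms by auto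

text \<open>Since \<open>0 / 0 = 0\<close>, the quotient of a number by itself tells whether the number is zero.\<close>

definition Ind :: "rexp \<Rightarrow> rexp" where "Ind e = RQuot e e"
definition Neg :: "rexp \<Rightarrow> rexp" where "Neg e = RMinus (RNum 1) e"

lemma rwf_Ind_Neg [simp]: "rwf (Ind e) \<longleftrightarrow> rwf e" "rwf (Neg e) \<longleftrightarrow> rwf e"
  unfolding Ind_def Neg_def by auto

lemma rval_Ind [simp]: "rval v \<mu> (Ind e) = of_bool (rval v \<mu> e \<noteq> 0)"
  unfolding Ind_def by simp

lemma rval_Neg [simp]: "rval v \<mu> (Neg e) = 1 - rval v \<mu> e"
  unfolding Neg_def by simp

lemma sum_of_bool_eq_0: "(\<Sum>k<N. of_bool (Q k) :: real) = 0 \<longleftrightarrow> (\<forall>k<(N::nat). \<not> Q k)"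
  by (subst sum_nonneg_eq_0_iff) auto

section \<open>Detecting the facet rows\<close>

text \<open>The set \<open>E\<close> spelled out in matrix entries; the last two conjuncts are a
  proper inclusion of zero patterns.\<close>

definition facet_rows :: "nat \<Rightarrow> nat \<Rightarrow> (nat \<Rightarrow> nat \<Rightarrow> real) \<Rightarrow> nat set" where
  "facet_rows m n S = {i. i < m \<and> (\<exists>j<n. S i j \<noteq> 0) \<and>
     \<not> (\<exists>k<m. (\<exists>j<n. S k j \<noteq> 0) \<and> (\<forall>j<n. S i j = 0 \<longrightarrow> S k j = 0) \<and> (\<exists>j<n. S k j = 0 \<and> S i j \<noteq> 0))}"

text \<open>Existence is tested by counting: a sum of terms \<open>0\<close> or \<open>1\<close> is
  nonzero iff some term is. Variable \<open>3\<close> is the bound column index, whence the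
  conditions \<open>x \<noteq> 3\<close> later on.\<close>

definition nonzero_exp :: "nat \<Rightarrow> rexp" where
  "nonzero_exp x = RSum 3 1 (Ind (RGet (S_at x 3)))"

text \<open>The number of columns that refute the inclusion of the zero pattern of row
  \<open>x\<close> in that of row \<open>y\<close>.\<close>

definition violation_exp :: "nat \<Rightarrow> nat \<Rightarrow> rexp" where
  "violation_exp x y = RSum 3 1 (RTimes (Neg (Ind (RGet (S_at x 3)))) (Ind (RGet (S_at y 3))))"

definition facet_exp :: rexp where
  "facet_exp = RTimes (Ind (nonzero_exp 2)) (Neg (Ind
     (RSum 4 0 (RTimes (Ind (nonzero_exp 4))
        (RTimes (Neg (Ind (violation_exp 2 4))) (Ind (violation_exp 4 2)))))))"

lemma rval_nonzero:
  assumes L: "layout m n S K U R H \<mu>" and v: "v 0 = m" "v (Suc 0) = n" and x: "v x < m" "x \<noteq> 3"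
  shows "rval v \<mu> (nonzero_exp x) = 0 \<longleftrightarrow> (\<forall>j<n. S (v x) j = 0)"
proof -
  have "rval v \<mu> (nonzero_exp x) = (\<Sum>j<n. of_bool (S (v x) j \<noteq> 0))"
    unfolding nonzero_exp_def
    by (simp add: v x ival_at[where m = m and n = n] layout_read[OF L] cong: sum.cong_simp)
  then show ?thesis by (simp only: sum_of_bool_eq_0) auto
qed

lemma rval_violation:
  assumes L: "layout m n S K U R H \<mu>" and v: "v 0 = m" "v (Suc 0) = n"
    and x: "v x < m" "x \<noteq> 3" "v y < m" "y \<noteq> 3"
  shows "rval v \<mu> (violation_exp x y) = 0 \<longleftrightarrow> (\<forall>j<n. S (v x) j = 0 \<longrightarrow> S (v y) j = 0)"
proof -
  have "rval v \<mu> (violation_exp x y) = (\<Sum>j<n. of_bool (S (v x) j = 0 \<and> S (v y) j \<noteq> 0))"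
    unfolding violation_exp_def rval.simps(7)
    using v x by (intro sum.cong) (auto simp: ival_at[where m = m and n = n] layout_read[OF L])
  then show ?thesis by (simp only: sum_of_bool_eq_0) auto
qed

lemma rval_facet:
  assumes L: "layout m n S K U R H \<mu>" and v: "v 0 = m" "v (Suc 0) = n" and i: "v 2 < m"
  shows "rval v \<mu> facet_exp = of_bool (v 2 \<in> facet_rows m n S)"
proof -
  let ?B = "RSum 4 0 (RTimes (Ind (nonzero_exp 4))
        (RTimes (Neg (Ind (violation_exp 2 4))) (Ind (violation_exp 4 2))))"
  have "rval v \<mu> ?B = (\<Sum>k<m. of_bool ((\<exists>j<n. S k j \<noteq> 0) \<and> (\<forall>j<n. S (v 2) j = 0 \<longrightarrow> S k j = 0) \<and>
      (\<exists>j<n. S k j = 0 \<and> S (v 2) j \<noteq> 0)))"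
    unfolding rval.simps(7) v
  proof (rule sum.cong[OF refl])
    fix k assume "k \<in> {..<m}"
    then have k: "k < m" by simp
    note e = rval_nonzero[OF L, of "v(4 := k)" 4] rval_violation[OF L, of "v(4 := k)" 2 4]
      rval_violation[OF L, of "v(4 := k)" 4 2]
    show "rval (v(4 := k)) \<mu> (RTimes (Ind (nonzero_exp 4))
        (RTimes (Neg (Ind (violation_exp 2 4))) (Ind (violation_exp 4 2)))) =
      of_bool ((\<exists>j<n. S k j \<noteq> 0) \<and> (\<forall>j<n. S (v 2) j = 0 \<longrightarrow> S k j = 0) \<and>
        (\<exists>j<n. S k j = 0 \<and> S (v 2) j \<noteq> 0))"
      using e k v i by auto
  qed
  then have B: "rval v \<mu> ?B = 0 \<longleftrightarrow> \<not> (\<exists>k<m. (\<exists>j<n. S k j \<noteq> 0) \<and>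
      (\<forall>j<n. S (v 2) j = 0 \<longrightarrow> S k j = 0) \<and> (\<exists>j<n. S k j = 0 \<and> S (v 2) j \<noteq> 0))"
    by (simp only: sum_of_bool_eq_0) blast
  have "rval v \<mu> facet_exp = of_bool (rval v \<mu> (nonzero_exp 2) \<noteq> 0) * (1 - of_bool (rval v \<mu> ?B \<noteq> 0))"
    unfolding facet_exp_def by (simp only: rval.simps(5) rval_Ind rval_Neg)
  then show ?thesis
    unfolding B facet_rows_def using rval_nonzero[OF L v i] i by auto
qed

definition facet_cmd :: cmd where "facet_cmd = For 2 0 (Put (K_at 2) facet_exp)"

lemma facet_cmd:
  assumes L: "layout m n S (\<lambda>_. 0) U R H \<mu>" and v: "v 0 = m" "v (Suc 0) = n"
  shows "\<exists>\<mu>'. cval v facet_cmd (\<mu>, \<kappa>, \<tau>) = (\<mu>', \<kappa>, \<tau>) \<and>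
    layout m n S (\<lambda>i. of_bool (i \<in> facet_rows m n S)) U R H \<mu>'"
proof -
  define I where "I i \<sigma> \<longleftrightarrow> (\<exists>\<mu>'. \<sigma> = (\<mu>', \<kappa>, \<tau>) \<and>
    layout m n S (\<lambda>l. of_bool (l < i \<and> l \<in> facet_rows m n S)) U R H \<mu>')" for i :: nat and \<sigma>
  have "I m (fold (\<lambda>i. cval (v(2 := i)) (Put (K_at 2) facet_exp)) [0..<m] (\<mu>, \<kappa>, \<tau>))"
  proof (rule fold_invariant[where I = I])
    show "I 0 (\<mu>, \<kappa>, \<tau>)" unfolding I_def using L by simp
  next
    fix i \<sigma> assume i: "i < m" and "I i \<sigma>"
    then obtain \<mu>' where \<sigma>: "\<sigma> = (\<mu>', \<kappa>, \<tau>)"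
      and L': "layout m n S (\<lambda>l. of_bool (l < i \<and> l \<in> facet_rows m n S)) U R H \<mu>'"
      unfolding I_def by blast
    have "rval (v(2 := i)) \<mu>' facet_exp = of_bool (i \<in> facet_rows m n S)"
      using rval_facet[OF L', of "v(2 := i)"] v i by simp
    then have "cval (v(2 := i)) (Put (K_at 2) facet_exp) \<sigma> =
        (\<mu>'(m * n + i := of_bool (i \<in> facet_rows m n S)), \<kappa>, \<tau>)"
      using v by (simp add: \<sigma> ival_at[where m = m and n = n])
    moreover have "layout m n S (\<lambda>l. of_bool (l < Suc i \<and> l \<in> facet_rows m n S)) U R H
        (\<mu>'(m * n + i := of_bool (i \<in> facet_rows m n S)))"
      by (rule layout_cong[OF layout_K[OF L' i]]) (auto simp: less_Suc_eq)
    ultimately show "I (Suc i) (cval (v(2 := i)) (Put (K_at 2) facet_exp) \<sigma>)"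
      unfolding I_def by blast
  qed
  then obtain \<mu>' where "cval v facet_cmd (\<mu>, \<kappa>, \<tau>) = (\<mu>', \<kappa>, \<tau>)"
    "layout m n S (\<lambda>l. of_bool (l < m \<and> l \<in> facet_rows m n S)) U R H \<mu>'"
    unfolding I_def facet_cmd_def using v by auto
  moreover from this(2) have "layout m n S (\<lambda>i. of_bool (i \<in> facet_rows m n S)) U R H \<mu>'"
    by (rule layout_cong) auto
  ultimately show ?thesis by blast
qed

section \<open>Computing the projection matrix\<close>

text \<open>With the indicator of \<open>E\<close> for \<open>K\<close> this is \<open>w\<close>; a
  factor replaces the case distinction, as suits arithmetic expressions.\<close>

definition diff_column :: "(nat \<Rightarrow> nat \<Rightarrow> real) \<Rightarrow> (nat \<Rightarrow> real) \<Rightarrow> nat \<Rightarrow> nat \<Rightarrow> real" where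
  "diff_column S K j i = K i * (S i j - S i 0)"

text \<open>\<open>IProd x 1\<close> is the address of the entry in column \<open>0\<close> of row
  \<open>x\<close>.\<close>

definition diff_column_exp :: "nat \<Rightarrow> nat \<Rightarrow> rexp" where
  "diff_column_exp x y = RTimes (RGet (K_at x)) (RMinus (RGet (S_at x y)) (RGet (IProd x 1)))"

definition residual_exp :: rexp where
  "residual_exp = RMinus (diff_column_exp 2 3) (RSum 4 0 (RTimes (RGet (H_at 2 4)) (diff_column_exp 4 3)))"

text \<open>An entry of \<open>H\<close> is recomputed from its own old value and from
  \<open>U\<close> alone, so the matrix can be updated in place.\<close>

definition update_exp :: rexp where
  "update_exp = RPlus (RGet (H_at 2 4)) (RQuot (RTimes (RGet (U_at 2)) (RGet (U_at 4)))
     (RSum 5 0 (RTimes (RGet (U_at 5)) (RGet (U_at 5)))))"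

definition residual_cmd :: cmd where "residual_cmd = For 2 0 (Put (U_at 2) residual_exp)"
definition update_cmd :: cmd where "update_cmd = For 2 0 (For 4 0 (Put (H_at 2 4) update_exp))"
definition projection_cmd :: cmd where "projection_cmd = For 3 1 (Then residual_cmd update_cmd)"

lemma rval_diff_column:
  assumes L: "layout m n S K U R H \<mu>" and v: "v 0 = m" "v (Suc 0) = n" and x: "v x < m" "v y < n"
  shows "rval v \<mu> (diff_column_exp x y) = diff_column S K (v y) (v x)"
  unfolding diff_column_exp_def diff_column_def
  using v x layout_read(1)[OF L x(1), of 0] by (simp add: ival_at[where m = m and n = n] layout_read[OF L])

lemma residual_cmd:
  assumes L: "layout m n S K U R H \<mu>" and v: "v 0 = m" "v (Suc 0) = n" "v 3 < n"
  shows "\<exists>\<mu>'. cval v residual_cmd (\<mu>, \<kappa>, \<tau>) = (\<mu>', \<kappa>, \<tau>) \<and>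
    layout m n S K (residual m H (diff_column S K (v 3))) R H \<mu>'"
proof -
  let ?u = "residual m H (diff_column S K (v 3))"
  define I where "I i \<sigma> \<longleftrightarrow> (\<exists>\<mu>'. \<sigma> = (\<mu>', \<kappa>, \<tau>) \<and>
    layout m n S K (\<lambda>l. if l < i then ?u l else U l) R H \<mu>')" for i :: nat and \<sigma>
  have "I m (fold (\<lambda>i. cval (v(2 := i)) (Put (U_at 2) residual_exp)) [0..<m] (\<mu>, \<kappa>, \<tau>))"
  proof (rule fold_invariant[where I = I])
    show "I 0 (\<mu>, \<kappa>, \<tau>)" unfolding I_def using L by simp
  next
    fix i \<sigma> assume i: "i < m" and "I i \<sigma>"
    then obtain \<mu>' where \<sigma>: "\<sigma> = (\<mu>', \<kappa>, \<tau>)"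
      and L': "layout m n S K (\<lambda>l. if l < i then ?u l else U l) R H \<mu>'"
      unfolding I_def by blast
    have "rval (v(2 := i)) \<mu>' (diff_column_exp 2 3) = diff_column S K (v 3) i"
      using rval_diff_column[OF L', of "v(2 := i)" 2 3] v i by simp
    moreover have "rval (v(2 := i, 4 := k)) \<mu>' (RTimes (RGet (H_at 2 4)) (diff_column_exp 4 3)) =
        H i k * diff_column S K (v 3) k" if "k < m" for k
      using rval_diff_column[OF L', of "v(2 := i, 4 := k)" 4 3] v i that
      by (simp add: ival_at[where m = m and n = n] layout_read[OF L'])
    then have "rval (v(2 := i)) \<mu>' (RSum 4 0 (RTimes (RGet (H_at 2 4)) (diff_column_exp 4 3))) =
        (\<Sum>k<m. H i k * diff_column S K (v 3) k)"
      unfolding rval.simps(7) using v by (intro sum.cong) auto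
    ultimately have "rval (v(2 := i)) \<mu>' residual_exp = ?u i"
      unfolding residual_exp_def residual_def by (simp only: rval.simps(4))
    then have "cval (v(2 := i)) (Put (U_at 2) residual_exp) \<sigma> = (\<mu>'(m * n + m + i := ?u i), \<kappa>, \<tau>)"
      using v by (simp add: \<sigma> ival_at[where m = m and n = n])
    moreover have "layout m n S K (\<lambda>l. if l < Suc i then ?u l else U l) R H (\<mu>'(m * n + m + i := ?u i))"
      by (rule layout_cong[OF layout_U[OF L' i]]) (auto simp: less_Suc_eq)
    ultimately show "I (Suc i) (cval (v(2 := i)) (Put (U_at 2) residual_exp) \<sigma>)"
      unfolding I_def by blast
  qed
  then obtain \<mu>' where "cval v residual_cmd (\<mu>, \<kappa>, \<tau>) = (\<mu>', \<kappa>, \<tau>)"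
    "layout m n S K (\<lambda>l. if l < m then ?u l else U l) R H \<mu>'"
    unfolding I_def residual_cmd_def using v by auto
  moreover from this(2) have "layout m n S K ?u R H \<mu>'" by (rule layout_cong) auto
  ultimately show ?thesis by blast
qed

lemma update_cmd:
  assumes L: "layout m n S K U R H \<mu>" and v: "v 0 = m" "v (Suc 0) = n"
  shows "\<exists>\<mu>'. cval v update_cmd (\<mu>, \<kappa>, \<tau>) = (\<mu>', \<kappa>, \<tau>) \<and>
    layout m n S K U R (\<lambda>i k. H i k + U i * U k / (\<Sum>l<m. U l * U l)) \<mu>'"
proof -
  define G where "G i k = H i k + U i * U k / (\<Sum>l<m. U l * U l)" for i k
  define I where "I i \<sigma> \<longleftrightarrow> (\<exists>\<mu>'. \<sigma> = (\<mu>', \<kappa>, \<tau>) \<and>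
    layout m n S K U R (\<lambda>l. if l < i then G l else H l) \<mu>')" for i :: nat and \<sigma>
  define J where "J i k \<sigma> \<longleftrightarrow> (\<exists>\<mu>'. \<sigma> = (\<mu>', \<kappa>, \<tau>) \<and>
    layout m n S K U R (\<lambda>l p. if l < i \<or> l = i \<and> p < k then G l p else H l p) \<mu>')" for i k :: nat and \<sigma>
  have "I m (fold (\<lambda>i. cval (v(2 := i)) (For 4 0 (Put (H_at 2 4) update_exp))) [0..<m] (\<mu>, \<kappa>, \<tau>))"
  proof (rule fold_invariant[where I = I])
    show "I 0 (\<mu>, \<kappa>, \<tau>)" unfolding I_def using L by simp
  next
    fix i \<sigma> assume i: "i < m" and Ii: "I i \<sigma>"
    have "J i m (fold (\<lambda>k. cval (v(2 := i, 4 := k)) (Put (H_at 2 4) update_exp)) [0..<m] \<sigma>)"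
    proof (rule fold_invariant[where I = "J i"])
      obtain \<mu>' where "\<sigma> = (\<mu>', \<kappa>, \<tau>)" and L': "layout m n S K U R (\<lambda>l. if l < i then G l else H l) \<mu>'"
        using Ii unfolding I_def by blast
      moreover have "layout m n S K U R (\<lambda>l p. if l < i \<or> l = i \<and> p < 0 then G l p else H l p) \<mu>'"
        by (rule layout_cong[OF L']) auto
      ultimately show "J i 0 \<sigma>" unfolding J_def by blast
    next
      fix k \<sigma> assume k: "k < m" and "J i k \<sigma>"
      then obtain \<mu>' where \<sigma>: "\<sigma> = (\<mu>', \<kappa>, \<tau>)"
        and L': "layout m n S K U R (\<lambda>l p. if l < i \<or> l = i \<and> p < k then G l p else H l p) \<mu>'"
        unfolding J_def by blast
      have "rval (v(2 := i, 4 := k)) \<mu>' update_exp = G i k"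
        unfolding update_exp_def G_def using v i k
        by (simp add: ival_at[where m = m and n = n] layout_read[OF L'] cong: sum.cong_simp)
      then have "cval (v(2 := i, 4 := k)) (Put (H_at 2 4) update_exp) \<sigma> =
          (\<mu>'(m * n + m + m + m + (i * m + k) := G i k), \<kappa>, \<tau>)"
        using v by (simp add: \<sigma> ival_at[where m = m and n = n])
      moreover have "layout m n S K U R (\<lambda>l p. if l < i \<or> l = i \<and> p < Suc k then G l p else H l p)
          (\<mu>'(m * n + m + m + m + (i * m + k) := G i k))"
        by (rule layout_cong[OF layout_H[OF L' i k]]) (auto simp: less_Suc_eq)
      ultimately show "J i (Suc k) (cval (v(2 := i, 4 := k)) (Put (H_at 2 4) update_exp) \<sigma>)"
        unfolding J_def by blast
    qed
    then obtain \<mu>' where "cval (v(2 := i)) (For 4 0 (Put (H_at 2 4) update_exp)) \<sigma> = (\<mu>', \<kappa>, \<tau>)"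
      and L': "layout m n S K U R (\<lambda>l p. if l < i \<or> l = i \<and> p < m then G l p else H l p) \<mu>'"
      unfolding J_def using v by auto
    moreover have "layout m n S K U R (\<lambda>l. if l < Suc i then G l else H l) \<mu>'"
      by (rule layout_cong[OF L']) (auto simp: less_Suc_eq)
    ultimately show "I (Suc i) (cval (v(2 := i)) (For 4 0 (Put (H_at 2 4) update_exp)) \<sigma>)"
      unfolding I_def by blast
  qed
  then obtain \<mu>' where "cval v update_cmd (\<mu>, \<kappa>, \<tau>) = (\<mu>', \<kappa>, \<tau>)"
    "layout m n S K U R (\<lambda>l. if l < m then G l else H l) \<mu>'"
    unfolding I_def update_cmd_def using v by auto
  moreover from this(2) have "layout m n S K U R G \<mu>'" by (rule layout_cong) auto
  ultimately show ?thesis unfolding G_def by blast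
qed

lemma projection_cmd:
  assumes L: "layout m n S K U R (\<lambda>_ _. 0) \<mu>" and v: "v 0 = m" "v (Suc 0) = n"
  shows "\<exists>\<mu>' U H. cval v projection_cmd (\<mu>, \<kappa>, \<tau>) = (\<mu>', \<kappa>, \<tau>) \<and>
    layout m n S K U R H \<mu>' \<and> projection m n (diff_column S K) H"
proof -
  define I where "I j \<sigma> \<longleftrightarrow> (\<exists>\<mu>' U H. \<sigma> = (\<mu>', \<kappa>, \<tau>) \<and> layout m n S K U R H \<mu>' \<and>
    projection m j (diff_column S K) H)" for j :: nat and \<sigma>
  have "I n (fold (\<lambda>j. cval (v(3 := j)) (Then residual_cmd update_cmd)) [0..<n] (\<mu>, \<kappa>, \<tau>))"
  proof (rule fold_invariant[where I = I])
    show "I 0 (\<mu>, \<kappa>, \<tau>)" unfolding I_def using L projection_0 by blast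
  next
    fix j \<sigma> assume j: "j < n" and "I j \<sigma>"
    then obtain \<mu>1 U1 H where 1: "\<sigma> = (\<mu>1, \<kappa>, \<tau>)" "layout m n S K U1 R H \<mu>1"
      "projection m j (diff_column S K) H" unfolding I_def by blast
    let ?v = "v(3 := j)" and ?U = "residual m H (diff_column S K j)"
    have v': "?v 0 = m" "?v (Suc 0) = n" "?v 3 < n" using v j by auto
    obtain \<mu>2 where 2: "cval ?v residual_cmd (\<mu>1, \<kappa>, \<tau>) = (\<mu>2, \<kappa>, \<tau>)" "layout m n S K ?U R H \<mu>2"
      using residual_cmd[OF 1(2) v', of \<kappa> \<tau>] unfolding fun_upd_same by blast
    obtain \<mu>3 where 3: "cval ?v update_cmd (\<mu>2, \<kappa>, \<tau>) = (\<mu>3, \<kappa>, \<tau>)"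
      "layout m n S K ?U R (\<lambda>i k. H i k + ?U i * ?U k / (\<Sum>l<m. ?U l * ?U l)) \<mu>3"
      using update_cmd[OF 2(2) v'(1,2), of \<kappa> \<tau>] by blast
    have "cval ?v (Then residual_cmd update_cmd) \<sigma> = (\<mu>3, \<kappa>, \<tau>)" using 1 2 3 by simp
    then show "I (Suc j) (cval ?v (Then residual_cmd update_cmd) \<sigma>)"
      unfolding I_def using 3(2) projection_Suc[OF 1(3)] by blast
  qed
  then show ?thesis unfolding I_def projection_cmd_def using v by auto
qed

section \<open>The connected component of the first facet row\<close>

text \<open>The sum runs over the indices below the current value of variable \<open>2\<close>, so
  it counts the facet rows before the present one.\<close>

definition first_exp :: rexp where
  "first_exp = RTimes (RGet (K_at 2)) (Neg (Ind (RSum 4 2 (RGet (K_at 4)))))"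

definition first_cmd :: cmd where "first_cmd = For 2 0 (Put (R_at 2) first_exp)"

lemma first_cmd:
  assumes L: "layout m n S (\<lambda>i. of_bool (i \<in> X)) U R H \<mu>" and v: "v 0 = m" "v (Suc 0) = n"
    and X: "p \<in> X" "\<And>i. i < p \<Longrightarrow> i \<notin> X"
  shows "\<exists>\<mu>'. cval v first_cmd (\<mu>, \<kappa>, \<tau>) = (\<mu>', \<kappa>, \<tau>) \<and>
    layout m n S (\<lambda>i. of_bool (i \<in> X)) U (\<lambda>i. of_bool (i = p)) H \<mu>'"
proof -
  define I where "I i \<sigma> \<longleftrightarrow> (\<exists>\<mu>'. \<sigma> = (\<mu>', \<kappa>, \<tau>) \<and>
    layout m n S (\<lambda>i. of_bool (i \<in> X)) U (\<lambda>l. if l < i then of_bool (l = p) else R l) H \<mu>')"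
    for i :: nat and \<sigma>
  have "I m (fold (\<lambda>i. cval (v(2 := i)) (Put (R_at 2) first_exp)) [0..<m] (\<mu>, \<kappa>, \<tau>))"
  proof (rule fold_invariant[where I = I])
    show "I 0 (\<mu>, \<kappa>, \<tau>)" unfolding I_def using L by simp
  next
    fix i \<sigma> assume i: "i < m" and "I i \<sigma>"
    then obtain \<mu>' where \<sigma>: "\<sigma> = (\<mu>', \<kappa>, \<tau>)"
      and L': "layout m n S (\<lambda>i. of_bool (i \<in> X)) U (\<lambda>l. if l < i then of_bool (l = p) else R l) H \<mu>'"
      unfolding I_def by blast
    have "rval (v(2 := i)) \<mu>' (RSum 4 2 (RGet (K_at 4))) = (\<Sum>k<i. of_bool (k \<in> X))"
      unfolding rval.simps(7)
      using v i by (intro sum.cong) (auto simp: ival_at[where m = m and n = n] layout_read[OF L'])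
    then have "rval (v(2 := i)) \<mu>' (RSum 4 2 (RGet (K_at 4))) = 0 \<longleftrightarrow> (\<forall>k<i. k \<notin> X)"
      by (simp only: sum_of_bool_eq_0)
    moreover have "rval (v(2 := i)) \<mu>' (RGet (K_at 2)) = of_bool (i \<in> X)"
      using v i by (simp add: ival_at[where m = m and n = n] layout_read[OF L'])
    moreover have "i = p \<longleftrightarrow> i \<in> X \<and> (\<forall>k<i. k \<notin> X)" using X by (metis linorder_neqE_nat)
    ultimately have "rval (v(2 := i)) \<mu>' first_exp = of_bool (i = p)"
      unfolding first_exp_def by (simp only: rval.simps(5) rval_Ind rval_Neg) auto
    then have "cval (v(2 := i)) (Put (R_at 2) first_exp) \<sigma> =
        (\<mu>'(m * n + m + m + i := of_bool (i = p)), \<kappa>, \<tau>)"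
      using v by (simp add: \<sigma> ival_at[where m = m and n = n])
    moreover have "layout m n S (\<lambda>i. of_bool (i \<in> X)) U (\<lambda>l. if l < Suc i then of_bool (l = p) else R l) H
        (\<mu>'(m * n + m + m + i := of_bool (i = p)))"
      by (rule layout_cong[OF layout_R[OF L' i]]) (auto simp: less_Suc_eq)
    ultimately show "I (Suc i) (cval (v(2 := i)) (Put (R_at 2) first_exp) \<sigma>)"
      unfolding I_def by blast
  qed
  then obtain \<mu>' where "cval v first_cmd (\<mu>, \<kappa>, \<tau>) = (\<mu>', \<kappa>, \<tau>)"
    "layout m n S (\<lambda>i. of_bool (i \<in> X)) U (\<lambda>l. if l < m then of_bool (l = p) else R l) H \<mu>'"
    unfolding I_def first_cmd_def using v by auto
  moreover from this(2) have "layout m n S (\<lambda>i. of_bool (i \<in> X)) U (\<lambda>i. of_bool (i = p)) H \<mu>'"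
    by (rule layout_cong) auto
  ultimately show ?thesis by blast
qed

definition close_at :: "nat \<Rightarrow> (nat \<Rightarrow> nat \<Rightarrow> real) \<Rightarrow> nat \<Rightarrow> nat set \<Rightarrow> nat set" where
  "close_at m H k X = X \<union> (if \<exists>i<m. i \<in> X \<and> H i k \<noteq> 0 then {k} else {})"

text \<open>Indices added during a round already count within the same round. This matches the
  update in place of \<open>R\<close>; a round adds at least all neighbours of
  \<open>X\<close>.\<close>

definition close_round :: "nat \<Rightarrow> (nat \<Rightarrow> nat \<Rightarrow> real) \<Rightarrow> nat set \<Rightarrow> nat set" where
  "close_round m H = fold (close_at m H) [0..<m]"

definition closed_under :: "nat \<Rightarrow> (nat \<Rightarrow> nat \<Rightarrow> real) \<Rightarrow> nat set \<Rightarrow> bool" where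
  "closed_under m H X \<longleftrightarrow> (\<forall>i<m. \<forall>k<m. i \<in> X \<longrightarrow> H i k \<noteq> 0 \<longrightarrow> k \<in> X)"

lemma close_round_increasing: "X \<subseteq> close_round m H X"
  unfolding close_round_def
  by (rule fold_invariant[where I = "\<lambda>_ Y. X \<subseteq> Y"]) (auto simp: close_at_def)

lemma close_round_bounded: "X \<subseteq> {..<m} \<Longrightarrow> close_round m H X \<subseteq> {..<m}"
  unfolding close_round_def
  by (rule fold_invariant[where I = "\<lambda>_ Y. Y \<subseteq> {..<m}"]) (auto simp: close_at_def)

lemma close_round_least:
  "closed_under m H Y \<Longrightarrow> X \<subseteq> Y \<Longrightarrow> close_round m H X \<subseteq> Y"
  unfolding close_round_def
  by (rule fold_invariant[where I = "\<lambda>_ Z. Z \<subseteq> Y"]) (auto simp: close_at_def closed_under_def)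

lemma close_round_fixpoint:
  assumes "close_round m H X = X"
  shows "closed_under m H X"
  unfolding closed_under_def
proof (intro allI impI)
  fix i k assume ik: "i < m" "k < m" "i \<in> X" "H i k \<noteq> 0"
  have "X \<subseteq> fold (close_at m H) [0..<m] X \<and> (\<forall>l<m. (\<exists>i<m. i \<in> X \<and> H i l \<noteq> 0) \<longrightarrow> l \<in> fold (close_at m H) [0..<m] X)"
    by (rule fold_invariant[where I = "\<lambda>k Y. X \<subseteq> Y \<and> (\<forall>l<k. (\<exists>i<m. i \<in> X \<and> H i l \<noteq> 0) \<longrightarrow> l \<in> Y)"])
      (auto simp: close_at_def less_Suc_eq)
  then show "k \<in> X" using ik assms unfolding close_round_def by auto
qed

lemma iterated_close_round:
  fixes H :: "nat \<Rightarrow> nat \<Rightarrow> real"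
  assumes "X \<subseteq> {..<m}"
  defines "C \<equiv> (close_round m H ^^ m) X"
  shows "closed_under m H C" "X \<subseteq> C" "C \<subseteq> {..<m}" "closed_under m H Y \<Longrightarrow> X \<subseteq> Y \<Longrightarrow> C \<subseteq> Y"
proof -
  define f where "f k = (close_round m H ^^ k) X" for k
  have f: "f 0 = X" "f (Suc k) = close_round m H (f k)" for k unfolding f_def by auto
  have bounded: "f k \<subseteq> {..<m}" for k by (induction k) (use assms close_round_bounded f in auto)
  have "mono f" by (rule incseq_SucI) (use f close_round_increasing in auto)
  moreover have "finite (range f)"
    by (rule finite_subset[of _ "Pow {..<m}"]) (use bounded in auto)
  \<comment> \<open>An increasing chain of subsets of \<open>{..<m}\<close> that stops growing once
    it stagnates can grow at most \<open>m\<close> times, so \<open>m\<close> rounds reach the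
    limit.\<close>
  ultimately have "f (card {..<m}) = (\<Union>k. f k)"
    using bounded f(2)
    by (intro finite_mono_strict_prefix_implies_finite_fixpoint
        finite_mono_remains_stable_implies_strict_prefix) auto
  then have "f m = (\<Union>k. f k)" by simp
  moreover have "f m \<subseteq> f (Suc m)" using f(2) close_round_increasing by auto
  ultimately have "close_round m H (f m) = f m" using f(2) by (metis UN_upper UNIV_I subset_antisym)
  then show "closed_under m H C" unfolding C_def f_def[symmetric] by (rule close_round_fixpoint)
  show "X \<subseteq> C" unfolding C_def f_def[symmetric] using f(1) \<open>f m = (\<Union>k. f k)\<close> by blast
  show "C \<subseteq> {..<m}" unfolding C_def f_def[symmetric] by (rule bounded)
  assume Y: "closed_under m H Y" "X \<subseteq> Y"
  have "f k \<subseteq> Y" for k by (induction k) (use Y f close_round_least in auto)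
  then show "C \<subseteq> Y" unfolding C_def f_def[symmetric] .
qed

definition close_exp :: rexp where
  "close_exp = Ind (RPlus (RGet (R_at 4)) (RSum 2 0 (RTimes (RGet (R_at 2)) (Ind (RGet (H_at 2 4))))))"

definition round_cmd :: cmd where "round_cmd = For 4 0 (Put (R_at 4) close_exp)"
definition close_cmd :: cmd where "close_cmd = For 5 0 round_cmd"

lemma round_cmd:
  assumes L: "layout m n S K U (\<lambda>i. of_bool (i \<in> X)) H \<mu>" and v: "v 0 = m" "v (Suc 0) = n"
  shows "\<exists>\<mu>'. cval v round_cmd (\<mu>, \<kappa>, \<tau>) = (\<mu>', \<kappa>, \<tau>) \<and>
    layout m n S K U (\<lambda>i. of_bool (i \<in> close_round m H X)) H \<mu>'"
proof -
  define I where "I k \<sigma> \<longleftrightarrow> (\<exists>\<mu>'. \<sigma> = (\<mu>', \<kappa>, \<tau>) \<and>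
    layout m n S K U (\<lambda>i. of_bool (i \<in> fold (close_at m H) [0..<k] X)) H \<mu>')"
    for k :: nat and \<sigma>
  have "I m (fold (\<lambda>k. cval (v(4 := k)) (Put (R_at 4) close_exp)) [0..<m] (\<mu>, \<kappa>, \<tau>))"
  proof (rule fold_invariant[where I = I])
    show "I 0 (\<mu>, \<kappa>, \<tau>)" unfolding I_def using L by simp
  next
    fix k \<sigma> assume k: "k < m" and "I k \<sigma>"
    define Y where "Y = fold (close_at m H) [0..<k] X"
    obtain \<mu>' where \<sigma>: "\<sigma> = (\<mu>', \<kappa>, \<tau>)" and L': "layout m n S K U (\<lambda>i. of_bool (i \<in> Y)) H \<mu>'"
      using \<open>I k \<sigma>\<close> unfolding I_def Y_def by blast
    have "rval (v(4 := k)) \<mu>' (RSum 2 0 (RTimes (RGet (R_at 2)) (Ind (RGet (H_at 2 4))))) =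
        (\<Sum>i<m. of_bool (i \<in> Y \<and> H i k \<noteq> 0))"
      unfolding rval.simps(7)
      using v k by (intro sum.cong) (auto simp: ival_at[where m = m and n = n] layout_read[OF L'])
    moreover have "rval (v(4 := k)) \<mu>' (RGet (R_at 4)) = of_bool (k \<in> Y)"
      using v k by (simp add: ival_at[where m = m and n = n] layout_read[OF L'])
    ultimately have "rval (v(4 := k)) \<mu>' close_exp =
        of_bool (of_bool (k \<in> Y) + (\<Sum>i<m. of_bool (i \<in> Y \<and> H i k \<noteq> 0)) \<noteq> (0::real))"
      unfolding close_exp_def by (simp only: rval.simps(3) rval_Ind)
    also have "\<dots> = of_bool (k \<in> close_at m H k Y)"
    proof -
      have "0 \<le> (\<Sum>i<m. of_bool (i \<in> Y \<and> H i k \<noteq> 0) :: real)" by (rule sum_nonneg) simp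
      then have "of_bool (k \<in> Y) + (\<Sum>i<m. of_bool (i \<in> Y \<and> H i k \<noteq> 0)) = (0::real) \<longleftrightarrow>
          k \<notin> Y \<and> (\<Sum>i<m. of_bool (i \<in> Y \<and> H i k \<noteq> 0) :: real) = 0"
        by (simp add: add_nonneg_eq_0_iff)
      also have "\<dots> \<longleftrightarrow> k \<notin> close_at m H k Y" unfolding sum_of_bool_eq_0 close_at_def by auto
      finally show ?thesis by simp
    qed
    finally have "cval (v(4 := k)) (Put (R_at 4) close_exp) \<sigma> =
        (\<mu>'(m * n + m + m + k := of_bool (k \<in> close_at m H k Y)), \<kappa>, \<tau>)"
      using v by (simp add: \<sigma> ival_at[where m = m and n = n])
    moreover have "layout m n S K U (\<lambda>i. of_bool (i \<in> close_at m H k Y)) H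
        (\<mu>'(m * n + m + m + k := of_bool (k \<in> close_at m H k Y)))"
      by (rule layout_cong[OF layout_R[OF L' k]]) (auto simp: close_at_def)
    moreover have "close_at m H k Y = fold (close_at m H) [0..<Suc k] X" unfolding Y_def by simp
    ultimately show "I (Suc k) (cval (v(4 := k)) (Put (R_at 4) close_exp) \<sigma>)"
      unfolding I_def by auto
  qed
  then show ?thesis unfolding I_def round_cmd_def close_round_def using v by simp
qed

lemma close_cmd:
  assumes L: "layout m n S K U (\<lambda>i. of_bool (i \<in> X)) H \<mu>" and v: "v 0 = m" "v (Suc 0) = n"
  shows "\<exists>\<mu>'. cval v close_cmd (\<mu>, \<kappa>, \<tau>) = (\<mu>', \<kappa>, \<tau>) \<and>
    layout m n S K U (\<lambda>i. of_bool (i \<in> (close_round m H ^^ m) X)) H \<mu>'"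
proof -
  define I where "I k \<sigma> \<longleftrightarrow> (\<exists>\<mu>'. \<sigma> = (\<mu>', \<kappa>, \<tau>) \<and>
    layout m n S K U (\<lambda>i. of_bool (i \<in> (close_round m H ^^ k) X)) H \<mu>')"
    for k :: nat and \<sigma>
  have "I m (fold (\<lambda>k. cval (v(5 := k)) round_cmd) [0..<m] (\<mu>, \<kappa>, \<tau>))"
  proof (rule fold_invariant[where I = I])
    show "I 0 (\<mu>, \<kappa>, \<tau>)" unfolding I_def using L by simp
  next
    fix k \<sigma> assume "I k \<sigma>"
    then obtain \<mu>' where \<sigma>: "\<sigma> = (\<mu>', \<kappa>, \<tau>)"
      and L': "layout m n S K U (\<lambda>i. of_bool (i \<in> (close_round m H ^^ k) X)) H \<mu>'"
      unfolding I_def by blast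
    show "I (Suc k) (cval (v(5 := k)) round_cmd \<sigma>)"
      using round_cmd[OF L', of "v(5 := k)" \<kappa> \<tau>] v unfolding I_def \<sigma> by auto
  qed
  then show ?thesis unfolding I_def close_cmd_def using v by simp
qed

section \<open>Output and correctness\<close>

text \<open>The number of selected rows is counted by \<open>Tick\<close> while the entries go to
  the tape; it becomes a dimension of the output.\<close>

definition emit_cmd :: "nat \<Rightarrow> rexp \<Rightarrow> cmd" where
  "emit_cmd c e = For 2 0 (Test e (Then (Tick c) (For 3 1 (Out (RGet (S_at 2 3))))))"

definition rows_of :: "nat \<Rightarrow> (nat \<Rightarrow> nat \<Rightarrow> real) \<Rightarrow> nat list \<Rightarrow> real list" where
  "rows_of n S es = concat (map (\<lambda>i. map (S i) [0..<n]) es)"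

lemma emit_row:
  assumes L: "layout m n S K U R H \<mu>" and v: "v 0 = m" "v (Suc 0) = n" "v 2 < m"
  shows "cval v (For 3 1 (Out (RGet (S_at 2 3)))) (\<mu>, \<kappa>, \<tau>) = (\<mu>, \<kappa>, \<tau> @ map (S (v 2)) [0..<n])"
proof -
  have "fold (\<lambda>j. cval (v(3 := j)) (Out (RGet (S_at 2 3)))) [0..<n] (\<mu>, \<kappa>, \<tau>) =
      (\<mu>, \<kappa>, \<tau> @ map (S (v 2)) [0..<n])"
    by (rule fold_invariant[where I = "\<lambda>j \<sigma>. \<sigma> = (\<mu>, \<kappa>, \<tau> @ map (S (v 2)) [0..<j])"])
      (use v in \<open>auto simp: ival_at[where m = m and n = n] layout_read[OF L]\<close>)
  then show ?thesis using v by simp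
qed

lemma emit_cmd:
  assumes L: "layout m n S K U R H \<mu>" and v: "v 0 = m" "v (Suc 0) = n"
    and e: "\<And>i. i < m \<Longrightarrow> rval (v(2 := i)) \<mu> e \<noteq> 0 \<longleftrightarrow> i \<in> X"
  shows "cval v (emit_cmd c e) (\<mu>, \<kappa>, \<tau>) =
    (\<mu>, \<kappa>(c := \<kappa> c + length (filter (\<lambda>i. i \<in> X) [0..<m])),
     \<tau> @ rows_of n S (filter (\<lambda>i. i \<in> X) [0..<m]))"
proof -
  let ?c = "Test e (Then (Tick c) (For 3 1 (Out (RGet (S_at 2 3)))))"
  define I where "I k \<sigma> \<longleftrightarrow> \<sigma> = (\<mu>, \<kappa>(c := \<kappa> c + length (filter (\<lambda>i. i \<in> X) [0..<k])),
     \<tau> @ rows_of n S (filter (\<lambda>i. i \<in> X) [0..<k]))" for k :: nat and \<sigma>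
  have "I m (fold (\<lambda>i. cval (v(2 := i)) ?c) [0..<m] (\<mu>, \<kappa>, \<tau>))"
  proof (rule fold_invariant[where I = I])
    show "I 0 (\<mu>, \<kappa>, \<tau>)" unfolding I_def rows_of_def by simp
  next
    fix i \<sigma> assume i: "i < m" and "I i \<sigma>"
    then show "I (Suc i) (cval (v(2 := i)) ?c \<sigma>)"
      using emit_row[OF L, of "v(2 := i)"] e[OF i] v i unfolding I_def by (auto simp: rows_of_def simp del: cval.simps(5))
  qed
  then show ?thesis unfolding I_def emit_cmd_def using v by simp
qed

definition complement_exp :: rexp where
  "complement_exp = RTimes (RGet (K_at 2)) (Neg (RGet (R_at 2)))"

text \<open>Counters \<open>0\<close> and \<open>1\<close> receive the row counts, counter
  \<open>2\<close> the answer: a product is reported iff some facet row lies outside the component.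
  The rows are written in either case.\<close>

definition output_cmd :: cmd where
  "output_cmd = Then (emit_cmd 0 (RGet (R_at 2))) (Then (emit_cmd 1 complement_exp)
     (Test (RSum 2 0 complement_exp) (Tick 2)))"

lemma output_cmd:
  assumes L: "layout m n S (\<lambda>i. of_bool (i \<in> F)) U (\<lambda>i. of_bool (i \<in> C)) H \<mu>"
    and v: "v 0 = m" "v (Suc 0) = n"
  defines "es1 \<equiv> filter (\<lambda>i. i \<in> C) [0..<m]" and "es2 \<equiv> filter (\<lambda>i. i \<in> F - C) [0..<m]"
  shows "cval v output_cmd (\<mu>, \<lambda>_. 0, []) =
    (\<mu>, (\<lambda>_. 0)(0 := length es1, 1 := length es2, 2 := of_bool (es2 \<noteq> [])),
     rows_of n S es1 @ rows_of n S es2)"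
proof -
  have R: "rval (v(2 := i)) \<mu> (RGet (R_at 2)) \<noteq> 0 \<longleftrightarrow> i \<in> C" if "i < m" for i
    using v that by (simp add: ival_at[where m = m and n = n] layout_read[OF L])
  have cmp: "rval (v(2 := i)) \<mu> complement_exp = of_bool (i \<in> F - C)" if "i < m" for i
    unfolding complement_exp_def
    using v that by (simp add: ival_at[where m = m and n = n] layout_read[OF L])
  then have cmp': "rval (v(2 := i)) \<mu> complement_exp \<noteq> 0 \<longleftrightarrow> i \<in> F - C" if "i < m" for i
    using that by simp
  have "rval v \<mu> (RSum 2 0 complement_exp) = (\<Sum>i<m. of_bool (i \<in> F - C))"
    unfolding rval.simps(7) v using cmp by (intro sum.cong) auto
  then have "rval v \<mu> (RSum 2 0 complement_exp) = 0 \<longleftrightarrow> es2 = []"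
    unfolding es2_def by (simp only: sum_of_bool_eq_0) (auto simp: filter_empty_conv)
  then have T: "cval v (Test (RSum 2 0 complement_exp) (Tick 2)) (\<mu>, \<kappa>, \<tau>) =
      (\<mu>, \<kappa>(2 := \<kappa> 2 + of_bool (es2 \<noteq> [])), \<tau>)" for \<kappa> \<tau>
    by (auto simp del: rval.simps)
  have 1: "cval v (emit_cmd 0 (RGet (R_at 2))) (\<mu>, \<kappa>, \<tau>) =
      (\<mu>, \<kappa>(0 := \<kappa> 0 + length es1), \<tau> @ rows_of n S es1)" for \<kappa> \<tau>
    unfolding es1_def by (rule emit_cmd[OF L v]) (rule R)
  have 2: "cval v (emit_cmd 1 complement_exp) (\<mu>, \<kappa>, \<tau>) =
      (\<mu>, \<kappa>(1 := \<kappa> 1 + length es2), \<tau> @ rows_of n S es2)" for \<kappa> \<tau>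
    unfolding es2_def by (rule emit_cmd[OF L v]) (rule cmp')
  show ?thesis
    unfolding output_cmd_def cval.simps(6) 1 2 T by (simp add: fun_eq_iff)
qed

section \<open>The complete program\<close>

definition factor_cmd :: cmd where
  "factor_cmd = Then facet_cmd (Then projection_cmd (Then first_cmd (Then close_cmd output_cmd)))"

lemma factor_cmd:
  fixes m n :: nat and S :: "nat \<Rightarrow> nat \<Rightarrow> real"
  defines "F \<equiv> facet_rows m n S"
  assumes L: "layout m n S (\<lambda>_. 0) (\<lambda>_. 0) (\<lambda>_. 0) (\<lambda>_ _. 0) \<mu>" and v: "v 0 = m" "v (Suc 0) = n"
    and F: "p \<in> F" "\<And>i. i < p \<Longrightarrow> i \<notin> F"
  obtains \<mu>' H C es1 es2 where
    "projection m n (diff_column S (\<lambda>i. of_bool (i \<in> F))) H"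
    "C = (close_round m H ^^ m) {p}"
    "es1 = filter (\<lambda>i. i \<in> C) [0..<m]" "es2 = filter (\<lambda>i. i \<in> F - C) [0..<m]"
    "cval v factor_cmd (\<mu>, \<lambda>_. 0, []) =
      (\<mu>', (\<lambda>_. 0)(0 := length es1, 1 := length es2, 2 := of_bool (es2 \<noteq> [])),
       rows_of n S es1 @ rows_of n S es2)"
proof -
  obtain \<mu>1 where 1: "cval v facet_cmd (\<mu>, \<lambda>_. 0, []) = (\<mu>1, \<lambda>_. 0, [])"
    "layout m n S (\<lambda>i. of_bool (i \<in> F)) (\<lambda>_. 0) (\<lambda>_. 0) (\<lambda>_ _. 0) \<mu>1"
    using facet_cmd[OF L v] unfolding F_def by blast
  obtain \<mu>2 U H where 2: "cval v projection_cmd (\<mu>1, \<lambda>_. 0, []) = (\<mu>2, \<lambda>_. 0, [])"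
    "layout m n S (\<lambda>i. of_bool (i \<in> F)) U (\<lambda>_. 0) H \<mu>2"
    "projection m n (diff_column S (\<lambda>i. of_bool (i \<in> F))) H"
    using projection_cmd[OF 1(2) v] by blast
  obtain \<mu>3 where 3: "cval v first_cmd (\<mu>2, \<lambda>_. 0, []) = (\<mu>3, \<lambda>_. 0, [])"
    "layout m n S (\<lambda>i. of_bool (i \<in> F)) U (\<lambda>i. of_bool (i \<in> {p})) H \<mu>3"
    using first_cmd[OF 2(2) v F] by auto
  obtain \<mu>4 where 4: "cval v close_cmd (\<mu>3, \<lambda>_. 0, []) = (\<mu>4, \<lambda>_. 0, [])"
    "layout m n S (\<lambda>i. of_bool (i \<in> F)) U (\<lambda>i. of_bool (i \<in> (close_round m H ^^ m) {p})) H \<mu>4"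
    using close_cmd[OF 3(2) v] by blast
  show thesis
    by (rule that[OF 2(3) refl refl refl])
      (simp only: factor_cmd_def cval.simps(6) 1(1) 2(1) 3(1) 4(1) output_cmd[OF 4(2) v])
qed

lemma cwf_factor_cmd: "cwf factor_cmd"
  by (simp add: factor_cmd_def facet_cmd_def facet_exp_def nonzero_exp_def violation_exp_def
      projection_cmd_def residual_cmd_def residual_exp_def diff_column_exp_def update_cmd_def
      update_exp_def first_cmd_def first_exp_def close_cmd_def round_cmd_def close_exp_def
      output_cmd_def emit_cmd_def complement_exp_def)

text \<open>Both outputs have as many columns as the input. Register \<open>1\<close> still holds
  that number and must be copied before it is overwritten by the first row count.\<close>

definition finish :: prog where
  "finish = Seq (mov 2 1) (Seq (mov 4 1) (Seq (Do (NConst 10 0)) (Seq (Do (NLoad 1 10))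
     (Seq (Do (NConst 10 1)) (Seq (Do (NLoad 3 10)) (Seq (Do (NConst 10 2)) (Do (NLoad 0 10))))))))"

lemma wp_finish:
  "wp finish 10 (\<lambda>s'. nreg s' 0 = nmem s 2 \<and> nreg s' 1 = nmem s 0 \<and> nreg s' 2 = nreg s 1 \<and>
     nreg s' 3 = nmem s 1 \<and> nreg s' 4 = nreg s 1 \<and> tape s' = tape s) s"
proof -
  have "wp finish (2 + (2 + (1 + (1 + (1 + (1 + (1 + 1))))))) (\<lambda>s'. nreg s' 0 = nmem s 2 \<and>
     nreg s' 1 = nmem s 0 \<and> nreg s' 2 = nreg s 1 \<and>
     nreg s' 3 = nmem s 1 \<and> nreg s' 4 = nreg s 1 \<and> tape s' = tape s) s"
    unfolding finish_def
    by (intro wp_Seq wp_Do wp_mov) simp_all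
  then show ?thesis by simp
qed

definition factor_prog :: prog where "factor_prog = Seq (ccomp 10 factor_cmd) finish"

lemma concat_nth_uniform:
  assumes "\<forall>xs\<in>set xss. length xs = n" "i < length xss" "j < n"
  shows "concat xss ! (i * n + j) = xss ! i ! j"
  using assms
proof (induction xss arbitrary: i)
  case (Cons xs xss)
  show ?case
  proof (cases i)
    case 0
    then show ?thesis using Cons.prems by (simp add: nth_append)
  next
    case (Suc k)
    then show ?thesis using Cons by (simp add: nth_append add.assoc)
  qed
qed simp

lemma mat_entries_nth:
  assumes "i < dim_row S" "j < dim_col S"
  shows "mat_entries S ! (i * dim_col S + j) = S $$ (i, j)"
  unfolding mat_entries_def mat_to_list_def using assms
  by (subst concat_nth_uniform) auto

lemma layout_input:
  "layout (dim_row S) (dim_col S) (\<lambda>i j. S $$ (i, j)) (\<lambda>_. 0) (\<lambda>_. 0) (\<lambda>_. 0) (\<lambda>_ _. 0) (rmem (input_state S))"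
  unfolding layout_def input_state_def by (simp add: index_less mat_entries_nth)

lemma projection_cong:
  assumes "projection m n w H" "\<And>l i. l < n \<Longrightarrow> i < m \<Longrightarrow> w l i = w' l i"
  shows "projection m n w' H"
proof -
  have "in_span m n w c \<Longrightarrow> in_span m n w' c" for c
    unfolding in_span_def using assms(2) by auto
  then show ?thesis using assms unfolding projection_def by simp
qed

section \<open>The component decides whether the polytope is a product\<close>

context slack_description
begin

lemma facet_rows_E:
  assumes "\<And>i j. i < m \<Longrightarrow> j < n \<Longrightarrow> r i (v j) = S i j"
  shows "facet_rows m n S = E"
proof -
  have zeros: "Z i = {j. j < n \<and> S i j = 0}" if "i < m" for i
    unfolding Z_def using assms that by auto
  have nonzero: "nz i \<longleftrightarrow> (\<exists>j<n. S i j \<noteq> 0)" if "i < m" for i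
    unfolding nz_def using assms that by auto
  have larger: "Z i \<subset> Z k \<longleftrightarrow> (\<forall>j<n. S i j = 0 \<longrightarrow> S k j = 0) \<and> (\<exists>j<n. S k j = 0 \<and> S i j \<noteq> 0)"
    if "i < m" "k < m" for i k
    unfolding zeros[OF that(1)] zeros[OF that(2)] psubset_eq set_eq_iff subset_iff mem_Collect_eq
    by blast
  have "i \<in> facet_rows m n S \<longleftrightarrow> i \<in> E" for i
  proof (cases "i < m")
    case True
    have "(\<exists>k<m. (\<exists>j<n. S k j \<noteq> 0) \<and> (\<forall>j<n. S i j = 0 \<longrightarrow> S k j = 0) \<and> (\<exists>j<n. S k j = 0 \<and> S i j \<noteq> 0))
      \<longleftrightarrow> (\<exists>k<m. nz k \<and> Z i \<subset> Z k)"
      by (intro ex_cong1 conj_cong refl) (simp_all only: nonzero larger[OF True])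
    then show ?thesis unfolding facet_rows_def E_def mem_Collect_eq nonzero[OF True] by simp
  qed (simp add: facet_rows_def E_def)
  then show ?thesis by blast
qed

lemma mat_entries_row_selection:
  assumes "\<And>i j. i < m \<Longrightarrow> j < n \<Longrightarrow> r i (v j) = S i j" "set es \<subseteq> {..<m}"
  shows "mat_entries (row_selection es) = rows_of n S es"
proof -
  have "mat_to_list (row_selection es) = map (\<lambda>p. map (\<lambda>q. r (es ! p) (v q)) [0..<n]) [0..<length es]"
    unfolding mat_to_list_def row_selection_def by simp
  also have "\<dots> = map (\<lambda>i. map (\<lambda>q. r i (v q)) [0..<n]) es"
    by (rule nth_equalityI) auto
  also have "\<dots> = map (\<lambda>i. map (S i) [0..<n]) es"
    using assms by (intro map_cong refl) auto
  finally show ?thesis unfolding mat_entries_def rows_of_def by simp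
qed

text \<open>No entry of \<open>H\<close> joins \<open>C\<close> to its complement, so
  \<open>C\<close> yields a splitting. Conversely both blocks of any splitting of \<open>P\<close>
  are closed under the edges; the one containing \<open>p\<close> contains \<open>C\<close>, and the
  other one remains outside.\<close>

lemma component_decides:
  assumes pr: "projection m n w H" and "p \<in> E"
  defines "C \<equiv> (close_round m H ^^ m) {p}"
  shows "p \<in> C" "C \<subseteq> E" "splits (affine hull P) C (E - C)"
    "\<lbrakk>E1 \<union> E2 = E; E1 \<inter> E2 = {}; E1 \<noteq> {}; E2 \<noteq> {}; splits P E1 E2\<rbrakk> \<Longrightarrow> E - C \<noteq> {}"
proof -
  have "{p} \<subseteq> {..<m}" using \<open>p \<in> E\<close> unfolding E_def by blast
  note C = iterated_close_round[OF this, of H, folded C_def]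
  show "p \<in> C" using C(2) by blast
  have "closed_under m H E" unfolding closed_under_def using projection_support(2)[OF pr] by blast
  then show "C \<subseteq> E" using C(4) \<open>p \<in> E\<close> by blast
  then show "splits (affine hull P) C (E - C)"
    using C(1) unfolding closed_under_def by (intro splits_if_block[OF pr]) blast+
  assume E12: "E1 \<union> E2 = E" "E1 \<inter> E2 = {}" "E1 \<noteq> {}" "E2 \<noteq> {}" "splits P E1 E2"
  have E21: "E2 \<union> E1 = E" "E2 \<inter> E1 = {}" using E12 by auto
  have "closed_under m H E1" unfolding closed_under_def
    using block_if_splits[OF pr E12(1,2,5)] by blast
  moreover have "closed_under m H E2" unfolding closed_under_def
    using block_if_splits[OF pr E21 splits_commute[OF E12(5)]] by blast
  moreover have "p \<in> E1 \<or> p \<in> E2" using \<open>p \<in> E\<close> E12(1) by blast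
  ultimately have "C \<subseteq> E1 \<or> C \<subseteq> E2" using C(4) by blast
  then show "E - C \<noteq> {}" using E12 by blast
qed

end

theorem theorem2:
  shows "\<exists>(p :: prog) (c :: nat) (k :: nat).
    \<forall>(d :: nat) (P :: (nat \<Rightarrow>\<^sub>0 real) set) (S :: real mat).
      polytope P \<and> P \<subseteq> coord_space d \<and> is_slack_matrix d P S \<and> 2 \<le> mat_rank S \<longrightarrow>
      (\<exists>(t :: nat) (s :: ram_state).
         exec p (input_state S) t s \<and>
         t \<le> c * (dim_row S + dim_col S) ^ k \<and>
         answer s = (if \<exists>d1 P1 d2 P2. is_factorization P d1 P1 d2 P2 then 1 else 0) \<and>
         ((\<exists>d1 P1 d2 P2. is_factorization P d1 P1 d2 P2) \<longrightarrow>
          (\<exists>S1 S2 d1 P1 d2 P2.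
             outputs_matrices s S1 S2 \<and>
             is_factorization P d1 P1 d2 P2 \<and>
             is_slack_matrix d1 P1 S1 \<and> 2 \<le> mat_rank S1 \<and>
             is_slack_matrix d2 P2 S2 \<and> 2 \<le> mat_rank S2)))"
proof -
  \<comment> \<open>The constants depend only on the program; the summand \<open>10\<close> is the
    budget of \<open>finish\<close>.\<close>
  have "poly_bounded (\<lambda>B. ctime B factor_cmd + 10)"
    by (intro poly_bounded_intros poly_bounded_ctime)
  then obtain c k where ck: "\<And>B. 1 \<le> B \<Longrightarrow> ctime B factor_cmd + 10 \<le> c * B ^ k"
    unfolding poly_bounded_def by blast
  show ?thesis
  proof (rule exI[of _ factor_prog], rule exI[of _ c], rule exI[of _ k], intro allI impI)
    fix d :: nat and P :: "(nat \<Rightarrow>\<^sub>0 real) set" and S :: "real mat"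
    assume asm: "polytope P \<and> P \<subseteq> coord_space d \<and> is_slack_matrix d P S \<and> 2 \<le> mat_rank S"
    define m n where "m = dim_row S" and "n = dim_col S"
    define s0 where "s0 = input_state S"
    obtain v a b where sd: "slack_description P m n v a b"
      and rS: "\<And>i j. i < m \<Longrightarrow> j < n \<Longrightarrow> slack_description.r a b i (v j) = S $$ (i, j)"
      using slack_matrix_description asm unfolding m_def n_def by metis
    interpret slack_description P m n v a b by (rule sd)
    \<comment> \<open>The row singled out by \<open>first_cmd\<close>.\<close>
    define p where "p = (LEAST i. i \<in> E)"
    have pE: "p \<in> E" unfolding p_def using E_nonempty by (metis LeastI ex_in_conv)
    have p_least: "i \<notin> E" if "i < p" for i using that not_less_Least unfolding p_def by blast
    have FE: "facet_rows m n (\<lambda>i j. S $$ (i, j)) = E" by (rule facet_rows_E) (rule rS)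
    have L: "layout m n (\<lambda>i j. S $$ (i, j)) (\<lambda>_. 0) (\<lambda>_. 0) (\<lambda>_. 0) (\<lambda>_ _. 0) (rmem s0)"
      unfolding m_def n_def s0_def by (rule layout_input)
    have s0: "nreg s0 0 = m" "nreg s0 (Suc 0) = n" "nmem s0 = (\<lambda>_. 0)" "tape s0 = []"
      unfolding s0_def m_def n_def input_state_def by auto
    obtain \<mu>' H C es1 es2 where
      pr: "projection m n (diff_column (\<lambda>i j. S $$ (i, j)) (\<lambda>i. of_bool (i \<in> E))) H"
      and C: "C = (close_round m H ^^ m) {p}"
      and es: "es1 = filter (\<lambda>i. i \<in> C) [0..<m]" "es2 = filter (\<lambda>i. i \<in> E - C) [0..<m]"
      and final: "cval (nreg s0) factor_cmd (rmem s0, \<lambda>_. 0, []) =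
        (\<mu>', (\<lambda>_. 0)(0 := length es1, 1 := length es2, 2 := of_bool (es2 \<noteq> [])),
         rows_of n (\<lambda>i j. S $$ (i, j)) es1 @ rows_of n (\<lambda>i j. S $$ (i, j)) es2)"
      by (rule factor_cmd[OF L s0(1,2), unfolded FE, OF pE]) (rule p_least, assumption, rule that)
    have prw: "projection m n w H"
      by (rule projection_cong[OF pr]) (use rS n_pos in \<open>auto simp: w_def diff_column_def\<close>)
    note comp = component_decides[OF prw pE, folded C]
    have "E \<subseteq> {..<m}" unfolding E_def by blast
    then have sets: "set es1 = C" "set es2 = E - C" using comp(2) unfolding es by auto
    have selection: "mat_entries (row_selection es) = rows_of n (\<lambda>i j. S $$ (i, j)) es"
      if "set es \<subseteq> E" for es
      using that \<open>E \<subseteq> {..<m}\<close> by (intro mat_entries_row_selection rS) auto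
    \<comment> \<open>Initially only registers \<open>0\<close> and \<open>1\<close> are nonzero, so
      \<open>m + n\<close> serves as the bound \<open>B\<close> for all variables.\<close>
    have bound: "\<forall>x<10. nreg s0 x \<le> m + n" unfolding s0_def m_def n_def input_state_def by auto
    have "wp (ccomp 10 factor_cmd) (ctime (m + n) factor_cmd) (\<lambda>s'.
        (rmem s', nmem s', tape s') = cval (nreg s0) factor_cmd (rmem s0, \<lambda>_. 0, []) \<and>
        (\<forall>x<10. nreg s' x = nreg s0 x)) s0"
      using ccomp_correct[OF cwf_factor_cmd order.refl _ bound, of s0] s0 by auto
    then have "wp factor_prog (ctime (m + n) factor_cmd + 10) (\<lambda>s. nreg s 0 = of_bool (es2 \<noteq> []) \<and>
        nreg s 1 = length es1 \<and> nreg s 2 = n \<and> nreg s 3 = length es2 \<and> nreg s 4 = n \<and>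
        tape s = rows_of n (\<lambda>i j. S $$ (i, j)) es1 @ rows_of n (\<lambda>i j. S $$ (i, j)) es2) s0"
      unfolding factor_prog_def
      by (intro wp_Seq) (erule wp_mono[OF _ order.refl], rule wp_mono[OF wp_finish order.refl],
          use s0 in \<open>auto simp: final\<close>)
    then obtain t s where t: "exec factor_prog s0 t s" "t \<le> ctime (m + n) factor_cmd + 10"
      and s: "nreg s 0 = of_bool (es2 \<noteq> [])" "nreg s 1 = length es1" "nreg s 2 = n"
        "nreg s 3 = length es2" "nreg s 4 = n"
        "tape s = rows_of n (\<lambda>i j. S $$ (i, j)) es1 @ rows_of n (\<lambda>i j. S $$ (i, j)) es2"
      unfolding wp_def by blast
    have out: "outputs_matrices s (row_selection es1) (row_selection es2)"
      unfolding outputs_matrices_def using s selection sets comp(2) by (simp add: row_selection_def)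
    have found: "\<exists>d1 P1 d2 P2. is_factorization P d1 P1 d2 P2 \<and>
        is_slack_matrix d1 P1 (row_selection es1) \<and> 2 \<le> mat_rank (row_selection es1) \<and>
        is_slack_matrix d2 P2 (row_selection es2) \<and> 2 \<le> mat_rank (row_selection es2)" if "es2 \<noteq> []"
      by (rule splits_factorization[OF sd]) (use sets comp that in auto)
    have complete: "es2 \<noteq> []" if "\<exists>d1 P1 d2 P2. is_factorization P d1 P1 d2 P2"
    proof -
      from that obtain d1 P1 d2 P2 where "is_factorization P d1 P1 d2 P2" by blast
      from factorization_splits[OF sd this] have "E - C \<noteq> {}" using comp(4) by blast
      then show ?thesis using sets by auto
    qed
    have iff: "(\<exists>d1 P1 d2 P2. is_factorization P d1 P1 d2 P2) \<longleftrightarrow> es2 \<noteq> []"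
      using found complete by blast
    show "\<exists>t s. exec factor_prog (input_state S) t s \<and>
         t \<le> c * (dim_row S + dim_col S) ^ k \<and>
         answer s = (if \<exists>d1 P1 d2 P2. is_factorization P d1 P1 d2 P2 then 1 else 0) \<and>
         ((\<exists>d1 P1 d2 P2. is_factorization P d1 P1 d2 P2) \<longrightarrow>
          (\<exists>S1 S2 d1 P1 d2 P2.
             outputs_matrices s S1 S2 \<and>
             is_factorization P d1 P1 d2 P2 \<and>
             is_slack_matrix d1 P1 S1 \<and> 2 \<le> mat_rank S1 \<and>
             is_slack_matrix d2 P2 S2 \<and> 2 \<le> mat_rank S2))"
    proof (rule exI[of _ t], rule exI[of _ s], intro conjI impI)
      show "exec factor_prog (input_state S) t s" using t(1) unfolding s0_def .
      \<comment> \<open>The polynomial bound holds for arguments from \<open>1\<close> on;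
        \<open>P\<close> has at least one listed point.\<close>
      have "1 \<le> m + n" using n_pos by simp
      then show "t \<le> c * (dim_row S + dim_col S) ^ k"
        using t(2) ck[of "m + n"] unfolding m_def n_def by linarith
      show "answer s = (if \<exists>d1 P1 d2 P2. is_factorization P d1 P1 d2 P2 then 1 else 0)"
        unfolding iff answer_def s(1) by simp
      assume "\<exists>d1 P1 d2 P2. is_factorization P d1 P1 d2 P2"
      then show "\<exists>S1 S2 d1 P1 d2 P2.
             outputs_matrices s S1 S2 \<and>
             is_factorization P d1 P1 d2 P2 \<and>
             is_slack_matrix d1 P1 S1 \<and> 2 \<le> mat_rank S1 \<and>
             is_slack_matrix d2 P2 S2 \<and> 2 \<le> mat_rank S2"
        using out found complete by blast
    qed
  qed
qed

end
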